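(* Let $d<n$ be positive integers and let $\mathcal{M}\subseteq\mathcal{F}\times\mathcal{P}$ be a class of models $(\mathbf{f},p_{\mathbf{z}})$, with latent variables $\mathbf{z}\in\mathbb{R}^d$ of law $p_{\mathbf{z}}$ and observations $\mathbf{x}=\mathbf{f}(\mathbf{z})\in\mathbb{R}^n$ lying on a $d$-dimensional manifold, such that: (1) $\mathcal{M}$ satisfies the functional orthogonality assumption (defined in the context); (2) for every $(\mathbf{f},p_{\mathbf{z}})\in\mathcal{M}$, the latent distribution $p_{\mathbf{z}}$ satisfies the full-support assumption (defined in the context). Then the generative process is identifiable on $\mathcal{M}$: for all $(\mathbf{f},p_{\mathbf{z}}),(\mathbf{g},p_{\hat{\mathbf{z}}})\in\mathcal{M}$ with $\mathbf{f}_*p_{\mathbf{z}}=\mathbf{g}_*p_{\hat{\mathbf{z}}}$, there exist a permutation of coordinates $\mathbf{P}$ and an element-wise reparameterization $\mathbf{t}$ such that $$\mathbf{f}=\mathbf{g}\circ(\mathbf{P}\circ\mathbf{t})^{-1}\quad\text{and}\quad p_{\mathbf{z}}=(\mathbf{P}\circ\mathbf{t})_*p_{\hat{\mathbf{z}}}.$$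
   Context: Notation. $\mathcal{F}$ is the set of all real-analytic and invertible functions $\mathbf{f}:\mathbb{R}^d\to\mathbb{R}^n$ (invertible: a diffeomorphism onto its image). $\mathcal{P}$ is the set of all probability densities on $\mathbb{R}^d$ with simply connected support. The latent domain of a model $(\mathbf{f},p_{\mathbf{z}})$ is the support of $p_{\mathbf{z}}$. $\mathbf{f}_*p$ denotes the pushforward of $p$ through $\mathbf{f}$. An element-wise reparameterization is a map $\mathbf{t}(z)=(t_1(z_1),\dots,t_d(z_d))$ with every $t_i$ invertible (strictly monotone) and smooth. Equality of $\mathbf{f}$ and $\mathbf{g}\circ(\mathbf{P}\circ\mathbf{t})^{-1}$ is understood on the latent domain. $J_{\mathbf{f}}$ is the $n\times d$ Jacobian of $\mathbf{f}$, with columns $\partial\mathbf{f}/\partial z_i$. Standing convention: two models of $\mathcal{M}$ with $\mathbf{f}_*p_{\mathbf{z}}=\mathbf{g}_*p_{\hat{\mathbf{z}}}$ are diffeomorphisms of their latent domains onto the same $d$-dimensional manifold of observations. Functional orthogonality assumption on $\mathcal{M}$. (a) For every $(\mathbf{f},p_{\mathbf{z}})\in\mathcal{M}$, at every point and for all $i\ne j$, $(\partial\mathbf{f}/\partial z_i)^{\top}(\partial\mathbf{f}/\partial z_j)=0$; equivalently $J_{\mathbf{f}}=Q_{\mathbf{f}}D_{\mathbf{f}}$ with $D_{\mathbf{f}}$ diagonal with positive entries (the column norms) and $Q_{\mathbf{f}}\in\mathbb{R}^{n\times d}$ with orthonormal columns. (b) For any $\mathbf{f},\mathbf{g}$ occurring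 in $\mathcal{M}$ that are related by a diffeomorphism $h$ of their latent domains, $\mathbf{g}=\mathbf{f}\circ h$, the relative frame $R(u):=Q_{\mathbf{f}}(h(u))^{\top}Q_{\mathbf{g}}(u)\in O(d)$ satisfies, at every point $u$: if $\partial_i^{\,k}R(u)=0$ for all $i\in\{1,\dots,d\}$ and all $k\ge1$, then $\partial^{\alpha}R(u)=0$ for all multi-indices $\alpha$ with $|\alpha|\ge1$. Full-support assumption on $p_{\mathbf{z}}$. The distribution $p_{\mathbf{z}}$ is supported on a bounded, simply connected region $\Omega\subset\mathbb{R}^d$ such that, up to a continuous strictly monotone coordinate-wise reparameterization, $\Omega$ is a hypercube; equivalently, the copula associated with $p_{\mathbf{z}}$ has full support on $[0,1]^d$. *)

theory Defs
  imports "HOL-Analysis.Analysis"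
begin

section \<open>Smooth and analytic maps\<close>

text \<open>For an open set \<open>U\<close> of a Euclidean space, \<open>Ck_on k U f\<close> says that \<open>f\<close> is \<open>k\<close> times
  continuously differentiable on \<open>U\<close>: all iterated directional derivatives up to order \<open>k\<close> exist
  and are continuous.\<close>

primrec Ck_on :: "nat \<Rightarrow> 'a::real_normed_vector set \<Rightarrow> ('a \<Rightarrow> 'b::real_normed_vector) \<Rightarrow> bool" where
  "Ck_on 0 U f \<longleftrightarrow> continuous_on U f"
| "Ck_on (Suc k) U f \<longleftrightarrow>
     (\<forall>x\<in>U. f differentiable (at x)) \<and> (\<forall>v. Ck_on k U (\<lambda>x. frechet_derivative f (at x) v))"

definition smooth_on_open :: "'a::real_normed_vector set \<Rightarrow> ('a \<Rightarrow> 'b::real_normed_vector) \<Rightarrow> bool" where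
  "smooth_on_open U f \<longleftrightarrow> open U \<and> (\<forall>k. Ck_on k U f)"

text \<open>Smoothness on an arbitrary subset of a Euclidean space (a closed box, an embedded
  submanifold, ...): locally the map is the restriction of a smooth map on an open set of the
  ambient space.\<close>

definition smooth_map_on :: "'a::euclidean_space set \<Rightarrow> ('a \<Rightarrow> 'b::euclidean_space) \<Rightarrow> bool" where
  "smooth_map_on S f \<longleftrightarrow>
     (\<forall>x\<in>S. \<exists>U F. x \<in> U \<and> smooth_on_open U F \<and> (\<forall>y\<in>S \<inter> U. F y = f y))"

definition diffeomorphism_betw ::
    "'a::euclidean_space set \<Rightarrow> 'b::euclidean_space set \<Rightarrow> ('a \<Rightarrow> 'b) \<Rightarrow> bool" where
  "diffeomorphism_betw S T h \<longleftrightarrow>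
     bij_betw h S T \<and> smooth_map_on S h \<and> smooth_map_on T (inv_into S h)"

text \<open>Real analyticity on the whole space; the coefficients of the power series are indexed by the
  multi-indices \<open>\<alpha> :: 'd \<Rightarrow> nat\<close>.\<close>

definition real_analytic :: "(real^'d::finite \<Rightarrow> 'b::euclidean_space) \<Rightarrow> bool" where
  "real_analytic f \<longleftrightarrow>
     (\<forall>a. \<exists>r>0. \<exists>c :: ('d \<Rightarrow> nat) \<Rightarrow> 'b. \<forall>z\<in>ball a r.
        ((\<lambda>\<alpha>. (\<Prod>i\<in>UNIV. (z $ i - a $ i) ^ \<alpha> i) *\<^sub>R c \<alpha>) has_sum f z) UNIV)"

section \<open>Models\<close>

definition mixing_functions :: "(real^'d::finite \<Rightarrow> real^'n::finite) set" where
  "mixing_functions = {f. real_analytic f \<and> diffeomorphism_betw UNIV (range f) f}"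

definition latent_law :: "(real^'d::finite \<Rightarrow> real) \<Rightarrow> (real^'d) measure" where
  "latent_law p = density lborel (\<lambda>z. ennreal (p z))"

text \<open>The topological support of the law with density \<open>p\<close>; it is closed and does not depend on the
  choice of the density within its almost-everywhere class.\<close>

definition latent_domain :: "(real^'d::finite \<Rightarrow> real) \<Rightarrow> (real^'d) set" where
  "latent_domain p = {z. \<forall>U. open U \<and> z \<in> U \<longrightarrow> emeasure (latent_law p) U > 0}"

definition latent_densities :: "(real^'d::finite \<Rightarrow> real) set" where
  "latent_densities =
     {p. p \<in> borel_measurable borel \<and> (\<forall>z. 0 \<le> p z) \<and>
         (\<integral>\<^sup>+ z. ennreal (p z) \<partial>lborel) = 1 \<and> simply_connected (latent_domain p)}"

definition pushforward :: "(real^'d::finite \<Rightarrow> real^'m::finite) \<Rightarrow> (real^'d) measure \<Rightarrow> (real^'m) measure" where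
  "pushforward f \<mu> = distr \<mu> borel f"

section \<open>Functional orthogonality\<close>

definition column_norms :: "(real^'d::finite \<Rightarrow> real^'n::finite) \<Rightarrow> real^'d \<Rightarrow> real^'d^'d" where
  "column_norms f z = (\<chi> i j. if i = j then norm (column i (jacobian f (at z))) else 0)"

text \<open>The factor \<open>Q\<close> in \<open>jacobian f (at z) = Q ** column_norms f z\<close>: the Jacobian with
  normalized columns.\<close>

definition frame :: "(real^'d::finite \<Rightarrow> real^'n::finite) \<Rightarrow> real^'d \<Rightarrow> real^'d^'n" where
  "frame f z = (\<chi> k i. jacobian f (at z) $ k $ i / column_norms f z $ i $ i)"

definition relative_frame ::
    "(real^'d::finite \<Rightarrow> real^'n::finite) \<Rightarrow> (real^'d \<Rightarrow> real^'n) \<Rightarrow> (real^'d \<Rightarrow> real^'d)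
      \<Rightarrow> real^'d \<Rightarrow> real^'d^'d" where
  "relative_frame f g h u = transpose (frame f (h u)) ** frame g u"

text \<open>Partial derivatives of a map that is only meaningful on \<open>S\<close>, such as a relative frame, which
  lives on a latent domain: the variable stays inside \<open>S\<close>. On a box this is the usual partial
  derivative at interior points and the one-sided one at boundary points.\<close>

definition partial_within ::
    "(real^'d::finite) set \<Rightarrow> 'd \<Rightarrow> (real^'d \<Rightarrow> 'b::real_normed_vector) \<Rightarrow> real^'d \<Rightarrow> 'b" where
  "partial_within S i F u =
     vector_derivative (\<lambda>s. F (u + s *\<^sub>R axis i 1)) (at 0 within {s. u + s *\<^sub>R axis i 1 \<in> S})"

text \<open>The derivative for a multi-index \<open>\<alpha>\<close>, given by any list of coordinates in which each
  coordinate \<open>i\<close> occurs \<open>\<alpha> i\<close> times; its order is the length of the list.\<close>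

definition mixed_partial_within ::
    "(real^'d::finite) set \<Rightarrow> 'd list \<Rightarrow> (real^'d \<Rightarrow> 'b::real_normed_vector) \<Rightarrow> real^'d \<Rightarrow> 'b" where
  "mixed_partial_within S is F = foldr (partial_within S) is F"

definition orthogonal_columns :: "(real^'d::finite \<Rightarrow> real^'n::finite) \<Rightarrow> bool" where
  "orthogonal_columns f \<longleftrightarrow>
     (\<forall>z i j. i \<noteq> j \<longrightarrow> column i (jacobian f (at z)) \<bullet> column j (jacobian f (at z)) = 0)"

definition pure_partials_control_mixed ::
    "(real^'d::finite) set \<Rightarrow> (real^'d \<Rightarrow> 'b::real_normed_vector) \<Rightarrow> bool" where
  "pure_partials_control_mixed S R \<longleftrightarrow>
     (\<forall>u\<in>S. (\<forall>i. \<forall>k\<ge>1. mixed_partial_within S (replicate k i) R u = 0)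
        \<longrightarrow> (\<forall>is. length is \<ge> 1 \<longrightarrow> mixed_partial_within S is R u = 0))"

definition functional_orthogonality ::
    "((real^'d::finite \<Rightarrow> real^'n::finite) \<times> (real^'d \<Rightarrow> real)) set \<Rightarrow> bool" where
  "functional_orthogonality M \<longleftrightarrow>
     (\<forall>(f, p)\<in>M. orthogonal_columns f) \<and>
     (\<forall>(f, p)\<in>M. \<forall>(g, q)\<in>M. \<forall>h.
        diffeomorphism_betw (latent_domain q) (latent_domain p) h \<and>
        (\<forall>u\<in>latent_domain q. g u = f (h u))
        \<longrightarrow> pure_partials_control_mixed (latent_domain q) (relative_frame f g h))"

section \<open>Full support and reparameterizations\<close>

text \<open>The reparameterization in this definition is only needed on the coordinate projections of the
  support, as for the marginal distribution functions that define the copula.\<close>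

definition strictly_monotone_on :: "real set \<Rightarrow> (real \<Rightarrow> real) \<Rightarrow> bool" where
  "strictly_monotone_on A \<phi> \<longleftrightarrow> strict_mono_on A \<phi> \<or> strict_antimono_on A \<phi>"

definition coordinatewise :: "('d \<Rightarrow> real \<Rightarrow> real) \<Rightarrow> real^'d::finite \<Rightarrow> real^'d" where
  "coordinatewise \<phi> z = (\<chi> i. \<phi> i (z $ i))"

definition full_support :: "(real^'d::finite \<Rightarrow> real) \<Rightarrow> bool" where
  "full_support p \<longleftrightarrow>
     bounded (latent_domain p) \<and> simply_connected (latent_domain p) \<and>
     (\<exists>\<phi>. (\<forall>i. continuous_on ((\<lambda>z. z $ i) ` latent_domain p) (\<phi> i) \<and>
               strictly_monotone_on ((\<lambda>z. z $ i) ` latent_domain p) (\<phi> i)) \<and>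
          coordinatewise \<phi> ` latent_domain p = cbox 0 1)"

definition elementwise_reparameterization :: "(real^'d::finite \<Rightarrow> real^'d) \<Rightarrow> bool" where
  "elementwise_reparameterization t \<longleftrightarrow>
     (\<exists>\<tau>. (\<forall>i. strictly_monotone_on UNIV (\<tau> i) \<and> smooth_on_open UNIV (\<tau> i)) \<and>
          t = coordinatewise \<tau>)"

definition coordinate_permutation :: "(real^'d::finite \<Rightarrow> real^'d) \<Rightarrow> bool" where
  "coordinate_permutation P \<longleftrightarrow> (\<exists>\<pi>. bij \<pi> \<and> P = (\<lambda>z. \<chi> i. z $ \<pi> i))"

end

theory Submission
  imports Defs "HOL-Complex_Analysis.Conformal_Mappings"
begin

text \<open>
  Full support forces both latent domains to be boxes, and equal laws of the observations force
  \<open>f\<close> and \<open>g\<close> to map them onto the same set, so \<open>g = f \<circ> h\<close> for a diffeomorphism \<open>h\<close> between the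
  boxes. At a point with at most one free coordinate, \<open>h\<close> and its inverse respect the tangent cones
  of the boxes; together with the orthogonality of the columns this makes the relative frame a signed
  permutation matrix there. It is therefore constant along the edges through a corner, all its pure
  partial derivatives at the corner vanish, and by assumption so do the mixed ones: the
  relative frame is constant to infinite order at the corner. Let \<open>H\<close> be the coordinatewise map (up
  to a permutation) that agrees with \<open>h\<close> on these edges. Then \<open>H - h\<close> vanishes to infinite
  order at the corner. The components of \<open>H\<close> are one-variable analytic inverses, so
  \<open>f \<circ> H - g\<close> is analytic along every segment from the corner and flat at the corner, hence
  zero. Working with \<open>H\<close> avoids the analytic inverse function theorem in several variables.
\<close>

section \<open>Smooth maps\<close>

text \<open>Since the columns of \<open>f\<close> are orthogonal, the derivative of \<open>h\<close>
  is the matrix of inner products of the columns of \<open>f\<close> at \<open>h u\<close> with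
  those of \<open>g\<close> at \<open>u\<close>, up to positive factors on the rows. An extreme
  coordinate of \<open>h u\<close> can only move inwards, which fixes signs of entries; a free
  coordinate of \<open>u\<close> can move both ways, which forces zeros against extreme coordinates
  of \<open>h u\<close>, and the same holds for the inverse. An entry that pairs a free coordinate
  of \<open>u\<close> with a free coordinate of \<open>h u\<close> escapes both arguments. With two
  free coordinates of \<open>u\<close> the method therefore stops: only edges are reached, and the
  passage from pure to mixed partial derivatives has to come from the assumption. Flatness of a
  smooth map at one point says nothing about its other values, and \<open>h\<close> is only known to
  be smooth; analyticity has to come from \<open>f\<close> and \<open>g\<close>. It is needed along
  segments that end at the corner, hence a notion of analyticity that makes sense at end points.
  Finally, each coordinate map lives on an interval, while a reparameterization is monotone and
  smooth on the whole line, hence the extension results.\<close>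

lemma frechet_derivative_cong_open:
  assumes "open U" "x \<in> U" "\<And>y. y \<in> U \<Longrightarrow> f y = g y"
  shows "frechet_derivative f (at x) = frechet_derivative g (at x)"
proof -
  \<comment> \<open>\<open>frechet_derivative\<close> is a choice among all derivatives, so
    equivalent predicates give equal choices, also at points where no derivative exists.\<close>
  have "(f has_derivative D) (at x) \<longleftrightarrow> (g has_derivative D) (at x)" for D
    using has_derivative_transform_within_open[OF _ assms(1,2)] assms(3) by metis
  then show ?thesis
    by (simp add: frechet_derivative_def)
qed

lemma differentiable_cong_open:
  assumes "open U" "x \<in> U" "\<And>y. y \<in> U \<Longrightarrow> f y = g y"
  shows "f differentiable (at x) \<longleftrightarrow> g differentiable (at x)"
  unfolding differentiable_def
  using has_derivative_transform_within_open[OF _ assms(1,2)] assms(3) by metis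

lemma Ck_on_cong:
  assumes "open U" "\<And>x. x \<in> U \<Longrightarrow> f x = g x"
  shows "Ck_on k U f \<longleftrightarrow> Ck_on k U g"
  using assms(2)
proof (induction k arbitrary: f g)
  case 0
  then show ?case by (auto intro: continuous_on_cong)
next
  case (Suc k)
  have "f differentiable (at x) \<longleftrightarrow> g differentiable (at x)" if "x \<in> U" for x
    using differentiable_cong_open[OF assms(1) that] Suc.prems by blast
  moreover have "Ck_on k U (\<lambda>x. frechet_derivative f (at x) v)
      \<longleftrightarrow> Ck_on k U (\<lambda>x. frechet_derivative g (at x) v)" for v
    by (rule Suc.IH) (use frechet_derivative_cong_open[OF assms(1)] Suc.prems in metis)
  ultimately show ?case by simp
qed

lemma Ck_on_subset: "Ck_on k U f \<Longrightarrow> V \<subseteq> U \<Longrightarrow> Ck_on k V f"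
  by (induction k arbitrary: f) (auto intro: continuous_on_subset)

lemma Ck_on_Union:
  assumes "\<And>x. x \<in> U \<Longrightarrow> \<exists>V. open V \<and> x \<in> V \<and> Ck_on k V f"
  shows "Ck_on k U f"
  using assms
proof (induction k arbitrary: f)
  case 0
  have "continuous (at x) f" if "x \<in> U" for x
    using 0[OF that] by (auto simp: continuous_on_eq_continuous_at)
  then show ?case
    by (simp add: continuous_at_imp_continuous_on)
next
  case (Suc k)
  have "Ck_on k U (\<lambda>x. frechet_derivative f (at x) v)" for v
    by (rule Suc.IH) (use Suc.prems in fastforce)
  moreover have "f differentiable (at x)" if "x \<in> U" for x
    using Suc.prems[OF that] by auto
  ultimately show ?case by simp
qed

text \<open>Lets an explicit formula stand for the derivative that \<open>Ck_on\<close> obtains by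
  choice; the closure properties below reduce to a lower order through it.\<close>

lemma Ck_on_SucI:
  assumes "open U" "\<And>x. x \<in> U \<Longrightarrow> (f has_derivative f' x) (at x)"
    and "\<And>v. Ck_on k U (\<lambda>x. f' x v)"
  shows "Ck_on (Suc k) U f"
proof -
  have "Ck_on k U (\<lambda>x. frechet_derivative f (at x) v)" for v
    by (rule Ck_on_cong[OF assms(1), THEN iffD2, OF _ assms(3)[of v]])
      (use frechet_derivative_at[OF assms(2)] in metis)
  then show ?thesis
    using assms(2) by (auto simp: differentiable_def)
qed

lemma Ck_on_Suc_has_derivative:
  "Ck_on (Suc k) U f \<Longrightarrow> x \<in> U \<Longrightarrow> (f has_derivative frechet_derivative f (at x)) (at x)"
  by (simp add: frechet_derivative_works)

lemma Ck_on_Suc_D: "Ck_on (Suc k) U f \<Longrightarrow> Ck_on k U f"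
proof (induction k arbitrary: f)
  case 0
  then show ?case
    by (auto intro!: continuous_at_imp_continuous_on differentiable_imp_continuous_within)
next
  case (Suc k)
  have "Ck_on k U (\<lambda>x. frechet_derivative f (at x) v)" for v
    by (rule Suc.IH) (use Suc.prems Ck_on.simps(2)[of "Suc k" U f] in blast)
  then show ?case
    using Suc.prems Ck_on.simps(2)[of "Suc k" U f] by simp
qed

section \<open>Sums, products and composites of \<open>k\<close> times continuously differentiable
  maps\<close>

lemma Ck_on_const: "open U \<Longrightarrow> Ck_on k U (\<lambda>x. c)"
proof (induction k arbitrary: c)
  case (Suc k)
  show ?case
    by (rule Ck_on_SucI[where f' = "\<lambda>x v. 0"]) (use Suc in simp_all)
qed auto

lemma Ck_on_bounded_linear:
  assumes "bounded_linear T" "open U"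
  shows "Ck_on k U T"
proof (cases k)
  case 0
  then show ?thesis
    using assms by (simp add: linear_continuous_on)
next
  case (Suc k')
  then show ?thesis
    using Ck_on_SucI[of U T "\<lambda>x. T" k', OF assms(2) bounded_linear_imp_has_derivative[OF assms(1)]
        Ck_on_const[OF assms(2)]] by blast
qed

lemma Ck_on_add:
  assumes "open U" "Ck_on k U f" "Ck_on k U g"
  shows "Ck_on k U (\<lambda>x. f x + g x)"
  using assms(2,3)
proof (induction k arbitrary: f g)
  case (Suc k)
  show ?case
    by (rule Ck_on_SucI[OF assms(1), where
        f' = "\<lambda>x v. frechet_derivative f (at x) v + frechet_derivative g (at x) v"])
      (use Suc in \<open>simp_all add: has_derivative_add frechet_derivative_works[symmetric]\<close>)
qed (auto intro: continuous_intros)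

lemma Ck_on_sum:
  assumes "open U" "finite A" "\<And>i. i \<in> A \<Longrightarrow> Ck_on k U (f i)"
  shows "Ck_on k U (\<lambda>x. \<Sum>i\<in>A. f i x)"
  using assms(2,3)
proof (induction A)
  case empty
  then show ?case by (simp add: Ck_on_const assms(1))
next
  case (insert a A)
  then show ?case by (simp add: Ck_on_add assms(1))
qed

text \<open>The product rule yields a sum of products of the same kind, so the induction on the
  order closes. One proof serves scaling, multiplication and the inner product.\<close>

lemma (in bounded_bilinear) Ck_on:
  assumes "open U" "Ck_on k U f" "Ck_on k U g"
  shows "Ck_on k U (\<lambda>x. prod (f x) (g x))"
  using assms(2,3)
proof (induction k arbitrary: f g)
  case 0
  then show ?case by (simp add: continuous_on)
next
  case (Suc k)
  show ?case
  proof (rule Ck_on_SucI[OF assms(1), where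
        f' = "\<lambda>x v. prod (f x) (frechet_derivative g (at x) v) + prod (frechet_derivative f (at x) v) (g x)"])
    show "((\<lambda>x. prod (f x) (g x)) has_derivative
        (\<lambda>v. prod (f x) (frechet_derivative g (at x) v) + prod (frechet_derivative f (at x) v) (g x))) (at x)"
      if "x \<in> U" for x
      using FDERIV[OF Ck_on_Suc_has_derivative Ck_on_Suc_has_derivative] Suc.prems that by blast
    show "Ck_on k U (\<lambda>x. prod (f x) (frechet_derivative g (at x) v) + prod (frechet_derivative f (at x) v) (g x))" for v
      by (intro Ck_on_add assms Suc.IH Ck_on_Suc_D[OF Suc.prems(1)] Ck_on_Suc_D[OF Suc.prems(2)])
        (use Suc.prems in auto)
  qed
qed

lemmas Ck_on_scaleR = bounded_bilinear.Ck_on[OF bounded_bilinear_scaleR]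
lemmas Ck_on_mult = bounded_bilinear.Ck_on[OF bounded_bilinear_mult]
lemmas Ck_on_inner = bounded_bilinear.Ck_on[OF bounded_bilinear_inner]

text \<open>Kept apart from general composition because the intermediate space is an arbitrary
  normed space here.\<close>

lemma Ck_on_linear_comp:
  assumes "bounded_linear T" "open U" "Ck_on k U f"
  shows "Ck_on k U (\<lambda>x. T (f x))"
  using assms(3)
proof (induction k arbitrary: f)
  case 0
  then show ?case
    using assms(1) bounded_linear.continuous_on by auto
next
  case (Suc k)
  show ?case
    by (rule Ck_on_SucI[OF assms(2), where f' = "\<lambda>x v. T (frechet_derivative f (at x) v)"])
      (use Suc in \<open>simp_all add: bounded_linear.has_derivative[OF assms(1)] frechet_derivative_works[symmetric]\<close>)
qed

text \<open>The induction hypothesis covers derivatives of \<open>f\<close> in fixed directions,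
  whereas the chain rule evaluates them in a direction that moves with \<open>x\<close>. Expanding
  that direction in the basis separates the two: the coefficients come from \<open>h\<close>, and
  the derivatives of \<open>f\<close> along basis vectors are composed with
  \<open>h\<close>.\<close>

lemma Ck_on_compose:
  fixes h :: "'a::real_normed_vector \<Rightarrow> 'b::euclidean_space" and f :: "'b \<Rightarrow> 'c::real_normed_vector"
  assumes "open U" "open V" "h ` U \<subseteq> V" "Ck_on k V f" "Ck_on k U h"
  shows "Ck_on k U (\<lambda>x. f (h x))"
  using assms(4,5)
proof (induction k arbitrary: f)
  case 0
  then show ?case
    using continuous_on_compose2[of V f U h, OF _ _ assms(3)] by simp
next
  case (Suc k)
  let ?D = "\<lambda>x v. frechet_derivative h (at x) v"
  show ?case
  proof (rule Ck_on_SucI[OF assms(1), where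
        f' = "\<lambda>x v. \<Sum>b\<in>Basis. (?D x v \<bullet> b) *\<^sub>R frechet_derivative f (at (h x)) b"])
    fix x assume x: "x \<in> U"
    then have hx: "h x \<in> V" using assms(3) by blast
    have df: "(f has_derivative frechet_derivative f (at (h x))) (at (h x))"
      by (rule Ck_on_Suc_has_derivative[OF Suc.prems(1) hx])
    have der: "((\<lambda>x. f (h x)) has_derivative (\<lambda>v. frechet_derivative f (at (h x)) (?D x v))) (at x)"
      using has_derivative_compose[OF Ck_on_Suc_has_derivative[OF Suc.prems(2) x] df] .
    have lin: "frechet_derivative f (at (h x)) w
        = (\<Sum>b\<in>Basis. (w \<bullet> b) *\<^sub>R frechet_derivative f (at (h x)) b)" for w
    proof -
      have "linear (frechet_derivative f (at (h x)))"
        using df has_derivative_linear by blast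
      then have "frechet_derivative f (at (h x)) (\<Sum>b\<in>Basis. (w \<bullet> b) *\<^sub>R b)
          = (\<Sum>b\<in>Basis. (w \<bullet> b) *\<^sub>R frechet_derivative f (at (h x)) b)"
        by (simp only: linear_sum linear_cmul)
      then show ?thesis
        by (simp only: euclidean_representation)
    qed
    show "((\<lambda>x. f (h x)) has_derivative
        (\<lambda>v. \<Sum>b\<in>Basis. (?D x v \<bullet> b) *\<^sub>R frechet_derivative f (at (h x)) b)) (at x)"
      by (rule has_derivative_eq_rhs[OF der ext[OF lin]])
  next
    fix v
    have "Ck_on k U (\<lambda>x. frechet_derivative f (at (h x)) b)" for b
      by (rule Suc.IH[OF _ Ck_on_Suc_D[OF Suc.prems(2)]]) (use Suc.prems(1) in simp)
    moreover have "Ck_on k U (\<lambda>x. ?D x v \<bullet> b)" for b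
      by (rule Ck_on_inner[OF assms(1) _ Ck_on_const[OF assms(1)]]) (use Suc.prems(2) in simp)
    ultimately show "Ck_on k U (\<lambda>x. \<Sum>b\<in>Basis. (?D x v \<bullet> b) *\<^sub>R frechet_derivative f (at (h x)) b)"
      by (intro Ck_on_sum[OF assms(1) finite_Basis] Ck_on_scaleR[OF assms(1)])
  qed
qed

lemma smooth_on_openD:
  assumes "smooth_on_open U f"
  shows "open U" "\<And>k. Ck_on k U f" "continuous_on U f"
    "\<And>x. x \<in> U \<Longrightarrow> (f has_derivative frechet_derivative f (at x)) (at x)"
    "\<And>v. smooth_on_open U (\<lambda>x. frechet_derivative f (at x) v)"
proof -
  show op: "open U" and Ck: "\<And>k. Ck_on k U f"
    using assms by (auto simp: smooth_on_open_def)
  show "continuous_on U f"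
    using Ck[of 0] by simp
  show "(f has_derivative frechet_derivative f (at x)) (at x)" if "x \<in> U" for x
    using Ck_on_Suc_has_derivative[OF Ck that] .
  have "Ck_on k U (\<lambda>x. frechet_derivative f (at x) v)" for k v
    using Ck[of "Suc k"] by simp
  then show "smooth_on_open U (\<lambda>x. frechet_derivative f (at x) v)" for v
    using op by (simp add: smooth_on_open_def)
qed

section \<open>Smooth maps on open sets\<close>

lemma smooth_on_open_subset:
  "smooth_on_open U f \<Longrightarrow> open V \<Longrightarrow> V \<subseteq> U \<Longrightarrow> smooth_on_open V f"
  by (auto simp: smooth_on_open_def intro: Ck_on_subset)

lemma smooth_on_open_cong:
  "smooth_on_open U f \<Longrightarrow> (\<And>x. x \<in> U \<Longrightarrow> f x = g x) \<Longrightarrow> smooth_on_open U g"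
  unfolding smooth_on_open_def using Ck_on_cong[of U f g] by blast

lemma smooth_on_open_local:
  assumes "\<And>x. x \<in> U \<Longrightarrow> \<exists>V. x \<in> V \<and> smooth_on_open V f" "open U"
  shows "smooth_on_open U f"
  unfolding smooth_on_open_def
proof (intro conjI allI assms(2) Ck_on_Union)
  show "\<exists>V. open V \<and> x \<in> V \<and> Ck_on k V f" if "x \<in> U" for x k
    using assms(1)[OF that] by (auto simp: smooth_on_open_def)
qed

lemma smooth_map_on_UNIV:
  fixes f :: "'a::euclidean_space \<Rightarrow> 'b::euclidean_space"
  assumes "smooth_map_on UNIV f"
  shows "smooth_on_open UNIV f"
proof (rule smooth_on_open_local)
  fix x :: 'a
  obtain U F where U: "x \<in> U" "smooth_on_open U F" "\<forall>y\<in>UNIV \<inter> U. F y = f y"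
    using assms unfolding smooth_map_on_def by blast
  have "smooth_on_open U f"
    by (rule smooth_on_open_cong[OF U(2)]) (use U(3) in simp)
  then show "\<exists>V. x \<in> V \<and> smooth_on_open V f"
    using U(1) by blast
qed simp

lemma smooth_on_open_const: "open U \<Longrightarrow> smooth_on_open U (\<lambda>x. c)"
  by (simp add: smooth_on_open_def Ck_on_const)

lemma smooth_on_open_linear: "bounded_linear T \<Longrightarrow> open U \<Longrightarrow> smooth_on_open U T"
  by (simp add: smooth_on_open_def Ck_on_bounded_linear)

lemma smooth_on_open_add:
  "smooth_on_open U f \<Longrightarrow> smooth_on_open U g \<Longrightarrow> smooth_on_open U (\<lambda>x. f x + g x)"
  by (simp add: smooth_on_open_def Ck_on_add)

lemma smooth_on_open_sum:
  "open U \<Longrightarrow> finite A \<Longrightarrow> (\<And>i. i \<in> A \<Longrightarrow> smooth_on_open U (f i)) \<Longrightarrow> smooth_on_open U (\<lambda>x. \<Sum>i\<in>A. f i x)"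
  by (simp add: smooth_on_open_def Ck_on_sum)

lemma smooth_on_open_mult:
  fixes f g :: "'a::real_normed_vector \<Rightarrow> 'b::real_normed_algebra"
  shows "smooth_on_open U f \<Longrightarrow> smooth_on_open U g \<Longrightarrow> smooth_on_open U (\<lambda>x. f x * g x)"
  by (simp add: smooth_on_open_def Ck_on_mult)

lemma smooth_on_open_inner:
  "smooth_on_open U f \<Longrightarrow> smooth_on_open U g \<Longrightarrow> smooth_on_open U (\<lambda>x. f x \<bullet> g x)"
  by (simp add: smooth_on_open_def Ck_on_inner)

lemma smooth_on_open_linear_comp:
  "bounded_linear T \<Longrightarrow> smooth_on_open U f \<Longrightarrow> smooth_on_open U (\<lambda>x. T (f x))"
  by (simp add: smooth_on_open_def Ck_on_linear_comp)

lemma smooth_on_open_compose: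
  fixes h :: "'a::real_normed_vector \<Rightarrow> 'b::euclidean_space"
  assumes "smooth_on_open V f" "smooth_on_open U h" "h ` U \<subseteq> V"
  shows "smooth_on_open U (\<lambda>x. f (h x))"
  using assms Ck_on_compose[OF _ _ assms(3)] unfolding smooth_on_open_def by blast

text \<open>A vector is the sum of its entries, each placed in an otherwise zero vector by a bounded
  linear map. Entries in an arbitrary normed space allow a second application for matrices.\<close>

lemma smooth_on_open_vec_lambda:
  fixes f :: "'i::finite \<Rightarrow> 'a::real_normed_vector \<Rightarrow> 'b::real_normed_vector"
  assumes "open U" "\<And>i. smooth_on_open U (f i)"
  shows "smooth_on_open U (\<lambda>x. \<chi> i. f i x)"
proof -
  have bl: "bounded_linear (\<lambda>y::'b. (\<chi> j. if j = i then y else 0) :: 'b^'i)" for i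
  proof (rule bounded_linear_intro[where K = 1])
    show "norm ((\<chi> j. if j = i then y else 0) :: 'b^'i) \<le> norm y * 1" for y :: 'b
    proof -
      have "norm ((\<chi> j. if j = i then y else 0) :: 'b^'i) \<le> (\<Sum>j\<in>UNIV. norm (((\<chi> j. if j = i then y else 0) :: 'b^'i) $ j))"
        unfolding norm_vec_def by (rule L2_set_le_sum) simp
      also have "\<dots> = norm y"
        by (simp add: if_distrib cong: if_cong)
      finally show ?thesis by simp
    qed
  qed (auto simp: vec_eq_iff)
  have "smooth_on_open U (\<lambda>x. \<Sum>i\<in>UNIV. (\<chi> j. if j = i then f i x else 0) :: 'b^'i)"
    by (intro smooth_on_open_sum smooth_on_open_linear_comp[OF bl] assms) auto
  moreover have "(\<Sum>i\<in>UNIV. (\<chi> j. if j = i then f i x else 0) :: 'b^'i) = (\<chi> i. f i x)" for x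
    by (simp add: vec_eq_iff)
  ultimately show ?thesis by simp
qed

lemma smooth_on_open_real:
  fixes f :: "real \<Rightarrow> real"
  assumes "open U" "\<And>x. x \<in> U \<Longrightarrow> (f has_real_derivative f' x) (at x)" "smooth_on_open U f'"
  shows "smooth_on_open U f"
proof -
  have "Ck_on k U f" for k
  proof (cases k)
    case 0
    then show ?thesis
      using assms(2) by (auto intro!: continuous_at_imp_continuous_on DERIV_isCont)
  next
    case (Suc k')
    have "Ck_on k' U (\<lambda>x. f' x * v)" for v
      using assms(1,3) by (auto intro!: Ck_on_mult Ck_on_const simp: smooth_on_open_def)
    then show ?thesis
      unfolding Suc using assms(2)
      by (intro Ck_on_SucI[OF assms(1), where f' = "\<lambda>x v. f' x * v"]) (auto simp: has_field_derivative_def)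
  qed
  then show ?thesis
    using assms(1) by (simp add: smooth_on_open_def)
qed

text \<open>Differentiation lowers the exponent, so the induction on the order runs over all
  exponents at once. The exponents -1 and -1/2 later provide reciprocals and inverse norms.\<close>

lemma smooth_on_open_powr: "smooth_on_open {0<..} (\<lambda>x::real. x powr a)"
proof -
  have "Ck_on k {0<..} (\<lambda>x::real. x powr a)" for k
  proof (induction k arbitrary: a)
    case 0
    then show ?case by (auto intro!: continuous_intros)
  next
    case (Suc k)
    show ?case
    proof (rule Ck_on_SucI[where f' = "\<lambda>x v. (a * x powr (a - 1)) * v"])
      show "((\<lambda>x. x powr a) has_derivative (\<lambda>v. a * x powr (a - 1) * v)) (at x)" if "x \<in> {0<..}" for x :: real
        using has_real_derivative_powr[of x a] that
        by (simp add: has_field_derivative_def)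
      show "Ck_on k {0<..} (\<lambda>x::real. a * x powr (a - 1) * v)" for v
        by (intro Ck_on_mult Ck_on_const Suc) auto
    qed auto
  qed
  then show ?thesis by (simp add: smooth_on_open_def)
qed

section \<open>Extension of smooth strictly monotone functions\<close>

lemma poly_times_exp_neg_tendsto_0:
  fixes p :: "real poly"
  shows "((\<lambda>y. poly p y * exp (- y)) \<longlongrightarrow> 0) at_top"
proof -
  have "((\<lambda>y. \<Sum>i\<le>degree p. coeff p i * (y ^ i / exp y)) \<longlongrightarrow> (\<Sum>i\<le>degree p. coeff p i * 0)) at_top"
    by (intro tendsto_sum tendsto_mult tendsto_const tendsto_power_div_exp_0)
  moreover have "(\<Sum>i\<le>degree p. coeff p i * (y ^ i / exp y)) = poly p y * exp (- y)" for y
    by (simp add: poly_altdef sum_distrib_right exp_minus divide_inverse mult.assoc)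
  ultimately show ?thesis by simp
qed

text \<open>The classical function exp(-1/x). It is embedded in the family p(1/x) exp(-1/x) with
  \<open>p\<close> a polynomial, which is closed under differentiation, so that smoothness follows
  by induction on the order.\<close>

lemma ex_smooth_flat_function:
  "\<exists>\<theta>::real \<Rightarrow> real. smooth_on_open UNIV \<theta> \<and> (\<forall>x\<le>0. \<theta> x = 0) \<and> (\<forall>x>0. \<theta> x > 0)"
proof -
  define F :: "real poly \<Rightarrow> real \<Rightarrow> real"
    where "F p x = (if x \<le> 0 then 0 else poly p (1/x) * exp (- (1/x)))" for p x
  \<comment> \<open>With y = 1/x, differentiating p(y) exp(-y) in x brings out the factor -y^2 and
    leaves y^2 (p(y) - p'(y)) exp(-y).\<close>
  define S :: "real poly \<Rightarrow> real poly" where "S p = monom 1 2 * (p - pderiv p)" for p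
  have der: "(F p has_real_derivative F (S p) x) (at x)" for p x
  proof -
    consider "x < 0" | "x = 0" | "x > 0" by linarith
    then show ?thesis
    proof cases
      case 1
      have "((\<lambda>x. 0) has_real_derivative F (S p) x) (at x)"
        using 1 by (simp add: F_def)
      then show ?thesis
        by (rule has_field_derivative_transform_within_open[where S = "{..<0}"]) (use 1 in \<open>auto simp: F_def\<close>)
    next
      case 3
      have "((\<lambda>x. poly p (1/x) * exp (- (1/x))) has_real_derivative F (S p) x) (at x)"
        using 3 by (auto intro!: derivative_eq_intros poly_DERIV[THEN DERIV_chain2]
            simp: F_def S_def poly_monom field_simps power2_eq_square)
      then show ?thesis
        by (rule has_field_derivative_transform_within_open[where S = "{0<..}"]) (use 3 in \<open>auto simp: F_def\<close>)
    next
      case 2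
      have "((\<lambda>h. F p h / h) \<longlongrightarrow> 0) (at_left 0)"
      proof (rule Lim_transform_eventually[OF tendsto_const])
        show "\<forall>\<^sub>F h in at_left 0. 0 = F p h / h"
          unfolding eventually_at_left_field by (intro exI[of _ "-1"]) (auto simp: F_def)
      qed
      moreover have "((\<lambda>h. F p h / h) \<longlongrightarrow> 0) (at_right 0)"
      proof (rule Lim_transform_eventually)
        \<comment> \<open>\<open>pCons 0 p\<close> is X times \<open>p\<close>: the division by
          \<open>h\<close> in the difference quotient is absorbed into the polynomial.\<close>
        show "((\<lambda>h. poly (pCons 0 p) (inverse h) * exp (- inverse h)) \<longlongrightarrow> 0) (at_right (0::real))"
          by (rule filterlim_compose[OF poly_times_exp_neg_tendsto_0 filterlim_inverse_at_top_right])
        show "\<forall>\<^sub>F h in at_right 0. poly (pCons 0 p) (inverse h) * exp (- inverse h) = F p h / h"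
          unfolding eventually_at_right_field
          by (intro exI[of _ 1]) (auto simp: F_def field_simps)
      qed
      ultimately have "((\<lambda>h. F p h / h) \<longlongrightarrow> 0) (at 0)"
        by (simp add: filterlim_split_at)
      then show ?thesis
        using 2 by (simp add: DERIV_def F_def)
    qed
  qed
  have "Ck_on k UNIV (F p)" for k p
  proof (induction k arbitrary: p)
    case 0
    then show ?case
      using DERIV_isCont[OF der] by (auto intro!: continuous_at_imp_continuous_on)
  next
    case (Suc k)
    show ?case
      by (rule Ck_on_SucI[where f' = "\<lambda>x v. F (S p) x * v"])
        (use der in \<open>auto simp: has_field_derivative_def intro!: Ck_on_mult Ck_on_const Suc\<close>)
  qed
  then have "smooth_on_open UNIV (F 1)"
    by (simp add: smooth_on_open_def)
  then show ?thesis
    by (intro exI[of _ "F 1"]) (auto simp: F_def)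
qed

lemma ex_smooth_step:
  "\<exists>\<psi>::real \<Rightarrow> real. smooth_on_open UNIV \<psi> \<and> (\<forall>x. 0 \<le> \<psi> x \<and> \<psi> x \<le> 1) \<and>
     (\<forall>x\<le>0. \<psi> x = 0) \<and> (\<forall>x\<ge>1. \<psi> x = 1)"
proof -
  obtain \<theta> :: "real \<Rightarrow> real" where \<theta>: "smooth_on_open UNIV \<theta>" "\<And>x. x \<le> 0 \<Longrightarrow> \<theta> x = 0" "\<And>x. x > 0 \<Longrightarrow> \<theta> x > 0"
    using ex_smooth_flat_function by blast
  have nonneg: "\<theta> x \<ge> 0" for x
    using \<theta>(2,3)[of x] by (cases "x \<le> 0") auto
  \<comment> \<open>The quotient \<theta>(x) / (\<theta>(x) + \<theta>(1 - x)) is the step; its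
    denominator is positive since \<open>x\<close> and \<open>1 - x\<close> are never both
    nonpositive.\<close>
  define D where "D x = \<theta> x + \<theta> (1 + (- 1) * x)" for x
  have pos: "D x > 0" for x
    unfolding D_def using nonneg[of x] nonneg[of "1 + (- 1) * x"] \<theta>(3)[of x] \<theta>(3)[of "1 + (- 1) * x"]
    by (cases "x > 0") auto
  have aff: "smooth_on_open UNIV (\<lambda>x::real. 1 + (- 1) * x)"
    by (intro smooth_on_open_add smooth_on_open_const smooth_on_open_linear)
      (auto simp: bounded_linear_minus[OF bounded_linear_ident])
  have "smooth_on_open UNIV D"
    unfolding D_def by (intro smooth_on_open_add \<theta> smooth_on_open_compose[OF \<theta>(1) aff]) auto
  then have "smooth_on_open UNIV (\<lambda>x. D x powr (- 1))"
    by (rule smooth_on_open_compose[OF smooth_on_open_powr]) (use pos in auto)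
  then have "smooth_on_open UNIV (\<lambda>x. \<theta> x * D x powr (- 1))"
    by (intro smooth_on_open_mult \<theta>)
  moreover have "\<theta> x * D x powr (- 1) = \<theta> x / D x" for x
    using pos[of x] by (simp add: powr_minus_divide)
  ultimately have sm: "smooth_on_open UNIV (\<lambda>x. \<theta> x / D x)"
    by (simp only:)
  show ?thesis
  proof (intro exI[of _ "\<lambda>x. \<theta> x / D x"] conjI allI impI sm)
    show "0 \<le> \<theta> x / D x" for x
      using pos[of x] nonneg[of x] by simp
    show "\<theta> x / D x \<le> 1" for x
      using pos[of x] nonneg[of "1 + (- 1) * x"] by (simp add: D_def)
    show "\<theta> x / D x = 0" if "x \<le> 0" for x
      using that by (simp add: \<theta>)
    show "\<theta> x / D x = 1" if "x \<ge> 1" for x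
      using that \<theta>(3)[of x] by (simp add: D_def \<theta>(2))
  qed
qed

lemma ex_smooth_plateau:
  fixes a b \<epsilon> :: real
  assumes "\<epsilon> > 0"
  shows "\<exists>\<psi>::real \<Rightarrow> real. smooth_on_open UNIV \<psi> \<and> (\<forall>x. 0 \<le> \<psi> x \<and> \<psi> x \<le> 1) \<and>
     (\<forall>x\<in>{a..b}. \<psi> x = 1) \<and> (\<forall>x. x \<le> a - \<epsilon> \<or> b + \<epsilon> \<le> x \<longrightarrow> \<psi> x = 0)"
proof -
  obtain \<psi> :: "real \<Rightarrow> real" where \<psi>: "smooth_on_open UNIV \<psi>" "\<And>x. 0 \<le> \<psi> x" "\<And>x. \<psi> x \<le> 1"
      "\<And>x. x \<le> 0 \<Longrightarrow> \<psi> x = 0" "\<And>x. x \<ge> 1 \<Longrightarrow> \<psi> x = 1"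
    using ex_smooth_step by blast
  have aff: "smooth_on_open UNIV (\<lambda>x::real. c + m * x)" for c m
    by (intro smooth_on_open_add smooth_on_open_const smooth_on_open_linear bounded_linear_mult_right) auto
  \<comment> \<open>Affine maps with \<open>l\<close> sending a - \<epsilon> to 0 and
    \<open>a\<close> to 1, and \<open>r\<close> sending b + \<epsilon> to 0 and \<open>b\<close> to
    1: the plateau is a rising step times a falling one.\<close>
  define l r where "l x = (\<epsilon> - a) / \<epsilon> + (1/\<epsilon>) * x" and "r x = (b + \<epsilon>) / \<epsilon> + (- 1/\<epsilon>) * x" for x
  have l: "l x = (x - a) / \<epsilon> + 1" and r: "r x = (b - x) / \<epsilon> + 1" for x
    using assms by (auto simp: l_def r_def field_simps)
  show ?thesis
  proof (intro exI[of _ "\<lambda>x. \<psi> (l x) * \<psi> (r x)"] conjI allI ballI impI)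
    show "smooth_on_open UNIV (\<lambda>x. \<psi> (l x) * \<psi> (r x))"
      unfolding l_def r_def
      by (intro smooth_on_open_mult smooth_on_open_compose[OF \<psi>(1) aff]) auto
    show "0 \<le> \<psi> (l x) * \<psi> (r x)" "\<psi> (l x) * \<psi> (r x) \<le> 1" for x
      using \<psi>(2,3) by (auto intro: mult_le_one)
    show "\<psi> (l x) * \<psi> (r x) = 1" if "x \<in> {a..b}" for x
      using that assms by (simp add: l r \<psi>(5))
    show "\<psi> (l x) * \<psi> (r x) = 0" if x: "x \<le> a - \<epsilon> \<or> b + \<epsilon> \<le> x" for x
    proof -
      from x have "l x \<le> 0 \<or> r x \<le> 0"
        using assms by (auto simp: l r field_simps)
      then show ?thesis using \<psi>(4) by auto
    qed
  qed
qed

section \<open>Smooth extension from a closed interval to the line\<close>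

lemma has_derivative_within_local:
  assumes "open U" "y \<in> S \<inter> U" "\<And>z. z \<in> S \<inter> U \<Longrightarrow> F z = T z" "(F has_derivative D) (at y)"
  shows "(T has_derivative D) (at y within S)"
proof -
  obtain r where r: "r > 0" "ball y r \<subseteq> U"
    using assms(1,2) openE by blast
  show ?thesis
    by (rule has_derivative_transform_within[OF has_derivative_at_withinI[OF assms(4)] r(1)])
      (use assms(2,3) r(2) in \<open>auto simp: dist_commute subset_iff\<close>)
qed

text \<open>The derivative within a nondegenerate interval is unique, end points included, so every
  local smooth extension of \<open>T\<close> has derivative \<open>T'\<close> there, and its
  derivative is a local smooth extension of \<open>T'\<close>.\<close>

lemma smooth_map_on_derivative:
  fixes T T' :: "real \<Rightarrow> real"
  assumes "a < b" "smooth_map_on {a..b} T"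
    and der: "\<And>x. x \<in> {a..b} \<Longrightarrow> (T has_real_derivative T' x) (at x within {a..b})"
  shows "smooth_map_on {a..b} T'"
  unfolding smooth_map_on_def
proof
  fix x assume "x \<in> {a..b}"
  then obtain U F where U: "x \<in> U" "smooth_on_open U F" "\<forall>y\<in>{a..b} \<inter> U. F y = T y"
    using assms(2) unfolding smooth_map_on_def by blast
  have "frechet_derivative F (at y) 1 = T' y" if y: "y \<in> {a..b} \<inter> U" for y
  proof -
    have F: "(F has_derivative frechet_derivative F (at y)) (at y)"
      using smooth_on_openD(4)[OF U(2)] y by blast
    have "(T has_derivative frechet_derivative F (at y)) (at y within {a..b})"
      by (rule has_derivative_within_local[OF smooth_on_openD(1)[OF U(2)] _ _ F]) (use U(3) y in auto)
    moreover have "(T has_derivative (*) (T' y)) (at y within {a..b})"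
      using der y by (simp add: has_field_derivative_def)
    ultimately have "frechet_derivative F (at y) = (*) (T' y)"
      using frechet_derivative_unique_within_closed_interval[of a b y T] y assms(1) by auto
    then show ?thesis by simp
  qed
  then show "\<exists>U G. x \<in> U \<and> smooth_on_open U G \<and> (\<forall>y\<in>{a..b} \<inter> U. G y = T' y)"
    using U(1) smooth_on_openD(5)[OF U(2)] by blast
qed

lemma smooth_map_on_ball_pos:
  fixes e :: "real \<Rightarrow> real"
  assumes "smooth_map_on S e" "x \<in> S" "e x > 0"
  obtains r G where "r > 0" "smooth_on_open (ball x r) G" "\<And>y. y \<in> ball x r \<Longrightarrow> G y > 0"
    "\<And>y. y \<in> S \<inter> ball x r \<Longrightarrow> G y = e y"
proof -
  obtain U G where U: "x \<in> U" "smooth_on_open U G" "\<forall>y\<in>S \<inter> U. G y = e y"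
    using assms unfolding smooth_map_on_def by blast
  have "open {y\<in>U. G y \<in> {0<..}}"
    using smooth_on_openD(1,3)[OF U(2)] continuous_open_preimage[of U G "{0<..}"]
    by (auto simp: vimage_def Int_def)
  moreover have "x \<in> {y\<in>U. G y \<in> {0<..}}"
    using U assms by auto
  ultimately obtain r where r: "r > 0" "ball x r \<subseteq> {y\<in>U. G y \<in> {0<..}}"
    using openE by blast
  show ?thesis
    by (rule that[of r G]) (use r U smooth_on_open_subset[OF U(2), of "ball x r"] in auto)
qed

text \<open>Near each end point a local extension stays positive by continuity. Blending it with the
  constant 1 by a cutoff keeps positivity, because a convex combination of positive numbers is
  positive.\<close>

lemma smooth_positive_extension:
  fixes e :: "real \<Rightarrow> real"
  assumes "a < b" "smooth_map_on {a..b} e" "\<And>x. x \<in> {a..b} \<Longrightarrow> e x > 0"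
  obtains E where "smooth_on_open UNIV E" "\<And>x. E x > 0" "\<And>x. x \<in> {a..b} \<Longrightarrow> E x = e x"
proof -
  have ends: "a \<in> {a..b}" "b \<in> {a..b}" using assms(1) by auto
  obtain ra Ga where Ga: "ra > 0" "smooth_on_open (ball a ra) Ga" "\<And>y. y \<in> ball a ra \<Longrightarrow> Ga y > 0"
    "\<And>y. y \<in> {a..b} \<inter> ball a ra \<Longrightarrow> Ga y = e y"
    by (rule smooth_map_on_ball_pos[OF assms(2) ends(1) assms(3)[OF ends(1)]]) blast
  obtain rb Gb where Gb: "rb > 0" "smooth_on_open (ball b rb) Gb" "\<And>y. y \<in> ball b rb \<Longrightarrow> Gb y > 0"
    "\<And>y. y \<in> {a..b} \<inter> ball b rb \<Longrightarrow> Gb y = e y"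
    by (rule smooth_map_on_ball_pos[OF assms(2) ends(2) assms(3)[OF ends(2)]]) blast
  define r where "r = min ra rb"
  have r: "r > 0" "r \<le> ra" "r \<le> rb" using Ga Gb by (auto simp: r_def)
  \<comment> \<open>Only the values between \<open>a - r\<close> and \<open>b + r\<close> matter:
    the cutoff vanishes elsewhere.\<close>
  define e0 where "e0 x = (if x < a then Ga x else if x \<le> b then e x else Gb x)" for x
  have pos: "e0 x > 0" if "a - r < x" "x < b + r" for x
  proof -
    consider "x < a" | "a \<le> x" "x \<le> b" | "b < x" by linarith
    then show ?thesis
      by cases (use that r Ga(3)[of x] Gb(3)[of x] assms(1) assms(3)[of x] in \<open>simp_all add: e0_def dist_real_def\<close>)
  qed
  have e0: "\<exists>V. x \<in> V \<and> smooth_on_open V e0" if x: "a - r < x" "x < b + r" for x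
  proof -
    consider "x < b" "x \<le> a" | "a < x" "x < b" | "a < x" "b \<le> x" using assms(1) by linarith
    then show ?thesis
    proof cases
      case 1
      have "smooth_on_open (ball a r \<inter> {..<b}) Ga"
        by (rule smooth_on_open_subset[OF Ga(2)]) (use r in auto)
      then have "smooth_on_open (ball a r \<inter> {..<b}) e0"
      proof (rule smooth_on_open_cong)
        show "Ga y = e0 y" if "y \<in> ball a r \<inter> {..<b}" for y
          using that r Ga(4)[of y] by (cases "y < a") (simp_all add: e0_def)
      qed
      moreover have "\<bar>a - x\<bar> < r"
        using 1(2) x(1) r(1) by linarith
      ultimately show ?thesis
        using 1(1) by (intro exI[of _ "ball a r \<inter> {..<b}"]) (simp add: dist_real_def)
    next
      case 3
      have "smooth_on_open (ball b r \<inter> {a<..}) Gb"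
        by (rule smooth_on_open_subset[OF Gb(2)]) (use r in auto)
      then have "smooth_on_open (ball b r \<inter> {a<..}) e0"
      proof (rule smooth_on_open_cong)
        show "Gb y = e0 y" if "y \<in> ball b r \<inter> {a<..}" for y
          using that r Gb(4)[of y] assms(1) by (cases "y \<le> b") (simp_all add: e0_def)
      qed
      moreover have "\<bar>b - x\<bar> < r"
        using 3(2) x(2) r(1) by linarith
      ultimately show ?thesis
        using 3(1) by (intro exI[of _ "ball b r \<inter> {a<..}"]) (simp add: dist_real_def)
    next
      case 2
      then have "x \<in> {a..b}" by simp
      then obtain U F where U: "x \<in> U" "smooth_on_open U F" "\<forall>y\<in>{a..b} \<inter> U. F y = e y"
        using assms(2) unfolding smooth_map_on_def by blast
      have "smooth_on_open (U \<inter> {a<..<b}) F"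
        by (rule smooth_on_open_subset[OF U(2)]) (use smooth_on_openD(1)[OF U(2)] in auto)
      then have "smooth_on_open (U \<inter> {a<..<b}) e0"
        by (rule smooth_on_open_cong) (use U(3) in \<open>simp add: e0_def\<close>)
      moreover have "x \<in> U \<inter> {a<..<b}"
        using 2 U by auto
      ultimately show ?thesis by blast
    qed
  qed
  \<comment> \<open>The margin \<open>r/2\<close> makes the cutoff vanish strictly inside the region
    where \<open>e0\<close> is smooth, so that the open sets used for gluing overlap.\<close>
  obtain \<psi> :: "real \<Rightarrow> real" where \<psi>: "smooth_on_open UNIV \<psi>" "\<And>x. 0 \<le> \<psi> x" "\<And>x. \<psi> x \<le> 1"
     "\<And>x. x\<in>{a..b} \<Longrightarrow> \<psi> x = 1" "\<And>x. x \<le> a - r/2 \<or> b + r/2 \<le> x \<Longrightarrow> \<psi> x = 0"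
    using ex_smooth_plateau[OF half_gt_zero[OF r(1)], of a b] by blast
  define E where "E x = \<psi> x * e0 x + (1 + (-1) * \<psi> x)" for x
  have "smooth_on_open UNIV E"
  proof (rule smooth_on_open_local)
    fix x :: real
    consider "a - r < x" "x < b + r" | "x \<le> a - r" | "b + r \<le> x" by linarith
    then show "\<exists>V. x \<in> V \<and> smooth_on_open V E"
    proof cases
      case 1
      then obtain V where V: "x \<in> V" "smooth_on_open V e0"
        using e0 by blast
      have "smooth_on_open V \<psi>"
        by (rule smooth_on_open_subset[OF \<psi>(1)]) (use smooth_on_openD(1)[OF V(2)] in auto)
      then have "smooth_on_open V E"
        unfolding E_def using V(2) smooth_on_openD(1)[OF V(2)]
        by (intro smooth_on_open_add smooth_on_open_mult smooth_on_open_const)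
      then show ?thesis using V by blast
    next
      case 2
      have "smooth_on_open {..<a - r/2} E"
        by (rule smooth_on_open_cong[OF smooth_on_open_const[of _ 1]]) (simp_all add: E_def \<psi>(5))
      then show ?thesis using 2 r by (intro exI[of _ "{..<a - r/2}"]) auto
    next
      case 3
      have "smooth_on_open {b + r/2<..} E"
        by (rule smooth_on_open_cong[OF smooth_on_open_const[of _ 1]]) (simp_all add: E_def \<psi>(5))
      then show ?thesis using 3 r by (intro exI[of _ "{b + r/2<..}"]) auto
    qed
  qed simp
  moreover have "E x > 0" for x
  proof (cases "\<psi> x = 0")
    case False
    then have "\<not> (x \<le> a - r/2 \<or> b + r/2 \<le> x)"
      using \<psi>(5) by blast
    then have "a - r < x" "x < b + r"
      using r(1) by auto
    then have "e0 x > 0"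
      by (rule pos)
    then have "\<psi> x * e0 x > 0"
      using \<psi>(2)[of x] False by simp
    then show ?thesis using \<psi>(3)[of x] unfolding E_def by linarith
  qed (simp add: E_def)
  moreover have "E x = e x" if "x \<in> {a..b}" for x
    using that \<psi>(4) by (simp add: E_def e0_def)
  ultimately show ?thesis using that by blast
qed

text \<open>Extending the derivative instead of the function preserves monotonicity: an
  antiderivative of a positive smooth function is smooth and strictly increasing, and one additive
  constant makes it agree with \<open>T\<close>.\<close>

lemma smooth_strict_mono_extension:
  fixes T T' :: "real \<Rightarrow> real"
  assumes "a < b" "smooth_map_on {a..b} T"
    and der: "\<And>x. x \<in> {a..b} \<Longrightarrow> (T has_real_derivative T' x) (at x within {a..b})"
    and pos: "\<And>x. x \<in> {a..b} \<Longrightarrow> T' x > 0"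
  obtains \<tau> where "smooth_on_open UNIV \<tau>" "strict_mono \<tau>" "\<And>x. x \<in> {a..b} \<Longrightarrow> \<tau> x = T x"
proof -
  obtain E where E: "smooth_on_open UNIV E" "\<And>x. E x > 0" "\<And>x. x \<in> {a..b} \<Longrightarrow> E x = T' x"
    using smooth_positive_extension[OF assms(1) smooth_map_on_derivative[OF assms(1-3)] pos] by blast
  have "isCont E x" for x
    using smooth_on_openD(3)[OF E(1)] by (simp add: continuous_on_eq_continuous_at)
  then obtain S where S: "\<And>x::real. (S has_vector_derivative E x) (at x)"
    using einterval_antiderivative[of "-\<infinity>" "\<infinity>" E] by auto
  define \<tau> where "\<tau> x = S x + (T a - S a)" for x
  have \<tau>: "(\<tau> has_real_derivative E x) (at x)" for x
    unfolding \<tau>_def using S[of x]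
    by (auto intro!: derivative_eq_intros simp: has_real_derivative_iff_has_vector_derivative)
  have "smooth_on_open UNIV \<tau>"
    by (rule smooth_on_open_real[OF _ \<tau> E(1)]) simp
  moreover have "strict_mono \<tau>"
    using DERIV_pos_imp_increasing[of _ _ \<tau>] \<tau> E(2) by (meson strict_monoI)
  moreover have "\<tau> x = T x" if x: "x \<in> {a..b}" for x
  proof -
    have "((\<lambda>x. \<tau> x - T x) has_field_derivative 0) (at x within {a..b})" if "x \<in> {a..b}" for x
      using DERIV_diff[OF has_field_derivative_at_within[OF \<tau>] der[OF that]] E(3)[OF that] by simp
    then obtain c where "\<And>y. y \<in> {a..b} \<Longrightarrow> \<tau> y - T y = c"
      using has_field_derivative_zero_constant[of "{a..b}" "\<lambda>x. \<tau> x - T x"] by auto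
    from this[of a] this[of x] show ?thesis
      using x assms(1) by (simp add: \<tau>_def)
  qed
  ultimately show ?thesis using that by blast
qed

section \<open>Real-analytic functions of one variable\<close>

text \<open>Encoded by local holomorphic extensions so that composition, inversion and the identity
  theorem are those of complex analysis. The extension lives on a full disc even at an end point of
  \<open>S\<close>.\<close>

definition analytic_real_on :: "real set \<Rightarrow> (real \<Rightarrow> real) \<Rightarrow> bool" where
  "analytic_real_on S c \<longleftrightarrow>
     (\<forall>s\<in>S. \<exists>r>0. \<exists>C. C holomorphic_on ball (complex_of_real s) r \<and>
        (\<forall>y\<in>S. dist y s < r \<longrightarrow> C (complex_of_real y) = complex_of_real (c y)))"

lemma analytic_real_onE:
  assumes "analytic_real_on S c" "s \<in> S"
  obtains r C where "r > 0" "C holomorphic_on ball (complex_of_real s) r"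
    "\<And>y. y \<in> S \<Longrightarrow> dist y s < r \<Longrightarrow> C (complex_of_real y) = complex_of_real (c y)"
  using assms unfolding analytic_real_on_def by metis

lemma dist_of_real_complex: "dist (complex_of_real x) (complex_of_real y) = dist x y"
  by (metis dist_of_real)

lemma analytic_real_on_affine: "analytic_real_on S (\<lambda>s. p + q * s)"
  unfolding analytic_real_on_def
proof
  fix s
  have "(\<lambda>z. of_real p + of_real q * z) holomorphic_on ball (complex_of_real s) 1"
    by (intro holomorphic_intros)
  then show "\<exists>r>0. \<exists>C. C holomorphic_on ball (complex_of_real s) r \<and>
      (\<forall>y\<in>S. dist y s < r \<longrightarrow> C (complex_of_real y) = complex_of_real (p + q * y))"
    by (intro exI[of _ 1] conjI exI[of _ "\<lambda>z. of_real p + of_real q * z"]) auto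
qed

lemma analytic_real_on_diff:
  assumes "analytic_real_on S c" "analytic_real_on S d"
  shows "analytic_real_on S (\<lambda>s. c s - d s)"
  unfolding analytic_real_on_def
proof
  fix s assume s: "s \<in> S"
  obtain r C where C: "r > 0" "C holomorphic_on ball (complex_of_real s) r"
    "\<And>y. y \<in> S \<Longrightarrow> dist y s < r \<Longrightarrow> C (complex_of_real y) = complex_of_real (c y)"
    using analytic_real_onE[OF assms(1) s] by metis
  obtain r' D where D: "r' > 0" "D holomorphic_on ball (complex_of_real s) r'"
    "\<And>y. y \<in> S \<Longrightarrow> dist y s < r' \<Longrightarrow> D (complex_of_real y) = complex_of_real (d y)"
    using analytic_real_onE[OF assms(2) s] by metis
  have "(\<lambda>z. C z - D z) holomorphic_on ball (complex_of_real s) (min r r')"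
    by (intro holomorphic_on_diff holomorphic_on_subset[OF C(2)] holomorphic_on_subset[OF D(2)]) auto
  then show "\<exists>r>0. \<exists>C. C holomorphic_on ball (complex_of_real s) r \<and>
      (\<forall>y\<in>S. dist y s < r \<longrightarrow> C (complex_of_real y) = complex_of_real (c y - d y))"
    using C(1,3) D(1,3)
    by (intro exI[of _ "min r r'"] conjI exI[of _ "\<lambda>z. C z - D z"] ballI impI)
      (simp, assumption, metis of_real_diff min_less_iff_conj)
qed

lemma holomorphic_on_ball_image_subset:
  assumes "C holomorphic_on ball z r" "r > 0" "open V" "C z \<in> V"
  obtains \<delta> where "\<delta> > 0" "\<delta> \<le> r" "C ` ball z \<delta> \<subseteq> V"
proof -
  have "open (ball z r \<inter> C -` V)"
    by (rule continuous_open_preimage[OF holomorphic_on_imp_continuous_on[OF assms(1)] open_ball assms(3)])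
  moreover have "z \<in> ball z r \<inter> C -` V"
    using assms by simp
  ultimately obtain e where e: "e > 0" "ball z e \<subseteq> ball z r \<inter> C -` V"
    using openE by blast
  have "C ` ball z (min e r) \<subseteq> V"
    using e(2) by (auto simp: subset_iff)
  then show ?thesis
    using that[of "min e r"] e(1) assms(2) by auto
qed

lemma analytic_real_on_compose:
  assumes "analytic_real_on T \<phi>" "analytic_real_on S c" "c ` S \<subseteq> T"
  shows "analytic_real_on S (\<lambda>s. \<phi> (c s))"
  unfolding analytic_real_on_def
proof
  fix s assume s: "s \<in> S"
  obtain r C where C: "r > 0" "C holomorphic_on ball (complex_of_real s) r"
    "\<And>y. y \<in> S \<Longrightarrow> dist y s < r \<Longrightarrow> C (complex_of_real y) = complex_of_real (c y)"
    using analytic_real_onE[OF assms(2) s] by metis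
  have cs: "c s \<in> T" using assms(3) s by blast
  obtain r' D where D: "r' > 0" "D holomorphic_on ball (complex_of_real (c s)) r'"
    "\<And>y. y \<in> T \<Longrightarrow> dist y (c s) < r' \<Longrightarrow> D (complex_of_real y) = complex_of_real (\<phi> y)"
    using analytic_real_onE[OF assms(1) cs] by metis
  obtain \<delta> where \<delta>: "\<delta> > 0" "\<delta> \<le> r" "C ` ball (complex_of_real s) \<delta> \<subseteq> ball (complex_of_real (c s)) r'"
  proof (rule holomorphic_on_ball_image_subset[OF C(2,1) open_ball])
    show "C (complex_of_real s) \<in> ball (complex_of_real (c s)) r'"
      using C(1,3) D(1) s by (metis centre_in_ball dist_self)
  qed blast
  have hol: "(D \<circ> C) holomorphic_on ball (complex_of_real s) \<delta>"
    by (rule holomorphic_on_compose_gen[OF holomorphic_on_subset[OF C(2)] D(2) \<delta>(3)]) (use \<delta>(2) in auto)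
  have "D (C (complex_of_real y)) = complex_of_real (\<phi> (c y))" if y: "y \<in> S" "dist y s < \<delta>" for y
  proof -
    have Cy: "C (complex_of_real y) = complex_of_real (c y)"
      using C(3)[OF y(1)] y(2) \<delta>(2) by simp
    have "complex_of_real y \<in> ball (complex_of_real s) \<delta>"
      using y(2) by (simp add: dist_of_real_complex dist_commute)
    then have "complex_of_real (c y) \<in> ball (complex_of_real (c s)) r'"
      using \<delta>(3) Cy by (metis image_subset_iff)
    then have "dist (c y) (c s) < r'"
      by (simp add: dist_of_real_complex dist_commute)
    moreover have "c y \<in> T" using assms(3) y by blast
    ultimately show ?thesis
      using D(3) Cy by simp
  qed
  then show "\<exists>r>0. \<exists>C. C holomorphic_on ball (complex_of_real s) r \<and>
      (\<forall>y\<in>S. dist y s < r \<longrightarrow> C (complex_of_real y) = complex_of_real (\<phi> (c y)))"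
    using \<delta>(1) hol by (intro exI[of _ \<delta>] conjI exI[of _ "D \<circ> C"]) auto
qed

lemma norm_le_of_component_le:
  fixes x :: "real^'d::finite"
  assumes "\<And>i. \<bar>x $ i\<bar> \<le> \<rho>"
  shows "norm x \<le> real CARD('d) * \<rho>"
proof -
  have "norm x \<le> (\<Sum>i\<in>UNIV. \<bar>x $ i\<bar>)"
    by (rule norm_le_l1_cart)
  also have "\<dots> \<le> (\<Sum>i\<in>(UNIV::'d set). \<rho>)"
    by (rule sum_mono) (use assms in simp)
  finally show ?thesis by simp
qed

text \<open>In the power series of \<open>f\<close> at \<open>c s\<close>, each real increment is
  replaced by the holomorphic extension of the corresponding coordinate of the curve. The resulting
  series of holomorphic functions converges uniformly near \<open>s\<close>.\<close>

lemma analytic_real_on_real_analytic_compose: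
  fixes f :: "real^'d::finite \<Rightarrow> real^'n::finite"
  assumes "real_analytic f" "\<And>i. analytic_real_on S (\<lambda>s. c s $ i)"
  shows "analytic_real_on S (\<lambda>s. f (c s) $ m)"
  unfolding analytic_real_on_def
proof
  fix s assume s: "s \<in> S"
  define a where "a = c s"
  obtain r K where r: "r > 0" and K: "\<And>z. z \<in> ball a r \<Longrightarrow>
      ((\<lambda>\<alpha>. (\<Prod>i\<in>UNIV. (z $ i - a $ i) ^ \<alpha> i) *\<^sub>R (K \<alpha>)) has_sum f z) UNIV"
    using assms(1) unfolding real_analytic_def by blast
  have Km: "((\<lambda>\<alpha>. (\<Prod>i\<in>UNIV. (z $ i - a $ i) ^ \<alpha> i) * (K \<alpha> $ m)) has_sum f z $ m) UNIV" if "z \<in> ball a r" for z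
    using has_sum_bounded_linear[OF bounded_linear_vec_nth[of m] K[OF that]] by simp
  \<comment> \<open>Chosen so that the cube of half side \<open>\<rho>\<close> about
    \<open>a\<close> lies in the ball: its points are within distance r/2 of
    \<open>a\<close>.\<close>
  define \<rho> where "\<rho> = r / (2 * real CARD('d))"
  have \<rho>: "\<rho> > 0"
    unfolding \<rho>_def by (intro divide_pos_pos mult_pos_pos r) simp_all
  have in_ball: "z \<in> ball a r" if "\<And>i. \<bar>z $ i - a $ i\<bar> \<le> \<rho>" for z
  proof -
    have "norm (z - a) \<le> real CARD('d) * \<rho>"
      by (rule norm_le_of_component_le) (use that in simp)
    also have "\<dots> < r" using r by (simp add: \<rho>_def)
    finally show ?thesis by (simp add: dist_norm norm_minus_commute)
  qed
  \<comment> \<open>Absolute values of the terms at the real point all of whose increments equal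
    \<open>\<rho>\<close>. Unordered convergence there is absolute, so this one point dominates the
    series on the complex polydisc of radius \<open>\<rho>\<close>.\<close>
  define M where "M \<alpha> = (\<Prod>i\<in>(UNIV::'d set). \<rho> ^ \<alpha> i) * \<bar>K \<alpha> $ m\<bar>" for \<alpha>
  have M: "M summable_on UNIV"
  proof -
    have "((\<lambda>\<alpha>. (\<Prod>i\<in>UNIV. \<rho> ^ \<alpha> i) * (K \<alpha> $ m)) has_sum f (a + (\<chi> i. \<rho>)) $ m) UNIV"
    proof -
      have "a + (\<chi> i. \<rho>) \<in> ball a r"
        by (rule in_ball) (use \<rho> in simp)
      from Km[OF this] show ?thesis
        by (simp only: vector_add_component vec_lambda_beta add_diff_cancel_left')
    qed
    then have "(\<lambda>\<alpha>. norm ((\<Prod>i\<in>UNIV. \<rho> ^ \<alpha> i) * (K \<alpha> $ m))) summable_on UNIV"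
      by (rule iffD1[OF summable_on_iff_abs_summable_on_real has_sum_imp_summable])
    moreover have "norm ((\<Prod>i\<in>UNIV. \<rho> ^ \<alpha> i) * (K \<alpha> $ m)) = M \<alpha>" for \<alpha>
      using \<rho> by (simp add: M_def abs_mult prod_nonneg abs_of_nonneg)
    ultimately show ?thesis by simp
  qed
  have "\<forall>i. \<exists>r C. r > 0 \<and> C holomorphic_on ball (complex_of_real s) r \<and>
    (\<forall>y\<in>S. dist y s < r \<longrightarrow> C (complex_of_real y) = complex_of_real (c y $ i))"
    using assms(2) s unfolding analytic_real_on_def by metis
  then obtain R C where R: "\<And>i. R i > 0" and C: "\<And>i. C i holomorphic_on ball (complex_of_real s) (R i)"
    and Cc: "\<And>i y. y \<in> S \<Longrightarrow> dist y s < R i \<Longrightarrow> C i (complex_of_real y) = complex_of_real (c y $ i)"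
    by metis
  have "\<forall>i. \<exists>\<delta>>0. \<delta> \<le> R i \<and> C i ` ball (complex_of_real s) \<delta> \<subseteq> ball (complex_of_real (a $ i)) \<rho>"
  proof
    fix i
    have "C i (complex_of_real s) \<in> ball (complex_of_real (a $ i)) \<rho>"
      using Cc[OF s, of i] R[of i] \<rho> by (simp add: a_def)
    then show "\<exists>\<delta>>0. \<delta> \<le> R i \<and> C i ` ball (complex_of_real s) \<delta> \<subseteq> ball (complex_of_real (a $ i)) \<rho>"
      using holomorphic_on_ball_image_subset[OF C[of i] R[of i] open_ball] by metis
  qed
  then obtain E where E: "\<And>i. E i > 0" "\<And>i. E i \<le> R i"
      "\<And>i. C i ` ball (complex_of_real s) (E i) \<subseteq> ball (complex_of_real (a $ i)) \<rho>"
    by metis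
  \<comment> \<open>Halving puts the closed disc of radius \<open>\<delta>\<close> inside each of
    the open discs, as uniform convergence is wanted up to the boundary.\<close>
  define \<delta> where "\<delta> = Min (range E) / 2"
  have Min_pos: "Min (range E) > 0" using E(1) by simp
  have Min_le: "Min (range E) \<le> E i" for i by simp
  have \<delta>: "\<delta> > 0" "\<delta> < E i" for i
    using Min_pos Min_le[of i] unfolding \<delta>_def by linarith+
  have Cb: "norm (C i z - complex_of_real (a $ i)) \<le> \<rho>" if "z \<in> cball (complex_of_real s) \<delta>" for i z
  proof -
    have "z \<in> ball (complex_of_real s) (E i)"
      using that \<delta>(2)[of i] by simp
    then have "C i z \<in> ball (complex_of_real (a $ i)) \<rho>"
      using E(3) by blast
    then show ?thesis by (simp add: dist_norm norm_minus_commute)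
  qed
  have CR: "C i holomorphic_on ball (complex_of_real s) (E i)" for i
    by (rule holomorphic_on_subset[OF C]) (use E(2) in \<open>simp add: subset_ball\<close>)
  define trm where "trm \<alpha> z = complex_of_real (K \<alpha> $ m) * (\<Prod>i\<in>UNIV. (C i z - complex_of_real (a $ i)) ^ \<alpha> i)" for \<alpha> z
  define \<Phi> where "\<Phi> z = (\<Sum>\<^sub>\<infinity>\<alpha>\<in>UNIV. trm \<alpha> z)" for z
  have "norm (trm \<alpha> z) \<le> M \<alpha>" if "z \<in> cball (complex_of_real s) \<delta>" for \<alpha> z
  proof -
    have "norm (trm \<alpha> z) = \<bar>K \<alpha> $ m\<bar> * (\<Prod>i\<in>UNIV. norm (C i z - complex_of_real (a $ i)) ^ \<alpha> i)"
      by (simp add: trm_def norm_mult prod_norm[symmetric] norm_power)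
    also have "\<dots> \<le> \<bar>K \<alpha> $ m\<bar> * (\<Prod>i\<in>UNIV. \<rho> ^ \<alpha> i)"
      by (intro mult_left_mono prod_mono conjI power_mono Cb[OF that]) auto
    finally show ?thesis by (simp add: M_def mult.commute)
  qed
  then have ulim: "uniform_limit (cball (complex_of_real s) \<delta>) (\<lambda>A z. \<Sum>\<alpha>\<in>A. trm \<alpha> z) \<Phi> (finite_subsets_at_top UNIV)"
    unfolding \<Phi>_def by (intro Weierstrass_m_test_general[OF _ M]) auto
  have part: "(\<lambda>z. \<Sum>\<alpha>\<in>A. trm \<alpha> z) holomorphic_on cball (complex_of_real s) \<delta>" for A
  proof -
    have sub: "cball (complex_of_real s) \<delta> \<subseteq> ball (complex_of_real s) (E i)" for i
      using \<delta>(2)[of i] by auto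
    show ?thesis
      unfolding trm_def by (intro holomorphic_intros holomorphic_on_subset[OF CR sub])
  qed
  have hol: "\<Phi> holomorphic_on ball (complex_of_real s) \<delta>"
  proof (rule holomorphic_uniform_limit[OF _ ulim])
    show "\<forall>\<^sub>F A in finite_subsets_at_top UNIV. continuous_on (cball (complex_of_real s) \<delta>) (\<lambda>z. \<Sum>\<alpha>\<in>A. trm \<alpha> z) \<and>
      (\<lambda>z. \<Sum>\<alpha>\<in>A. trm \<alpha> z) holomorphic_on ball (complex_of_real s) \<delta>"
      using part holomorphic_on_imp_continuous_on holomorphic_on_subset[OF part ball_subset_cball] by simp
  qed auto
  have "\<Phi> (complex_of_real y) = complex_of_real (f (c y) $ m)" if y: "y \<in> S" "dist y s < \<delta>" for y
  proof -
    have Cy: "C i (complex_of_real y) = complex_of_real (c y $ i)" for i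
      using Cc[OF y(1), of i] y(2) \<delta>(2)[of i] E(2)[of i] by linarith
    have yb: "complex_of_real y \<in> cball (complex_of_real s) \<delta>"
      using y(2) by (simp add: dist_of_real_complex dist_commute)
    have "\<bar>c y $ i - a $ i\<bar> \<le> \<rho>" for i
      using Cb[OF yb, of i] unfolding Cy of_real_diff[symmetric] norm_of_real .
    then have "((\<lambda>\<alpha>. (\<Prod>i\<in>UNIV. (c y $ i - a $ i) ^ \<alpha> i) * (K \<alpha> $ m)) has_sum f (c y) $ m) UNIV"
      using Km in_ball by blast
    then have "((\<lambda>\<alpha>. complex_of_real ((\<Prod>i\<in>UNIV. (c y $ i - a $ i) ^ \<alpha> i) * (K \<alpha> $ m))) has_sum complex_of_real (f (c y) $ m)) UNIV"
      by (rule has_sum_bounded_linear[OF bounded_linear_of_real])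
    moreover have "complex_of_real ((\<Prod>i\<in>UNIV. (c y $ i - a $ i) ^ \<alpha> i) * (K \<alpha> $ m)) = trm \<alpha> (complex_of_real y)" for \<alpha>
      by (simp add: trm_def Cy mult.commute)
    ultimately show ?thesis
      unfolding \<Phi>_def by (simp add: infsumI)
  qed
  then show "\<exists>r>0. \<exists>C. C holomorphic_on ball (complex_of_real s) r \<and>
      (\<forall>y\<in>S. dist y s < r \<longrightarrow> C (complex_of_real y) = complex_of_real (f (c y) $ m))"
    using \<delta>(1) hol by blast
qed

text \<open>\<open>T\<close> solves \<open>F (T y) = G y\<close> with analytic data and nonzero
  derivative of \<open>F\<close>, so locally it is a holomorphic inverse composed with an extension
  of \<open>G\<close>. The data may depend on \<open>s\<close>, because the component of a vector
  equation that is solvable for \<open>T\<close> may change from point to point.\<close>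

lemma analytic_real_on_inverse:
  assumes cont: "continuous_on S T"
    and inv: "\<And>s. s \<in> S \<Longrightarrow> \<exists>F F' G. analytic_real_on UNIV F \<and> (F has_real_derivative F') (at (T s)) \<and>
      F' \<noteq> 0 \<and> analytic_real_on S G \<and> (\<forall>y\<in>S. F (T y) = G y)"
  shows "analytic_real_on S T"
  unfolding analytic_real_on_def
proof
  fix s assume s: "s \<in> S"
  obtain F F' G where F: "analytic_real_on UNIV F" "(F has_real_derivative F') (at (T s))" "F' \<noteq> 0"
    and G: "analytic_real_on S G" "\<And>y. y \<in> S \<Longrightarrow> F (T y) = G y"
    using inv[OF s] by blast
  obtain r \<Phi> where \<Phi>: "r > 0" "\<Phi> holomorphic_on ball (complex_of_real (T s)) r"
    "\<And>y. dist y (T s) < r \<Longrightarrow> \<Phi> (complex_of_real y) = complex_of_real (F y)"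
    using analytic_real_onE[OF F(1), of "T s"] by (metis UNIV_I)
  obtain r' \<Gamma> where \<Gamma>: "r' > 0" "\<Gamma> holomorphic_on ball (complex_of_real s) r'"
    "\<And>y. y \<in> S \<Longrightarrow> dist y s < r' \<Longrightarrow> \<Gamma> (complex_of_real y) = complex_of_real (G y)"
    using analytic_real_onE[OF G(1) s] by metis
  \<comment> \<open>Restricted to the real line, the complex derivative of \<open>\<Phi>\<close>
    becomes the real derivative \<open>F'\<close>, hence is nonzero.\<close>
  have "(\<Phi> has_field_derivative deriv \<Phi> (complex_of_real (T s))) (at (complex_of_real (T s)))"
    by (rule holomorphic_derivI[OF \<Phi>(2)]) (use \<Phi>(1) in auto)
  then have "((\<lambda>y. \<Phi> (complex_of_real y)) has_vector_derivative deriv \<Phi> (complex_of_real (T s))) (at (T s))"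
    by (rule has_vector_derivative_real_field)
  then have "((\<lambda>y. complex_of_real (F y)) has_vector_derivative deriv \<Phi> (complex_of_real (T s))) (at (T s))"
  proof (rule has_vector_derivative_transform_within_open[where S = "ball (T s) r"])
    show "\<Phi> (complex_of_real y) = complex_of_real (F y)" if "y \<in> ball (T s) r" for y
      by (rule \<Phi>(3)) (use that in \<open>simp add: dist_commute\<close>)
  qed (use \<Phi>(1) in auto)
  moreover have "((\<lambda>y. complex_of_real (F y)) has_vector_derivative complex_of_real F') (at (T s))"
    using F(2) by (simp add: has_vector_derivative_of_real has_real_derivative_iff_has_vector_derivative)
  ultimately have "deriv \<Phi> (complex_of_real (T s)) \<noteq> 0"
    using F(3) vector_derivative_unique_at by fastforce
  then obtain e where e: "e > 0" "ball (complex_of_real (T s)) e \<subseteq> ball (complex_of_real (T s)) r"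
      "open (\<Phi> ` ball (complex_of_real (T s)) e)" "inj_on \<Phi> (ball (complex_of_real (T s)) e)"
    using has_complex_derivative_locally_invertible[OF \<Phi>(2) _ open_ball] \<Phi>(1) by (metis centre_in_ball)
  let ?B = "ball (complex_of_real (T s)) e"
  obtain \<Psi> where \<Psi>: "\<Psi> holomorphic_on (\<Phi> ` ?B)" "\<And>z. z \<in> ?B \<Longrightarrow> \<Psi> (\<Phi> z) = z"
    using holomorphic_has_inverse[OF holomorphic_on_subset[OF \<Phi>(2) e(2)] open_ball e(4)] by metis
  have "\<Gamma> (complex_of_real s) = \<Phi> (complex_of_real (T s))"
    using \<Gamma>(3)[OF s] \<Gamma>(1) \<Phi>(3)[of "T s"] \<Phi>(1) G(2)[OF s] by simp
  then have "\<Gamma> (complex_of_real s) \<in> \<Phi> ` ?B"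
    using e(1) by simp
  then obtain \<delta> where \<delta>: "\<delta> > 0" "\<delta> \<le> r'" "\<Gamma> ` ball (complex_of_real s) \<delta> \<subseteq> \<Phi> ` ?B"
    using holomorphic_on_ball_image_subset[OF \<Gamma>(2,1) e(3)] by metis
  \<comment> \<open>Continuity keeps \<open>T y\<close> in the disc where \<open>\<Phi>\<close> is
    injective; without it the local inverse could return another solution of the equation.\<close>
  obtain \<delta>' where \<delta>': "\<delta>' > 0" "\<And>y. y \<in> S \<Longrightarrow> dist y s < \<delta>' \<Longrightarrow> dist (T y) (T s) < e"
    using cont s e(1) unfolding continuous_on_iff by metis
  have hol: "(\<Psi> \<circ> \<Gamma>) holomorphic_on ball (complex_of_real s) (min \<delta> \<delta>')"
  proof (rule holomorphic_on_compose_gen[OF _ \<Psi>(1)])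
    show "\<Gamma> holomorphic_on ball (complex_of_real s) (min \<delta> \<delta>')"
      by (rule holomorphic_on_subset[OF \<Gamma>(2)]) (use \<delta>(2) in auto)
    show "\<Gamma> ` ball (complex_of_real s) (min \<delta> \<delta>') \<subseteq> \<Phi> ` ?B"
      using \<delta>(3) by (meson image_mono min.cobounded1 subset_ball subset_trans)
  qed
  have "\<Psi> (\<Gamma> (complex_of_real y)) = complex_of_real (T y)" if y: "y \<in> S" "dist y s < min \<delta> \<delta>'" for y
  proof -
    have d: "dist (T y) (T s) < e"
      using \<delta>'(2) y by simp
    then have B: "complex_of_real (T y) \<in> ?B"
      by (simp add: dist_of_real_complex dist_commute)
    then have "complex_of_real (T y) \<in> ball (complex_of_real (T s)) r"
      using e(2) by blast
    then have "\<Phi> (complex_of_real (T y)) = complex_of_real (F (T y))"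
      by (intro \<Phi>(3)) (simp add: dist_of_real_complex dist_commute)
    moreover have "\<Gamma> (complex_of_real y) = complex_of_real (G y)"
      using \<Gamma>(3) y \<delta>(2) by simp
    ultimately have "\<Gamma> (complex_of_real y) = \<Phi> (complex_of_real (T y))"
      using G(2)[OF y(1)] by simp
    then show ?thesis using \<Psi>(2)[OF B] by simp
  qed
  then show "\<exists>r>0. \<exists>C. C holomorphic_on ball (complex_of_real s) r \<and>
      (\<forall>y\<in>S. dist y s < r \<longrightarrow> C (complex_of_real y) = complex_of_real (T y))"
    using \<delta>(1) \<delta>'(1) hol by (intro exI[of _ "min \<delta> \<delta>'"] conjI exI[of _ "\<Psi> \<circ> \<Gamma>"]) auto
qed

section \<open>The identity theorem for functions flat at an end point\<close>

lemma islimpt_of_real_interval: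
  assumes "l < u" "x \<in> {l..u}"
  shows "complex_of_real x islimpt complex_of_real ` {l..u}"
proof (rule connected_imp_perfect)
  show "connected (complex_of_real ` {l..u})"
    by (intro connected_continuous_image continuous_intros) auto
  show "complex_of_real ` {l..u} \<noteq> {z}" for z
  proof
    assume "complex_of_real ` {l..u} = {z}"
    then have "complex_of_real l = z" "complex_of_real u = z"
      using assms(1) by (auto simp: set_eq_iff)
    then show False using assms(1) by (metis less_irrefl of_real_eq_iff)
  qed
qed (use assms in blast)

text \<open>A nonconstant holomorphic function with a zero has a finite order there, visible already
  along the positive real axis, which is the only direction in which flatness is known.\<close>

lemma holomorphic_flat_at_left_end:
  assumes "C holomorphic_on ball 0 r" "r > 0"
    and flat: "\<And>N::nat. \<exists>K \<delta>. \<delta> > 0 \<and> (\<forall>s. 0 \<le> s \<and> s < \<delta> \<longrightarrow> norm (C (complex_of_real s)) \<le> K * s ^ N)"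
    and w: "w \<in> ball 0 r"
  shows "C w = 0"
proof -
  have C0: "C 0 = 0"
  proof -
    obtain K \<delta> where "\<delta> > 0" "\<forall>s. 0 \<le> s \<and> s < \<delta> \<longrightarrow> norm (C (complex_of_real s)) \<le> K * s ^ (1::nat)"
      using flat[of 1] by blast
    then show ?thesis by (metis mult_zero_right norm_le_zero_iff of_real_0 order_refl power_one_right)
  qed
  have "C constant_on ball 0 r"
  proof (rule ccontr)
    assume nc: "\<not> C constant_on ball 0 r"
    have "0 \<in> ball 0 r" using assms(2) by simp
    then obtain g e n where g: "0 < n" "0 < e" "ball (0::complex) e \<subseteq> ball 0 r" "g holomorphic_on ball 0 e"
      "\<And>w. w \<in> ball 0 e \<Longrightarrow> C w = (w - 0) ^ n * g w" "\<And>w. w \<in> ball 0 e \<Longrightarrow> g w \<noteq> 0"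
      by (rule holomorphic_factor_zero_nonconstant[OF assms(1) open_ball connected_ball _ C0 nc]) (rule that)
    \<comment> \<open>One order more than the order \<open>n\<close> of the zero: after division by
      the \<open>n\<close>-th power, \<open>g\<close> is bounded by \<open>K * s\<close> and would
      vanish at 0.\<close>
    obtain K \<delta> where K: "\<delta> > 0" "\<And>s. 0 \<le> s \<Longrightarrow> s < \<delta> \<Longrightarrow> norm (C (complex_of_real s)) \<le> K * s ^ Suc n"
      using flat[of "Suc n"] by blast
    have "isCont g 0"
      using holomorphic_on_imp_continuous_on[OF g(4)] g(2) by (simp add: continuous_on_eq_continuous_at)
    then have "((\<lambda>s. norm (g (complex_of_real s))) \<longlongrightarrow> norm (g 0)) (at_right 0)"
      by (intro tendsto_norm isCont_tendsto_compose[of 0 g]) (auto intro!: tendsto_eq_intros)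
    moreover have "((\<lambda>s. K * s) \<longlongrightarrow> 0) (at_right (0::real))"
      by (auto intro!: tendsto_eq_intros)
    moreover have "\<forall>\<^sub>F s in at_right 0. norm (g (complex_of_real s)) \<le> K * s"
      unfolding eventually_at_right_field
    proof (intro exI[of _ "min \<delta> e"] conjI allI impI)
      show "0 < min \<delta> e" using K(1) g(2) by simp
      fix s assume s: "0 < s" "s < min \<delta> e"
      then have "norm (C (complex_of_real s)) = s ^ n * norm (g (complex_of_real s))"
        using g(5)[of "complex_of_real s"] by (simp add: norm_mult norm_power)
      then have "s ^ n * norm (g (complex_of_real s)) \<le> s ^ n * (K * s)"
        using K(2)[of s] s by (simp add: mult_ac)
      then show "norm (g (complex_of_real s)) \<le> K * s"
        using s(1) by simp
    qed
    ultimately have "norm (g 0) \<le> 0"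
      by (intro tendsto_le[of "at_right (0::real)" "\<lambda>s. K * s" 0 "\<lambda>s. norm (g (complex_of_real s))"]) auto
    then show False using g(6)[of 0] g(2) by simp
  qed
  then obtain k where "\<And>z. z \<in> ball 0 r \<Longrightarrow> C z = k"
    unfolding constant_on_def by blast
  then show ?thesis
    using C0 w assms(2) by (metis centre_in_ball)
qed

text \<open>Flatness gives vanishing near 0. Vanishing near one point of a disc spreads to all real
  points of that disc by the identity theorem, and connectedness of the interval carries it to
  1.\<close>

lemma analytic_real_on_flat_eq_0:
  assumes an: "analytic_real_on {0..1} \<phi>"
    and flat: "\<And>N::nat. \<exists>K \<delta>. \<delta> > 0 \<and> (\<forall>s\<in>{0..1}. s < \<delta> \<longrightarrow> \<bar>\<phi> s\<bar> \<le> K * s ^ N)"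
  shows "\<phi> 1 = 0"
proof -
  define P where "P s \<longleftrightarrow> (\<exists>\<epsilon>>0. \<forall>y\<in>{0..1}. dist y s < \<epsilon> \<longrightarrow> \<phi> y = 0)" for s
  have "P 1"
  proof (rule connected_induction_simple[of "{0..1::real}" 0 1 P])
    show "P 0"
    proof -
      obtain r C where C: "r > 0" "C holomorphic_on ball (complex_of_real 0) r"
        "\<And>y. y \<in> {0..1} \<Longrightarrow> dist y 0 < r \<Longrightarrow> C (complex_of_real y) = complex_of_real (\<phi> y)"
        by (rule analytic_real_onE[OF an, of 0]) auto
      have fl: "\<exists>K \<delta>. \<delta> > 0 \<and> (\<forall>s. 0 \<le> s \<and> s < \<delta> \<longrightarrow> norm (C (complex_of_real s)) \<le> K * s ^ N)" for N
      proof -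
        obtain K \<delta> where K: "\<delta> > 0" "\<forall>s\<in>{0..1}. s < \<delta> \<longrightarrow> \<bar>\<phi> s\<bar> \<le> K * s ^ N"
          using flat by blast
        have "norm (C (complex_of_real s)) \<le> K * s ^ N" if "0 \<le> s" "s < min (min \<delta> r) 1" for s
        proof -
          have "norm (C (complex_of_real s)) = \<bar>\<phi> s\<bar>"
            using C(3)[of s] that norm_of_real[of "\<phi> s"] by (simp add: dist_real_def)
          then show ?thesis using that K(2) by simp
        qed
        then show ?thesis
          using K(1) C(1) by (intro exI[of _ K] exI[of _ "min (min \<delta> r) 1"]) auto
      qed
      have "\<phi> y = 0" if y: "y \<in> {0..1}" "dist y 0 < r" for y
      proof -
        have "C (complex_of_real y) = 0"
          by (rule holomorphic_flat_at_left_end[OF _ C(1) fl]) (use C(2) y in auto)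
        then show ?thesis using C(3)[OF y] by simp
      qed
      then show ?thesis unfolding P_def using C(1) by blast
    qed
    fix s :: real assume s: "s \<in> {0..1}"
    obtain r C where C: "r > 0" "C holomorphic_on ball (complex_of_real s) r"
      "\<And>y. y \<in> {0..1} \<Longrightarrow> dist y s < r \<Longrightarrow> C (complex_of_real y) = complex_of_real (\<phi> y)"
      using analytic_real_onE[OF an s] by metis
    have main: "P y" if x: "x \<in> {0..1} \<inter> ball s r" and y: "y \<in> {0..1} \<inter> ball s r" and "P x" for x y
    proof -
      obtain \<epsilon> where \<epsilon>: "\<epsilon> > 0" "\<And>z. z \<in> {0..1} \<Longrightarrow> dist z x < \<epsilon> \<Longrightarrow> \<phi> z = 0"
        using \<open>P x\<close> unfolding P_def by blast
      obtain e where e: "e > 0" "ball x e \<subseteq> ball s r"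
        using x openE[OF open_ball, of x s r] by blast
      define d where "d = min e \<epsilon> / 2"
      have d: "d > 0" "d < e" "d < \<epsilon>" using e(1) \<epsilon>(1) by (auto simp: d_def)
      \<comment> \<open>A nondegenerate subinterval of the unit interval around \<open>x\<close> on
        which the function vanishes: its points accumulate, as the identity theorem
        requires.\<close>
      define l u where "l = max 0 (x - d)" and "u = min 1 (x + d)"
      have lu: "l < u" "x \<in> {l..u}" using x d(1) by (auto simp: l_def u_def)
      have z: "z \<in> {0..1} \<and> dist z x \<le> d" if "z \<in> {l..u}" for z
        using that by (auto simp: l_def u_def dist_real_def)
      have zs: "dist z s < r" if "z \<in> {l..u}" for z
      proof -
        have "z \<in> ball x e" using z[OF that] d(2) by (simp add: dist_commute)
        then have "z \<in> ball s r" using e(2) by blast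
        then show ?thesis by (simp add: dist_commute)
      qed
      have C0: "C w = 0" if w: "w \<in> ball (complex_of_real s) r" for w
      proof (rule analytic_continuation[OF C(2) open_ball connected_ball _ _ islimpt_of_real_interval[OF lu] _ w])
        show "complex_of_real ` {l..u} \<subseteq> ball (complex_of_real s) r"
          using zs by (auto simp: dist_of_real_complex dist_commute simp del: atLeastAtMost_iff)
        show "complex_of_real x \<in> ball (complex_of_real s) r"
          using x by (simp add: dist_of_real_complex)
        fix w assume "w \<in> complex_of_real ` {l..u}"
        then obtain z where zz: "z \<in> {l..u}" "w = complex_of_real z" by blast
        then have "\<phi> z = 0" using \<epsilon>(2)[of z] z[OF zz(1)] d(3) by auto
        then show "C w = 0" using C(3)[of z] z[OF zz(1)] zs[OF zz(1)] zz(2) by simp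
      qed
      obtain e' where e': "e' > 0" "ball y e' \<subseteq> ball s r"
        using y openE[OF open_ball, of y s r] by blast
      have "\<phi> v = 0" if v: "v \<in> {0..1}" "dist v y < e'" for v
      proof -
        have "v \<in> ball s r" by (rule subsetD[OF e'(2)]) (use v(2) in \<open>simp add: dist_commute\<close>)
        then have "dist v s < r" "complex_of_real v \<in> ball (complex_of_real s) r"
          by (auto simp: dist_of_real_complex dist_commute)
        then show ?thesis using C(3)[OF v(1)] C0 by simp
      qed
      then show ?thesis unfolding P_def using e'(1) by blast
    qed
    have "openin (top_of_set {0..1}) ({0..1} \<inter> ball s r)"
      by (simp add: openin_open_Int)
    moreover have "s \<in> {0..1} \<inter> ball s r" using s C(1) by simp
    ultimately show "\<exists>T. openin (top_of_set {0..1}) T \<and> s \<in> T \<and> (\<forall>x\<in>T. \<forall>y\<in>T. P x \<longrightarrow> P y)"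
      using main by blast
  qed auto
  then obtain \<epsilon> where "\<epsilon> > 0" "\<And>y. y \<in> {0..1} \<Longrightarrow> dist y 1 < \<epsilon> \<Longrightarrow> \<phi> y = 0"
    unfolding P_def by blast
  from this(2)[of 1] this(1) show ?thesis by simp
qed

section \<open>Latent laws and their supports\<close>

lemma sets_latent_law [measurable_cong]: "sets (latent_law p) = sets borel"
  by (simp add: latent_law_def)

lemma space_latent_law: "space (latent_law p) = UNIV"
  by (simp add: latent_law_def)

lemma compl_latent_domain:
  "- latent_domain p = \<Union>{U. open U \<and> emeasure (latent_law p) U = 0}"
  by (auto simp: latent_domain_def)

lemma closed_latent_domain: "closed (latent_domain p)"
proof -
  have "open (- latent_domain p)"
    unfolding compl_latent_domain by (rule open_Union) auto
  then show ?thesis by (simp add: closed_def)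
qed

text \<open>The complement is a union of possibly uncountably many open null sets; by Lindelof
  countably many of them already cover it.\<close>

lemma emeasure_compl_latent_domain: "emeasure (latent_law p) (- latent_domain p) = 0"
proof -
  let ?F = "{U. open U \<and> emeasure (latent_law p) U = 0}"
  obtain F where F: "F \<subseteq> ?F" "countable F" "\<Union>F = \<Union>?F"
    using Lindelof[of ?F] by auto
  have "U \<in> null_sets (latent_law p)" if "U \<in> F" for U
    using F(1) that by (auto simp: null_sets_def sets_latent_law)
  then have "(\<Union>U\<in>F. U) \<in> null_sets (latent_law p)"
    by (rule null_sets_UN'[OF F(2)])
  then show ?thesis
    using F(3) unfolding compl_latent_domain by (simp add: null_setsD1)
qed

lemma emeasure_latent_law_Int_domain:
  assumes "A \<in> sets borel"
  shows "emeasure (latent_law p) (A \<inter> latent_domain p) = emeasure (latent_law p) A"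
proof -
  have "emeasure (latent_law p) (A - - latent_domain p) = emeasure (latent_law p) A"
    by (rule emeasure_Diff_null_set)
      (use assms closed_latent_domain[of p] in \<open>auto simp: null_sets_def emeasure_compl_latent_domain sets_latent_law\<close>)
  then show ?thesis
    by (simp add: Diff_eq)
qed

lemma emeasure_latent_law_UNIV:
  assumes "p \<in> latent_densities"
  shows "emeasure (latent_law p) UNIV = 1"
  using assms by (simp add: latent_densities_def latent_law_def emeasure_density)

lemma emeasure_pushforward_latent_law:
  assumes "continuous_on UNIV f" "A \<in> sets borel"
  shows "emeasure (pushforward f (latent_law p)) A = emeasure (latent_law p) (f -` A)"
proof -
  have "f \<in> borel_measurable borel"
    using assms(1) by (rule borel_measurable_continuous_onI)
  then have "f \<in> measurable (latent_law p) borel"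
    by (simp add: measurable_cong_sets[OF sets_latent_law refl])
  then show ?thesis
    using assms(2) by (simp add: pushforward_def emeasure_distr space_latent_law)
qed

text \<open>A point \<open>f z\<close> outside the compact set on the right has an open
  neighbourhood avoiding it. This has positive mass for the first law, as \<open>z\<close> is in the
  support, and none for the second.\<close>

lemma image_latent_domain_subset:
  fixes f g :: "real^'d::finite \<Rightarrow> real^'m::finite"
  assumes "continuous_on UNIV f" "continuous_on UNIV g" "compact (latent_domain q)"
    and eq: "pushforward f (latent_law p) = pushforward g (latent_law q)"
  shows "f ` latent_domain p \<subseteq> g ` latent_domain q"
proof (rule ccontr)
  assume "\<not> ?thesis"
  then obtain z where z: "z \<in> latent_domain p" "f z \<notin> g ` latent_domain q" by blast
  define V where "V = - g ` latent_domain q"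
  have "closed (g ` latent_domain q)"
    using assms(2,3) by (intro compact_imp_closed compact_continuous_image) (auto intro: continuous_on_subset)
  then have V: "open V" by (simp add: V_def open_Compl)
  then have "open (f -` V)"
    using assms(1) open_vimage by blast
  moreover have "z \<in> f -` V" using z by (simp add: V_def)
  ultimately have "emeasure (latent_law p) (f -` V) > 0"
    using z(1) by (simp add: latent_domain_def)
  moreover have "emeasure (latent_law p) (f -` V) = emeasure (latent_law q) (g -` V)"
    using emeasure_pushforward_latent_law[OF assms(1), of V p] emeasure_pushforward_latent_law[OF assms(2), of V q]
      eq V by simp
  moreover have "emeasure (latent_law q) (g -` V) \<le> emeasure (latent_law q) (- latent_domain q)"
    using closed_latent_domain[of q] by (intro emeasure_mono) (auto simp: V_def sets_latent_law)
  ultimately show False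
    by (simp add: emeasure_compl_latent_domain)
qed

text \<open>Finite Borel measures are determined by their values on closed sets. Such a set is
  transported through the space of observations, where the two laws agree by assumption.\<close>

lemma latent_law_eq_pushforward:
  fixes f g :: "real^'d::finite \<Rightarrow> real^'m::finite" and T :: "real^'d \<Rightarrow> real^'d"
  assumes cont: "continuous_on UNIV f" "continuous_on UNIV g" "continuous_on UNIV T"
    and inj: "inj f" and comp: "compact (latent_domain p)" and dens: "p \<in> latent_densities"
    and eq: "pushforward f (latent_law p) = pushforward g (latent_law q)"
    and T: "\<And>u. u \<in> latent_domain q \<Longrightarrow> T u \<in> latent_domain p \<and> f (T u) = g u"
  shows "latent_law p = pushforward T (latent_law q)"
proof (rule measure_eqI_generator_eq[where \<Omega> = UNIV and E = "Collect closed" and A = "\<lambda>_. UNIV"])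
  show "Int_stable (Collect closed :: (real^'d) set set)"
    by (auto simp: Int_stable_def)
  have bor: "sets borel = sigma_sets UNIV (Collect closed :: (real^'d) set set)"
    by (subst borel_eq_closed) simp
  show "sets (latent_law p) = sigma_sets UNIV (Collect closed)"
    using bor by (simp add: sets_latent_law)
  show "sets (pushforward T (latent_law q)) = sigma_sets UNIV (Collect closed)"
    using bor by (simp add: pushforward_def)
  show "emeasure (latent_law p) UNIV \<noteq> \<infinity>" for i :: nat
    using emeasure_latent_law_UNIV[OF dens] by simp
next
  fix A :: "(real^'d) set" assume "A \<in> Collect closed"
  then have A: "closed A" by simp
  \<comment> \<open>Intersecting with the compact support first makes the image compact, hence
    closed and Borel.\<close>
  define K where "K = f ` (A \<inter> latent_domain p)"
  have "compact K"
    unfolding K_def using cont(1)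
    by (intro compact_continuous_image closed_Int_compact A comp) (auto intro: continuous_on_subset)
  then have "closed K"
    by (rule compact_imp_closed)
  then have K: "K \<in> sets borel" "closed K"
    by (simp_all add: borel_closed)
  have vT: "T -` A \<in> sets borel" and vg: "g -` K \<in> sets borel"
    by (intro borel_closed closed_vimage[OF A cont(3)], intro borel_closed closed_vimage[OF K(2) cont(2)])
  have "emeasure (latent_law p) A = emeasure (latent_law p) (A \<inter> latent_domain p)"
    using A by (simp add: emeasure_latent_law_Int_domain)
  also have "A \<inter> latent_domain p = f -` K"
    using inj by (auto simp: K_def inj_def)
  also have "emeasure (latent_law p) (f -` K) = emeasure (latent_law q) (g -` K)"
    using emeasure_pushforward_latent_law[OF cont(1) K(1), of p] emeasure_pushforward_latent_law[OF cont(2) K(1), of q]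
    by (simp add: eq)
  also have "\<dots> = emeasure (latent_law q) (g -` K \<inter> latent_domain q)"
    using vg by (simp add: emeasure_latent_law_Int_domain)
  also have "g -` K \<inter> latent_domain q = T -` A \<inter> latent_domain q"
  proof -
    have "g u \<in> K \<longleftrightarrow> T u \<in> A" if "u \<in> latent_domain q" for u
      using T[OF that] injD[OF inj] unfolding K_def by (metis IntD1 IntI imageE imageI)
    then show ?thesis by auto
  qed
  also have "emeasure (latent_law q) (T -` A \<inter> latent_domain q) = emeasure (latent_law q) (T -` A)"
    using vT by (simp add: emeasure_latent_law_Int_domain)
  also have "\<dots> = emeasure (pushforward T (latent_law q)) A"
    using A by (simp add: emeasure_pushforward_latent_law[OF cont(3)])
  finally show "emeasure (latent_law p) A = emeasure (pushforward T (latent_law q)) A" .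
qed auto

lemma strictly_monotone_on_imp_inj_on: "strictly_monotone_on A \<phi> \<Longrightarrow> inj_on \<phi> A"
proof (rule inj_onI)
  fix x y assume m: "strictly_monotone_on A \<phi>" and xy: "x \<in> A" "y \<in> A" "\<phi> x = \<phi> y"
  show "x = y"
  proof (rule ccontr)
    assume "x \<noteq> y"
    then have "x < y \<or> y < x" by linarith
    then have "\<phi> x < \<phi> y \<or> \<phi> y < \<phi> x"
      using m xy(1,2) unfolding strictly_monotone_on_def monotone_on_def by blast
    then show False using xy(3) by simp
  qed
qed

text \<open>Each \<phi> is a homeomorphism from a coordinate projection of the support onto the unit
  interval, so the projections are intervals; surjectivity onto the cube makes the support their
  full product.\<close>

lemma full_support_imp_box:
  fixes p :: "real^'d::finite \<Rightarrow> real"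
  assumes "full_support p"
  obtains a b where "\<And>i. a $ i < b $ i" "latent_domain p = cbox a b"
proof -
  define S where "S = latent_domain p"
  define A where "A i = (\<lambda>z. z $ i) ` S" for i
  obtain \<phi> where cont: "\<And>i. continuous_on (A i) (\<phi> i)" and mono: "\<And>i. strictly_monotone_on (A i) (\<phi> i)"
    and im: "coordinatewise \<phi> ` S = cbox 0 1"
    using assms unfolding full_support_def S_def A_def by blast
  have "compact S"
    using assms closed_latent_domain[of p] by (simp add: full_support_def S_def compact_eq_bounded_closed)
  then have compA: "compact (A i)" for i
    unfolding A_def by (intro compact_continuous_image continuous_intros)
  have inj: "inj_on (\<phi> i) (A i)" for i
    using mono strictly_monotone_on_imp_inj_on by blast
  have imA: "\<phi> i ` A i = {0..1}" for i
  proof -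
    have "\<phi> i ` A i = (\<lambda>z. z $ i) ` (coordinatewise \<phi> ` S)"
      unfolding A_def image_image coordinatewise_def by simp
    also have "\<dots> = (\<lambda>z. z $ i) ` cbox 0 1"
      using im by simp
    also have "\<dots> = {0..1}"
    proof
      show "(\<lambda>z. z $ i) ` cbox (0::real^'d) 1 \<subseteq> {0..1}"
        by (auto simp: mem_box_cart)
      show "{0..1} \<subseteq> (\<lambda>z. z $ i) ` cbox (0::real^'d) 1"
      proof
        fix x :: real assume "x \<in> {0..1}"
        then show "x \<in> (\<lambda>z. z $ i) ` cbox (0::real^'d) 1"
          by (intro image_eqI[of _ _ "\<chi> j. x"]) (auto simp: mem_box_cart)
      qed
    qed
    finally show ?thesis .
  qed
  have "\<exists>l u. l < u \<and> A i = {l..u}" for i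
  proof -
    \<comment> \<open>A continuous injection on a compact set has a continuous inverse, which
      carries connectedness of the unit interval back to the projection.\<close>
    have "continuous_on (\<phi> i ` A i) (inv_into (A i) (\<phi> i))"
      by (rule continuous_on_inv[OF cont compA]) (use inj in simp)
    then have "connected (inv_into (A i) (\<phi> i) ` \<phi> i ` A i)"
      unfolding imA by (rule connected_continuous_image) simp
    then have "connected (A i)"
      by (simp add: inv_into_image_cancel inj)
    then obtain l u where lu: "A i = {l..u}"
      using compA connected_compact_interval_1 by blast
    have "{0, 1} \<subseteq> \<phi> i ` {l..u}"
      using imA[of i] lu by simp
    then obtain x y where "x \<in> {l..u}" "y \<in> {l..u}" "\<phi> i x = 0" "\<phi> i y = 1"
      by (metis imageE insert_subset)
    then have "l < u"
      by (metis atLeastAtMost_iff leD less_eq_real_def order_antisym order_trans zero_neq_one linorder_not_less)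
    then show ?thesis using lu by blast
  qed
  then obtain l u where lu: "\<And>i. l i < u i" "\<And>i. A i = {l i..u i}"
    by metis
  have "S = cbox (\<chi> i. l i) (\<chi> i. u i)"
  proof
    show "S \<subseteq> cbox (\<chi> i. l i) (\<chi> i. u i)"
    proof
      fix z assume "z \<in> S"
      then have "z $ i \<in> A i" for i by (simp add: A_def)
      then show "z \<in> cbox (\<chi> i. l i) (\<chi> i. u i)" using lu(2) by (simp add: mem_box_cart)
    qed
    show "cbox (\<chi> i. l i) (\<chi> i. u i) \<subseteq> S"
    proof
      fix z assume "z \<in> cbox (\<chi> i. l i) (\<chi> i. u i)"
      then have z: "z $ i \<in> A i" for i using lu(2) by (simp add: mem_box_cart)
      then have "\<phi> i (z $ i) \<in> {0..1}" for i using imA by blast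
      then have "coordinatewise \<phi> z \<in> cbox 0 1"
        by (simp add: mem_box_cart coordinatewise_def)
      \<comment> \<open>Injectivity in each coordinate identifies the preimage \<open>w\<close> of
        this cube point, which lies in the support, with \<open>z\<close>.\<close>
      then obtain w where w: "w \<in> S" "coordinatewise \<phi> z = coordinatewise \<phi> w"
        using im by (metis imageE)
      have "z $ i = w $ i" for i
      proof -
        have "\<phi> i (z $ i) = \<phi> i (w $ i)"
          using w(2) by (simp add: coordinatewise_def vec_eq_iff)
        moreover have "w $ i \<in> A i" using w(1) by (simp add: A_def)
        ultimately show ?thesis using inj_onD[OF inj] z by blast
      qed
      then show "z \<in> S" using w(1) by (metis vec_eq_iff)
    qed
  qed
  then show ?thesis
    using that[of "\<chi> i. l i" "\<chi> i. u i"] lu(1) by (simp add: S_def)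
qed

section \<open>Orthogonal parametrizations of the same image\<close>

abbreviation partial :: "(real^'d::finite \<Rightarrow> 'b::real_normed_vector) \<Rightarrow> 'd \<Rightarrow> real^'d \<Rightarrow> 'b" where
  "partial f i z \<equiv> frechet_derivative f (at z) (axis i 1)"

lemma column_jacobian: "column i (jacobian f (at z)) = partial f i z"
  by (simp add: column_def jacobian_def matrix_def vec_eq_iff)

lemma linear_eq_sum_axis:
  fixes D :: "real^'d::finite \<Rightarrow> 'b::real_vector"
  assumes "linear D"
  shows "D v = (\<Sum>i\<in>UNIV. v $ i *\<^sub>R D (axis i 1))"
proof -
  have "D v = D (\<Sum>i\<in>UNIV. v $ i *\<^sub>R axis i 1)"
    using basis_expansion[of v] by (simp add: scalar_mult_eq_scaleR)
  also have "\<dots> = (\<Sum>i\<in>UNIV. v $ i *\<^sub>R D (axis i 1))"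
    by (simp only: linear_sum[OF assms] linear_cmul[OF assms])
  finally show ?thesis .
qed

section \<open>Mixing functions are immersions\<close>

lemma mixing_functions_smooth:
  assumes "f \<in> mixing_functions"
  shows "smooth_on_open UNIV f"
  using assms unfolding mixing_functions_def diffeomorphism_betw_def
  by (intro smooth_map_on_UNIV) simp

lemma mixing_functions_inj:
  assumes "f \<in> mixing_functions"
  shows "inj f"
  using assms unfolding mixing_functions_def diffeomorphism_betw_def bij_betw_def by simp

text \<open>The left inverse is defined on an open set of the ambient space of observations, so it
  can be composed with any smooth map into that space. It takes the place of an inverse function
  theorem.\<close>

lemma mixing_functions_local_left_inverse:
  assumes "f \<in> mixing_functions"
  obtains V G where "f z \<in> V" "smooth_on_open V G" "\<And>w. f w \<in> V \<Longrightarrow> G (f w) = w"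
proof -
  have "smooth_map_on (range f) (inv f)"
    using assms unfolding mixing_functions_def diffeomorphism_betw_def by simp
  then obtain V G where VG: "f z \<in> V" "smooth_on_open V G" "\<forall>y\<in>range f \<inter> V. G y = inv f y"
    unfolding smooth_map_on_def by blast
  have "G (f w) = w" if "f w \<in> V" for w
    using VG(3) that inv_f_f[OF mixing_functions_inj[OF assms]] by simp
  then show ?thesis using that VG by blast
qed

lemma mixing_functions_partial_nonzero:
  assumes "f \<in> mixing_functions"
  shows "partial f i z \<noteq> 0"
proof
  assume 0: "partial f i z = 0"
  obtain V G where VG: "f z \<in> V" "smooth_on_open V G" "\<And>w. f w \<in> V \<Longrightarrow> G (f w) = w"
    using mixing_functions_local_left_inverse[OF assms] by metis
  note f = mixing_functions_smooth[OF assms]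
  have op: "open (f -` V)"
    using open_vimage[OF smooth_on_openD(1)[OF VG(2)]] smooth_on_openD(3)[OF f] by blast
  have "((\<lambda>w. G (f w)) has_derivative (\<lambda>v. frechet_derivative G (at (f z)) (frechet_derivative f (at z) v))) (at z)"
    by (rule has_derivative_compose[OF smooth_on_openD(4)[OF f] smooth_on_openD(4)[OF VG(2,1)]]) simp
  then have "((\<lambda>w. w) has_derivative (\<lambda>v. frechet_derivative G (at (f z)) (frechet_derivative f (at z) v))) (at z)"
    by (rule has_derivative_transform_within_open[OF _ op]) (use VG in auto)
  then have "(\<lambda>v. v) = (\<lambda>v. frechet_derivative G (at (f z)) (frechet_derivative f (at z) v))"
    using has_derivative_unique[OF has_derivative_ident] by blast
  then have "axis i 1 = frechet_derivative G (at (f z)) (partial f i z)"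
    by metis
  also have "\<dots> = 0"
    unfolding 0 using has_derivative_linear[OF smooth_on_openD(4)[OF VG(2,1)]] linear_0 by blast
  finally show False
    by (simp add: axis_eq_0_iff)
qed

lemma frame_nth: "frame f z $ m $ i = partial f i z $ m / norm (partial f i z)"
  by (simp add: frame_def column_norms_def column_jacobian) (simp add: jacobian_def matrix_def)

text \<open>Each entry is the cosine of the angle between a column of \<open>f\<close> and a column
  of \<open>g\<close> at the same observation, when \<open>g u = f (h u)\<close>.\<close>

lemma relative_frame_nth:
  "relative_frame f g h u $ k $ i =
     (partial f k (h u) \<bullet> partial g i u) / (norm (partial f k (h u)) * norm (partial g i u))"
  by (simp add: relative_frame_def matrix_matrix_mult_def transpose_def frame_nth inner_vec_def sum_divide_distrib)

lemma smooth_on_open_normalized_inner: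
  fixes x y :: "'a::real_normed_vector \<Rightarrow> 'b::euclidean_space"
  assumes "smooth_on_open U x" "smooth_on_open U y" "\<And>u. u \<in> U \<Longrightarrow> x u \<noteq> 0" "\<And>u. u \<in> U \<Longrightarrow> y u \<noteq> 0"
  shows "smooth_on_open U (\<lambda>u. (x u \<bullet> y u) / (norm (x u) * norm (y u)))"
proof -
  have inv_norm: "smooth_on_open U (\<lambda>u. (z u \<bullet> z u) powr (- 1/2))"
    if "smooth_on_open U z" "\<And>u. u \<in> U \<Longrightarrow> z u \<noteq> 0" for z :: "'a \<Rightarrow> 'b"
    by (rule smooth_on_open_compose[OF smooth_on_open_powr smooth_on_open_inner[OF that(1) that(1)]])
      (use that(2) in auto)
  have eq: "(z \<bullet> z) powr (- 1/2) = 1 / norm z" for z :: 'b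
    by (simp add: norm_eq_sqrt_inner powr_minus_divide powr_half_sqrt)
  have "smooth_on_open U (\<lambda>u. (x u \<bullet> y u) * ((x u \<bullet> x u) powr (- 1/2) * (y u \<bullet> y u) powr (- 1/2)))"
    by (intro smooth_on_open_mult smooth_on_open_inner inv_norm assms)
  then show ?thesis
    unfolding eq by simp
qed

lemma cbox_add_axis_iff:
  fixes u :: "real^'d::finite"
  assumes "u \<in> cbox a b"
  shows "u + c *\<^sub>R axis i 1 \<in> cbox a b \<longleftrightarrow> a $ i \<le> u $ i + c \<and> u $ i + c \<le> b $ i"
proof -
  have "(u + c *\<^sub>R axis i 1) $ j = (if j = i then u $ i + c else u $ j)" for j
    by (simp add: axis_def)
  then show ?thesis
    using assms by (auto simp: mem_box_cart)
qed

text \<open>The data on \<open>h\<close> reduce to bijectivity and \<open>gfh\<close>; its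
  smoothness is derived from that of \<open>f\<close> and \<open>g\<close>. In this form the setting
  is symmetric under exchange of the two models.\<close>

locale orthogonal_box_pair =
  fixes f g :: "real^'d::finite \<Rightarrow> real^'n::finite" and h :: "real^'d \<Rightarrow> real^'d"
    and a b a' b' :: "real^'d"
  assumes f: "f \<in> mixing_functions" "orthogonal_columns f"
    and g: "g \<in> mixing_functions" "orthogonal_columns g"
    and ab: "\<And>i. a $ i < b $ i" "\<And>i. a' $ i < b' $ i"
    and bij: "bij_betw h (cbox a b) (cbox a' b')"
    and gfh: "\<And>u. u \<in> cbox a b \<Longrightarrow> g u = f (h u)"
begin

text \<open>Gives every statement about \<open>h\<close> a counterpart for its inverse; the zero
  pattern of the relative frame needs both.\<close>

lemma swap: "orthogonal_box_pair g f (inv_into (cbox a b) h) a' b' a b"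
proof (unfold_locales; (fact f g ab)?)
  show "bij_betw (inv_into (cbox a b) h) (cbox a' b') (cbox a b)"
    using bij bij_betw_inv_into by blast
  show "f x = g (inv_into (cbox a b) h x)" if "x \<in> cbox a' b'" for x
    using gfh bij that by (metis bij_betw_imp_surj_on f_inv_into_f inv_into_into)
qed

lemma h_in: "u \<in> cbox a b \<Longrightarrow> h u \<in> cbox a' b'"
  using bij bij_betwE by blast

lemma inv_h: "u \<in> cbox a b \<Longrightarrow> inv_into (cbox a b) h (h u) = u"
  using bij by (simp add: bij_betw_def)

lemma corner_in: "a \<in> cbox a b"
  using ab(1) by (simp add: mem_box_cart less_imp_le)

lemma orthogonal:
  "i \<noteq> j \<Longrightarrow> partial f i z \<bullet> partial f j z = 0" "i \<noteq> j \<Longrightarrow> partial g i z \<bullet> partial g j z = 0"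
  using f(2) g(2) by (simp_all add: orthogonal_columns_def column_jacobian)

text \<open>Near \<open>u\<close>, \<open>h\<close> is a smooth left inverse of \<open>f\<close>
  composed with \<open>g\<close>, and this composite makes sense on an open set reaching across the
  boundary of the box.\<close>

lemma h_local_extension:
  assumes "u \<in> cbox a b"
  obtains U F where "u \<in> U" "smooth_on_open U F" "\<And>y. y \<in> cbox a b \<inter> U \<Longrightarrow> F y = h y"
proof -
  obtain V G where VG: "f (h u) \<in> V" "smooth_on_open V G" "\<And>w. f w \<in> V \<Longrightarrow> G (f w) = w"
    using mixing_functions_local_left_inverse[OF f(1)] by metis
  note sg = mixing_functions_smooth[OF g(1)]
  have op: "open (g -` V)"
    using open_vimage[OF smooth_on_openD(1)[OF VG(2)]] smooth_on_openD(3)[OF sg] by blast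
  have "smooth_on_open (g -` V) (\<lambda>x. G (g x))"
    by (rule smooth_on_open_compose[OF VG(2) smooth_on_open_subset[OF sg op]]) auto
  moreover have "u \<in> g -` V"
    using VG(1) gfh[OF assms] by simp
  moreover have "G (g y) = h y" if "y \<in> cbox a b \<inter> g -` V" for y
    using VG(3) gfh that by auto
  ultimately show ?thesis using that by blast
qed

lemma smooth_h: "smooth_map_on (cbox a b) h"
  unfolding smooth_map_on_def
proof
  fix u assume "u \<in> cbox a b"
  then show "\<exists>U F. u \<in> U \<and> smooth_on_open U F \<and> (\<forall>y\<in>cbox a b \<inter> U. F y = h y)"
    using h_local_extension by metis
qed

text \<open>The derivative of \<open>h\<close>: the coefficients of the image of \<open>v\<close>
  under the derivative of \<open>g\<close> in the orthogonal system of columns of \<open>f\<close>,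
  whence the squared norms.\<close>

definition h' :: "real^'d \<Rightarrow> real^'d \<Rightarrow> real^'d" where
  "h' u v = (\<chi> k. (partial f k (h u) \<bullet> frechet_derivative g (at u) v) / (norm (partial f k (h u)))\<^sup>2)"

lemma h_derivative:
  assumes u: "u \<in> cbox a b"
  shows "(h has_derivative h' u) (at u within cbox a b)"
    and "frechet_derivative g (at u) v = (\<Sum>k\<in>UNIV. h' u v $ k *\<^sub>R partial f k (h u))"
proof -
  obtain U F where UF: "u \<in> U" "smooth_on_open U F" "\<And>y. y \<in> cbox a b \<inter> U \<Longrightarrow> F y = h y"
    using h_local_extension[OF u] by metis
  define D where "D = frechet_derivative F (at u)"
  have D: "(h has_derivative D) (at u within cbox a b)"
    unfolding D_def
    by (rule has_derivative_within_local[OF smooth_on_openD(1)[OF UF(2)] _ UF(3) smooth_on_openD(4)[OF UF(2,1)]])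
      (use u UF(1) in auto)
  note sf = smooth_on_openD(4)[OF mixing_functions_smooth[OF f(1)] UNIV_I]
    and sg = smooth_on_openD(4)[OF mixing_functions_smooth[OF g(1)] UNIV_I]
  have "((\<lambda>y. f (h y)) has_derivative (\<lambda>v. frechet_derivative f (at (h u)) (D v))) (at u within cbox a b)"
    by (rule has_derivative_compose[OF D sf])
  from has_derivative_transform[OF u gfh this]
  have "(g has_derivative (\<lambda>v. frechet_derivative f (at (h u)) (D v))) (at u within cbox a b)"
    by simp
  moreover have "(g has_derivative frechet_derivative g (at u)) (at u within cbox a b)"
    using sg has_derivative_at_withinI by blast
  \<comment> \<open>Nondegeneracy of the box makes derivatives within it unique at boundary points
    too, so the derivative of \<open>g\<close> can be compared with the one from the chain
    rule.\<close>
  moreover have "a \<bullet> e < b \<bullet> e" if "e \<in> Basis" for e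
    using that ab(1) by (auto simp: Basis_vec_def inner_axis)
  ultimately have eq: "frechet_derivative g (at u) = (\<lambda>v. frechet_derivative f (at (h u)) (D v))"
    using frechet_derivative_unique_within_closed_interval[OF _ u] by metis
  have lin: "frechet_derivative g (at u) v = (\<Sum>k\<in>UNIV. D v $ k *\<^sub>R partial f k (h u))" for v
    unfolding eq by (rule linear_eq_sum_axis[OF has_derivative_linear[OF sf]])
  have "D v $ k = h' u v $ k" for v k
  proof -
    have "partial f k (h u) \<bullet> frechet_derivative g (at u) v
        = (\<Sum>j\<in>UNIV. D v $ j * (partial f k (h u) \<bullet> partial f j (h u)))"
      unfolding lin by (simp add: inner_sum_right)
    also have "\<dots> = (\<Sum>j\<in>UNIV. if j = k then D v $ k * (norm (partial f k (h u)))\<^sup>2 else 0)"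
      by (rule sum.cong) (auto simp: orthogonal(1) power2_norm_eq_inner)
    also have "\<dots> = D v $ k * (norm (partial f k (h u)))\<^sup>2"
      by simp
    finally show ?thesis
      using mixing_functions_partial_nonzero[OF f(1)] by (simp add: h'_def)
  qed
  then have Dh: "D = h' u"
    by (simp add: fun_eq_iff vec_eq_iff)
  show "(h has_derivative h' u) (at u within cbox a b)"
    using D Dh by simp
  show "frechet_derivative g (at u) v = (\<Sum>k\<in>UNIV. h' u v $ k *\<^sub>R partial f k (h u))"
    using lin Dh by simp
qed

lemma linear_h': "u \<in> cbox a b \<Longrightarrow> linear (h' u)"
  using h_derivative(1) has_derivative_linear by blast

lemma continuous_on_h: "continuous_on (cbox a b) h"
  using h_derivative(1) has_derivative_continuous_on by blast

text \<open>Entry of the transposed Jacobian of \<open>f\<close> times the Jacobian of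
  \<open>g\<close>. It has the signs and zeros of both the derivative of \<open>h\<close> and the
  relative frame, without their normalizations.\<close>

definition gram :: "'d \<Rightarrow> 'd \<Rightarrow> real^'d \<Rightarrow> real" where
  "gram k i u = partial f k (h u) \<bullet> partial g i u"

lemma h'_axis: "h' u (axis i 1) $ k = gram k i u / (norm (partial f k (h u)))\<^sup>2"
  by (simp add: h'_def gram_def)

lemma segment_in:
  assumes "u \<in> cbox a b" "u + w \<in> cbox a b" "t \<in> {0..1}"
  shows "u + t *\<^sub>R w \<in> cbox a b"
proof -
  have "(1 - t) *\<^sub>R u + t *\<^sub>R (u + w) \<in> cbox a b"
    using convexD_alt[OF convex_box(1) assms(1,2), of t] assms(3) by simp
  then show ?thesis by (simp add: algebra_simps)
qed

lemma h_derivative_segment: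
  assumes "u \<in> cbox a b" "u + w \<in> cbox a b" "t \<in> {0..1}"
  shows "((\<lambda>t. h (u + t *\<^sub>R w) $ k) has_real_derivative h' (u + t *\<^sub>R w) w $ k) (at t within {0..1})"
proof -
  let ?p = "\<lambda>t. u + t *\<^sub>R w"
  have im: "?p ` {0..1} \<subseteq> cbox a b"
    using segment_in[OF assms(1,2)] by blast
  have "(?p has_derivative (\<lambda>s. s *\<^sub>R w)) (at t within {0..1})"
    by (auto intro!: derivative_eq_intros)
  moreover have "(h has_derivative h' (?p t)) (at (?p t) within ?p ` {0..1})"
    using has_derivative_subset[OF h_derivative(1) im] segment_in[OF assms] by blast
  ultimately have "((\<lambda>t. h (?p t)) has_derivative (\<lambda>s. h' (?p t) (s *\<^sub>R w))) (at t within {0..1})"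
    by (rule has_derivative_in_compose)
  then have "((\<lambda>t. h (?p t) $ k) has_derivative (\<lambda>s. h' (?p t) (s *\<^sub>R w) $ k)) (at t within {0..1})"
    by (rule bounded_linear.has_derivative[OF bounded_linear_vec_nth])
  moreover have "h' (?p t) (s *\<^sub>R w) $ k = h' (?p t) w $ k * s" for s
    using linear_cmul[OF linear_h'[OF segment_in[OF assms]]] by simp
  ultimately show ?thesis
    by (simp add: has_field_derivative_def)
qed

text \<open>Moving from \<open>u\<close> into the box, a coordinate of \<open>h\<close> that sits at its extreme value can only move
  inwards.\<close>

lemma gram_sign:
  assumes "u \<in> cbox a b" "u + c *\<^sub>R axis i 1 \<in> cbox a b"
  shows "h u $ k = a' $ k \<Longrightarrow> c * gram k i u \<ge> 0" and "h u $ k = b' $ k \<Longrightarrow> c * gram k i u \<le> 0"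
proof -
  let ?w = "c *\<^sub>R axis i (1::real)"
  let ?\<phi> = "\<lambda>t. h (u + t *\<^sub>R ?w) $ k"
  let ?d = "h' (u + 0 *\<^sub>R ?w) ?w $ k"
  have der: "(?\<phi> has_real_derivative ?d) (at 0 within {0..1})"
    by (rule h_derivative_segment[OF assms]) simp
  have "?d = c * (gram k i u / (norm (partial f k (h u)))\<^sup>2)"
    using linear_cmul[OF linear_h'[OF assms(1)]] h'_axis by simp
  then have d: "c * gram k i u = ?d * (norm (partial f k (h u)))\<^sup>2"
    using mixing_functions_partial_nonzero[OF f(1)] by simp
  have rng: "a' $ k \<le> ?\<phi> t" "?\<phi> t \<le> b' $ k" if "t \<in> {0..1}" for t
    using h_in[OF segment_in[OF assms that]] by (simp_all add: mem_box_cart)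
  show "c * gram k i u \<ge> 0" if "h u $ k = a' $ k"
  proof (rule ccontr)
    assume "\<not> ?thesis"
    then have "?d < 0" unfolding d by (simp add: not_le mult_less_0_iff)
    then obtain e where e: "e > 0" "\<And>t. t > 0 \<Longrightarrow> 0 + t \<in> {0..1} \<Longrightarrow> t < e \<Longrightarrow> ?\<phi> (0 + t) < ?\<phi> 0"
      using has_real_derivative_neg_dec_right[OF der] by blast
    have "?\<phi> (0 + min 1 (e/2)) < ?\<phi> 0"
      by (rule e(2)) (use e(1) in auto)
    then show False using rng(1)[of "min 1 (e/2)"] e(1) that by simp
  qed
  show "c * gram k i u \<le> 0" if "h u $ k = b' $ k"
  proof (rule ccontr)
    assume "\<not> ?thesis"
    then have "?d > 0" unfolding d by (simp add: not_le zero_less_mult_iff)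
    then obtain e where e: "e > 0" "\<And>t. t > 0 \<Longrightarrow> 0 + t \<in> {0..1} \<Longrightarrow> t < e \<Longrightarrow> ?\<phi> 0 < ?\<phi> (0 + t)"
      using has_real_derivative_pos_inc_right[OF der] by blast
    have "?\<phi> 0 < ?\<phi> (0 + min 1 (e/2))"
      by (rule e(2)) (use e(1) in auto)
    then show False using rng(2)[of "min 1 (e/2)"] e(1) that by simp
  qed
qed

text \<open>From \<open>u\<close> one can move along coordinate \<open>i\<close> in both directions,
  and the sign constraint for an extreme coordinate of \<open>h\<close> then holds with either
  sign.\<close>

lemma gram_zero_of_interior:
  assumes u: "u \<in> cbox a b" and i: "u $ i \<noteq> a $ i" "u $ i \<noteq> b $ i"
    and k: "h u $ k = a' $ k \<or> h u $ k = b' $ k"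
  shows "gram k i u = 0"
proof -
  have lt: "a $ i < u $ i" "u $ i < b $ i"
    using u i by (auto simp: mem_box_cart less_le)
  define c1 c2 where "c1 = b $ i - u $ i" and "c2 = a $ i - u $ i"
  have c: "c1 > 0" "c2 < 0" using lt by (auto simp: c1_def c2_def)
  have in1: "u + c1 *\<^sub>R axis i 1 \<in> cbox a b" and in2: "u + c2 *\<^sub>R axis i 1 \<in> cbox a b"
    unfolding cbox_add_axis_iff[OF u] c1_def c2_def using lt by auto
  from k show ?thesis
  proof
    assume "h u $ k = a' $ k"
    then have "c1 * gram k i u \<ge> 0" "c2 * gram k i u \<ge> 0"
      using gram_sign(1)[OF u in1] gram_sign(1)[OF u in2] by auto
    then show ?thesis using c by (simp add: zero_le_mult_iff)
  next
    assume "h u $ k = b' $ k"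
    then have "c1 * gram k i u \<le> 0" "c2 * gram k i u \<le> 0"
      using gram_sign(2)[OF u in1] gram_sign(2)[OF u in2] by auto
    then show ?thesis using c by (simp add: mult_le_0_iff)
  qed
qed

text \<open>Parseval's identity: the columns of \<open>g\<close> lie in the span of the orthogonal
  columns of \<open>f\<close>.\<close>

lemma sum_gram:
  assumes "u \<in> cbox a b"
  shows "(\<Sum>k\<in>UNIV. gram k i u * gram k j u / (norm (partial f k (h u)))\<^sup>2) = partial g i u \<bullet> partial g j u"
proof -
  have "partial g i u \<bullet> partial g j u = (\<Sum>k\<in>UNIV. h' u (axis i 1) $ k *\<^sub>R partial f k (h u)) \<bullet> partial g j u"
    using h_derivative(2)[OF assms] by metis
  also have "\<dots> = (\<Sum>k\<in>UNIV. gram k i u * gram k j u / (norm (partial f k (h u)))\<^sup>2)"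
    by (simp add: inner_sum_left h'_axis gram_def)
  finally show ?thesis by simp
qed

text \<open>The previous vanishing argument applied to the inverse of \<open>h\<close>, whose
  \<open>gram\<close> matrix is the transpose.\<close>

lemma gram_zero_of_image_interior:
  assumes u: "u \<in> cbox a b" and k: "h u $ k \<noteq> a' $ k" "h u $ k \<noteq> b' $ k"
    and i: "u $ i = a $ i \<or> u $ i = b $ i"
  shows "gram k i u = 0"
proof -
  interpret sw: orthogonal_box_pair g f "inv_into (cbox a b) h" a' b' a b
    by (rule swap)
  have "sw.gram i k (h u) = 0"
    by (rule sw.gram_zero_of_interior[OF h_in[OF u] k]) (use i inv_h[OF u] in simp)
  then show ?thesis
    by (simp add: sw.gram_def gram_def inv_h[OF u] inner_commute)
qed

text \<open>At corners and on edges the sign constraints on \<open>gram\<close> make all terms of the orthogonality relation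
  between two columns have the same sign, so each of them vanishes.\<close>

lemma gram_monomial_on_edges:
  assumes u: "u \<in> cbox a b" and ij: "i \<noteq> j"
    and edge: "\<And>i j. i \<noteq> j \<Longrightarrow> (u $ i = a $ i \<or> u $ i = b $ i) \<or> (u $ j = a $ j \<or> u $ j = b $ j)"
  shows "gram k i u = 0 \<or> gram k j u = 0"
proof (cases "h u $ k = a' $ k \<or> h u $ k = b' $ k")
  case False
  then show ?thesis
    using edge[OF ij] gram_zero_of_image_interior[OF u] by blast
next
  case True
  show ?thesis
  proof (cases "(u $ i = a $ i \<or> u $ i = b $ i) \<and> (u $ j = a $ j \<or> u $ j = b $ j)")
    case False
    then show ?thesis
      using gram_zero_of_interior[OF u _ _ True] by blast
  next
    case act: True
    \<comment> \<open>The displacement from \<open>u\<close> to the opposite face; its sign records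
      the inward direction, so weighting the entries by it makes signs comparable across
      columns.\<close>
    define c where "c i = (if u $ i = a $ i then b $ i - a $ i else a $ i - b $ i)" for i
    have c0: "c i \<noteq> 0" for i
      using ab(1)[of i] by (auto simp: c_def)
    have cin: "u + c i *\<^sub>R axis i 1 \<in> cbox a b" if "u $ i = a $ i \<or> u $ i = b $ i" for i
      unfolding cbox_add_axis_iff[OF u] using that ab(1)[of i] by (auto simp: c_def)
    have pos: "(c i * gram l i u) * (c j * gram l j u) \<ge> 0" for l
    proof (cases "h u $ l = a' $ l \<or> h u $ l = b' $ l")
      case False
      then show ?thesis using gram_zero_of_image_interior[OF u] act by simp
    next
      case True
      then show ?thesis
        using gram_sign[OF u cin[of i], of l] gram_sign[OF u cin[of j], of l] act
        by (auto intro: mult_nonneg_nonneg mult_nonpos_nonpos)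
    qed
    define q where "q l = (c i * gram l i u) * (c j * gram l j u) / (norm (partial f l (h u)))\<^sup>2" for l
    have "(\<Sum>l\<in>UNIV. q l) = c i * c j * (\<Sum>l\<in>UNIV. gram l i u * gram l j u / (norm (partial f l (h u)))\<^sup>2)"
      unfolding q_def sum_distrib_left by (rule sum.cong) (auto simp: mult_ac)
    then have "(\<Sum>l\<in>UNIV. q l) = 0"
      using sum_gram[OF u] orthogonal(2)[OF ij] by simp
    moreover have "q l \<ge> 0" for l
      unfolding q_def using pos by simp
    ultimately have "q k = 0"
      by (simp add: sum_nonneg_eq_0_iff)
    then show ?thesis
      using c0 mixing_functions_partial_nonzero[OF f(1)] by (simp add: q_def)
  qed
qed

section \<open>The relative frame on the edges through the corner\<close>

abbreviation R :: "real^'d \<Rightarrow> real^'d^'d" where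
  "R \<equiv> relative_frame f g h"

lemma R_nth: "R u $ k $ i = gram k i u / (norm (partial f k (h u)) * norm (partial g i u))"
  by (simp add: relative_frame_nth gram_def)

lemma gram_eq: "gram k i u = R u $ k $ i * (norm (partial f k (h u)) * norm (partial g i u))"
  using mixing_functions_partial_nonzero[OF f(1)] mixing_functions_partial_nonzero[OF g(1)]
  by (simp add: R_nth)

lemma R_orthonormal_columns:
  assumes u: "u \<in> cbox a b"
  shows "(\<Sum>k\<in>UNIV. R u $ k $ i * R u $ k $ j) = (if i = j then 1 else 0)"
proof -
  have "(\<Sum>k\<in>UNIV. R u $ k $ i * R u $ k $ j)
      = (\<Sum>k\<in>UNIV. gram k i u * gram k j u / (norm (partial f k (h u)))\<^sup>2) / (norm (partial g i u) * norm (partial g j u))"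
    unfolding sum_divide_distrib by (rule sum.cong) (auto simp: R_nth power2_eq_square field_simps)
  also have "\<dots> = (partial g i u \<bullet> partial g j u) / (norm (partial g i u) * norm (partial g j u))"
    by (simp only: sum_gram[OF u])
  also have "\<dots> = (if i = j then 1 else 0)"
    using orthogonal(2)[of i j u] mixing_functions_partial_nonzero[OF g(1), of u i]
    by (auto simp: norm_eq_sqrt_inner)
  finally show ?thesis .
qed

text \<open>For a square matrix a left inverse is a right inverse. This is where the equality of the
  two latent dimensions enters.\<close>

lemma R_orthonormal_rows:
  assumes u: "u \<in> cbox a b"
  shows "(\<Sum>i\<in>UNIV. R u $ k $ i * R u $ l $ i) = (if k = l then 1 else 0)"
proof -
  have "transpose (R u) ** R u = mat 1"
    using R_orthonormal_columns[OF u]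
    by (simp add: vec_eq_iff matrix_matrix_mult_def transpose_def mat_def)
  then have "R u ** transpose (R u) = mat 1"
    using matrix_left_right_inverse by blast
  then have "(R u ** transpose (R u)) $ k $ l = mat 1 $ k $ l"
    by simp
  then show ?thesis
    by (simp add: matrix_matrix_mult_def transpose_def mat_def)
qed

lemma R_local_extension:
  assumes u: "u \<in> cbox a b"
  obtains U F where "u \<in> U" "smooth_on_open U F" "\<And>y. y \<in> cbox a b \<inter> U \<Longrightarrow> F y = R y"
proof -
  obtain U H where UH: "u \<in> U" "smooth_on_open U H" "\<And>y. y \<in> cbox a b \<inter> U \<Longrightarrow> H y = h y"
    using h_local_extension[OF u] by metis
  note U = smooth_on_openD(1)[OF UH(2)]
  have "smooth_on_open U (\<lambda>y. partial f k (H y))" for k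
    by (rule smooth_on_open_compose[OF smooth_on_openD(5)[OF mixing_functions_smooth[OF f(1)]] UH(2)]) simp
  moreover have "smooth_on_open U (\<lambda>y. partial g i y)" for i
    by (rule smooth_on_open_subset[OF smooth_on_openD(5)[OF mixing_functions_smooth[OF g(1)]] U]) simp
  ultimately have "smooth_on_open U (\<lambda>y. \<chi> k i. (partial f k (H y) \<bullet> partial g i y) /
      (norm (partial f k (H y)) * norm (partial g i y)))"
    using mixing_functions_partial_nonzero[OF f(1)] mixing_functions_partial_nonzero[OF g(1)]
    by (intro smooth_on_open_vec_lambda U smooth_on_open_normalized_inner)
  moreover have "(\<chi> k i. (partial f k (H y) \<bullet> partial g i y) /
      (norm (partial f k (H y)) * norm (partial g i y))) = R y" if "y \<in> cbox a b \<inter> U" for y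
    by (simp only: UH(3)[OF that] vec_eq_iff relative_frame_nth vec_lambda_beta simp_thms)
  ultimately show ?thesis using that UH(1) by blast
qed

lemma continuous_on_R: "continuous_on (cbox a b) R"
  unfolding continuous_on_eq_continuous_within
proof
  fix u assume u: "u \<in> cbox a b"
  obtain U F where UF: "u \<in> U" "smooth_on_open U F" "\<And>y. y \<in> cbox a b \<inter> U \<Longrightarrow> F y = R y"
    using R_local_extension[OF u] by metis
  have "(R has_derivative frechet_derivative F (at u)) (at u within cbox a b)"
    by (rule has_derivative_within_local[OF smooth_on_openD(1)[OF UF(2)] _ UF(3) smooth_on_openD(4)[OF UF(2,1)]])
      (use u UF(1) in auto)
  then show "continuous (at u within cbox a b) R"
    by (rule has_derivative_continuous)
qed

text \<open>The parameter is the value of coordinate \<open>i\<close> itself, not the distance from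
  the corner, so functions along the edge are functions of the latent coordinate.\<close>

definition edge_point :: "'d \<Rightarrow> real \<Rightarrow> real^'d" where
  "edge_point i s = a + (s - a $ i) *\<^sub>R axis i 1"

lemma edge_point_nth: "edge_point i s $ j = (if j = i then s else a $ j)"
  by (simp add: edge_point_def axis_def)

lemma edge_point_in: "s \<in> {a $ i..b $ i} \<Longrightarrow> edge_point i s \<in> cbox a b"
  using ab(1) by (simp add: mem_box_cart edge_point_nth less_imp_le)

lemma edge_point_corner: "edge_point i (a $ i) = a"
  by (simp add: edge_point_def)

lemma gram_monomial_edge_point:
  assumes "s \<in> {a $ l..b $ l}" "i \<noteq> j"
  shows "gram k i (edge_point l s) = 0 \<or> gram k j (edge_point l s) = 0"
  by (rule gram_monomial_on_edges[OF edge_point_in[OF assms(1)] assms(2)]) (auto simp: edge_point_nth)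

text \<open>A row of unit length with at most one nonzero entry has that entry equal to 1 or
  -1.\<close>

lemma R_entries_edge_point:
  assumes s: "s \<in> {a $ l..b $ l}"
  shows "R (edge_point l s) $ k $ i \<in> {0, 1, -1}"
proof (cases "R (edge_point l s) $ k $ i = 0")
  case False
  let ?u = "edge_point l s"
  have 0: "R ?u $ k $ j = 0" if "j \<noteq> i" for j
    using gram_monomial_edge_point[OF s that, of k] False by (auto simp: R_nth)
  have "(\<Sum>j\<in>UNIV. R ?u $ k $ j * R ?u $ k $ j) = (\<Sum>j\<in>UNIV. if j = i then R ?u $ k $ i * R ?u $ k $ i else 0)"
    by (rule sum.cong) (use 0 in auto)
  then have "R ?u $ k $ i * R ?u $ k $ i = 1"
    using R_orthonormal_rows[OF edge_point_in[OF s], of k k] by simp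
  then show ?thesis
    using square_eq_1_iff by auto
qed simp

text \<open>A continuous function with finitely many values on an interval is constant.\<close>

lemma R_edge_point:
  assumes s: "s \<in> {a $ l..b $ l}"
  shows "R (edge_point l s) = R a"
proof -
  have "R (edge_point l s) $ k $ i = R a $ k $ i" for k i
  proof -
    let ?\<phi> = "\<lambda>s. R (edge_point l s) $ k $ i"
    have "continuous_on {a $ l..b $ l} (edge_point l)"
      unfolding edge_point_def by (intro continuous_intros)
    then have "continuous_on {a $ l..b $ l} (\<lambda>s. R (edge_point l s))"
      by (rule continuous_on_compose2[OF continuous_on_R]) (use edge_point_in in auto)
    then have "continuous_on {a $ l..b $ l} ?\<phi>"
      by (intro continuous_on_component)
    moreover have "finite (?\<phi> ` {a $ l..b $ l})"
      by (rule finite_subset[of _ "{0, 1, -1}"]) (use R_entries_edge_point in blast, simp)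
    ultimately have "?\<phi> constant_on {a $ l..b $ l}"
      using continuous_finite_range_constant[OF connected_Icc] by blast
    moreover have "a $ l \<in> {a $ l..b $ l}"
      using ab(1)[of l] by simp
    ultimately show ?thesis
      using s edge_point_corner[of l] unfolding constant_on_def by metis
  qed
  then show ?thesis by (simp add: vec_eq_iff)
qed

end

section \<open>Flatness of the relative frame at a corner\<close>

text \<open>Counterpart of \<open>mixed_partial_within\<close> with ordinary derivatives, to be
  applied to smooth extensions on open sets.\<close>

definition iterated_partial ::
    "'d list \<Rightarrow> (real^'d::finite \<Rightarrow> 'b::real_normed_vector) \<Rightarrow> real^'d \<Rightarrow> 'b" where
  "iterated_partial is F = foldr (\<lambda>i F. partial F i) is F"

lemma iterated_partial_simps [simp]:
  "iterated_partial [] F = F"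
  "iterated_partial (i # is) F = partial (iterated_partial is F) i"
  by (simp_all add: iterated_partial_def)

lemma smooth_on_open_iterated_partial:
  "smooth_on_open U F \<Longrightarrow> smooth_on_open U (iterated_partial is F)"
  by (induction "is") (auto intro: smooth_on_openD(5))

lemma iterated_partial_snoc: "iterated_partial (is @ [i]) F = iterated_partial is (partial F i)"
  by (simp add: iterated_partial_def)

text \<open>In place of Taylor's formula: the partial derivatives of \<open>F\<close> inherit the
  hypothesis and are small of order \<open>N\<close> by induction, and the mean value inequality
  gains one more order.\<close>

lemma smooth_flat_at_point:
  fixes F :: "real^'d::finite \<Rightarrow> 'b::euclidean_space"
  assumes "smooth_on_open U F" "u0 \<in> U" "\<And>is. is \<noteq> [] \<Longrightarrow> iterated_partial is F u0 = 0"
  shows "\<exists>C \<delta>. C \<ge> 0 \<and> \<delta> > 0 \<and> (\<forall>u\<in>ball u0 \<delta>. norm (F u - F u0) \<le> C * norm (u - u0) ^ N)"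
  using assms(1,3)
proof (induction N arbitrary: F)
  case 0
  have "isCont F u0"
    using smooth_on_openD(1,3)[OF 0(1)] assms(2) by (simp add: continuous_on_eq_continuous_at)
  then obtain \<delta> where "\<delta> > 0" "\<And>u. dist u u0 < \<delta> \<Longrightarrow> dist (F u) (F u0) < 1"
    unfolding continuous_at_eps_delta dist_norm using zero_less_one by blast
  then show ?case
    by (intro exI[of _ 1] exI[of _ \<delta>]) (auto simp: dist_norm norm_minus_commute less_imp_le)
next
  case (Suc N)
  have "\<exists>C \<delta>. C \<ge> 0 \<and> \<delta> > 0 \<and> (\<forall>u\<in>ball u0 \<delta>. norm (partial F i u) \<le> C * norm (u - u0) ^ N)" for i
  proof -
    have "partial F i u0 = 0"
      using Suc.prems(2)[of "[i]"] by simp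
    \<comment> \<open>The last list entry is differentiated first, so appending \<open>i\<close>
      describes the derivatives of \<open>partial F i\<close>.\<close>
    moreover have "iterated_partial is (partial F i) u0 = 0" for "is"
      using Suc.prems(2)[of "is @ [i]"] by (simp add: iterated_partial_snoc)
    ultimately show ?thesis
      using Suc.IH[OF smooth_on_openD(5)[OF Suc.prems(1), of "axis i 1"]] by simp
  qed
  then obtain C \<delta> where C: "\<And>i. C i \<ge> 0" and \<delta>: "\<And>i. \<delta> i > 0"
    and bd: "\<And>i u. u \<in> ball u0 (\<delta> i) \<Longrightarrow> norm (partial F i u) \<le> C i * norm (u - u0) ^ N"
    by metis
  obtain e where e: "e > 0" "ball u0 e \<subseteq> U"
    using openE[OF smooth_on_openD(1)[OF Suc.prems(1)] assms(2)] by blast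
  define d where "d = min e (Min (range \<delta>))"
  have Min_pos: "Min (range \<delta>) > 0" using \<delta> by simp
  have Min_le: "Min (range \<delta>) \<le> \<delta> i" for i by simp
  have d: "d > 0" "d \<le> e" "d \<le> \<delta> i" for i
    using Min_pos Min_le[of i] e(1) unfolding d_def by linarith+
  define K where "K = (\<Sum>i\<in>UNIV. C i)"
  have K: "K \<ge> 0" using C by (simp add: K_def sum_nonneg)
  have "norm (F u - F u0) \<le> K * norm (u - u0) ^ Suc N" if u: "u \<in> ball u0 d" for u
  proof -
    \<comment> \<open>A convex set containing \<open>u\<close> and \<open>u0\<close> in which no
      point is farther from \<open>u0\<close> than \<open>u\<close>, so that the derivative bound is
      uniform on it.\<close>
    let ?S = "cball u0 (norm (u - u0))"
    have S: "x \<in> U" "x \<in> ball u0 (\<delta> i)" if "x \<in> ?S" for x i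
    proof -
      have "dist u0 x < d" using that u by (simp add: dist_norm norm_minus_commute)
      then show "x \<in> U" "x \<in> ball u0 (\<delta> i)"
        using d(2) d(3)[of i] e(2) by (auto simp: subset_iff)
    qed
    have "norm (F u - F u0) \<le> K * norm (u - u0) ^ N * norm (u - u0)"
    proof (rule differentiable_bound[of ?S F "\<lambda>x. frechet_derivative F (at x)"])
      show "(F has_derivative frechet_derivative F (at x)) (at x within ?S)" if "x \<in> ?S" for x
        using smooth_on_openD(4)[OF Suc.prems(1) S(1)[OF that]] has_derivative_at_withinI by blast
      show "onorm (frechet_derivative F (at x)) \<le> K * norm (u - u0) ^ N" if x: "x \<in> ?S" for x
      proof (rule onorm_bound)
        show "0 \<le> K * norm (u - u0) ^ N" using K by simp
        fix v
        have lin: "linear (frechet_derivative F (at x))"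
          using smooth_on_openD(4)[OF Suc.prems(1) S(1)[OF x]] has_derivative_linear by blast
        have "norm (frechet_derivative F (at x) v) \<le> (\<Sum>i\<in>UNIV. norm (v $ i *\<^sub>R partial F i x))"
          by (subst linear_eq_sum_axis[OF lin]) (rule norm_sum)
        also have "\<dots> \<le> (\<Sum>i\<in>UNIV. norm v * (C i * norm (u - u0) ^ N))"
        proof (rule sum_mono)
          fix i
          have "norm (partial F i x) \<le> C i * norm (x - u0) ^ N"
            by (rule bd[OF S(2)[OF x]])
          also have "\<dots> \<le> C i * norm (u - u0) ^ N"
            using x C by (intro mult_left_mono power_mono) (auto simp: dist_norm norm_minus_commute)
          finally show "norm (v $ i *\<^sub>R partial F i x) \<le> norm v * (C i * norm (u - u0) ^ N)"
            unfolding norm_scaleR real_norm_def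
            by (intro mult_mono component_le_norm_cart) auto
        qed
        also have "\<dots> = K * norm (u - u0) ^ N * norm v"
          by (simp add: K_def sum_distrib_left sum_distrib_right mult_ac)
        finally show "norm (frechet_derivative F (at x) v) \<le> K * norm (u - u0) ^ N * norm v" .
      qed
    qed (auto simp: dist_norm norm_minus_commute)
    then show ?thesis by (simp add: mult_ac)
  qed
  then show ?case using K d(1) by blast
qed

text \<open>Identifies one-sided derivatives at boundary points with those of a smooth extension.
  The induction keeps \<open>u\<close> general because the outer derivative needs the inner identity
  at all nearby points of the box.\<close>

lemma mixed_partial_within_cbox:
  fixes F G :: "real^'d::finite \<Rightarrow> 'b::real_normed_vector"
  assumes ab: "\<And>i. a $ i < b $ i" and F: "smooth_on_open U F"
    and eq: "\<And>y. y \<in> cbox a b \<inter> U \<Longrightarrow> F y = G y" and u: "u \<in> cbox a b \<inter> U"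
  shows "mixed_partial_within (cbox a b) is G u = iterated_partial is F u"
  using u
proof (induction "is" arbitrary: u)
  case Nil
  then show ?case using eq by (simp add: mixed_partial_within_def)
next
  case (Cons i js)
  let ?H = "mixed_partial_within (cbox a b) js G" and ?K = "iterated_partial js F"
  let ?p = "\<lambda>s::real. u + s *\<^sub>R axis i 1"
  let ?S = "{s. ?p s \<in> cbox a b}"
  have uc: "u \<in> cbox a b" "u \<in> U" using Cons.prems by auto
  have S: "?S = {a $ i - u $ i..b $ i - u $ i}"
    using cbox_add_axis_iff[OF uc(1)] by (auto simp: algebra_simps)
  have 0: "0 \<in> ?S" using uc(1) by simp
  \<comment> \<open>The slice of the box is a nondegenerate closed interval containing 0, so a
    derivative within it is unique even if 0 is an end point.\<close>
  have lim: "at 0 within ?S \<noteq> bot"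
    using 0 ab[of i] unfolding S
    by (simp add: trivial_limit_within islimpt_Icc)
  have D: "(?K has_derivative frechet_derivative ?K (at u)) (at u)"
    by (rule smooth_on_openD(4)[OF smooth_on_open_iterated_partial[OF F] uc(2)])
  have "(?p has_derivative (\<lambda>s. s *\<^sub>R axis i 1)) (at 0)"
    by (auto intro!: derivative_eq_intros)
  then have "((\<lambda>s. ?K (?p s)) has_derivative (\<lambda>s. frechet_derivative ?K (at u) (s *\<^sub>R axis i 1))) (at 0)"
    by (rule has_derivative_compose) (use D in simp)
  then have der: "((\<lambda>s. ?K (?p s)) has_derivative (\<lambda>s. s *\<^sub>R partial ?K i u)) (at 0)"
    by (simp add: linear_cmul[OF has_derivative_linear[OF D]])
  have opn: "open (?p -` U)"
    by (rule open_vimage[OF smooth_on_openD(1)[OF F]]) (intro continuous_intros)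
  have "((\<lambda>s. ?H (?p s)) has_derivative (\<lambda>s. s *\<^sub>R partial ?K i u)) (at 0 within ?S)"
    by (rule has_derivative_within_local[OF opn _ _ der]) (use uc 0 Cons.IH in auto)
  then have "vector_derivative (\<lambda>s. ?H (?p s)) (at 0 within ?S) = partial ?K i u"
    by (intro vector_derivative_within lim) (simp add: has_vector_derivative_def)
  then show ?case
    by (simp add: mixed_partial_within_def partial_within_def)
qed

context orthogonal_box_pair
begin

lemma pure_partials_R_corner:
  assumes "k \<ge> 1"
  shows "mixed_partial_within (cbox a b) (replicate k i) R a = 0"
proof -
  \<comment> \<open>The claim covers the whole edge, since differentiating once more along it needs
    the previous derivative at all its points. The case \<open>k = 0\<close> is constancy of
    \<open>R\<close>.\<close>
  have "mixed_partial_within (cbox a b) (replicate k i) R (edge_point i s) = (if k = 0 then R a else 0)"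
    if "s \<in> {a $ i..b $ i}" for k s
    using that
  proof (induction k arbitrary: s)
    case 0
    then show ?case by (simp add: mixed_partial_within_def R_edge_point)
  next
    case (Suc k)
    let ?H = "mixed_partial_within (cbox a b) (replicate k i) R"
    let ?p = "\<lambda>t::real. edge_point i s + t *\<^sub>R axis i 1"
    let ?S = "{t. ?p t \<in> cbox a b}"
    have p: "?p t = edge_point i (s + t)" for t
      by (simp add: edge_point_def algebra_simps)
    have S: "?S = {a $ i - s..b $ i - s}"
      using cbox_add_axis_iff[OF edge_point_in[OF Suc.prems]] by (auto simp: edge_point_nth algebra_simps)
    have lim: "at 0 within ?S \<noteq> bot"
      using Suc.prems ab(1)[of i] unfolding S by (simp add: trivial_limit_within islimpt_Icc)
    have const: "?H (?p t) = (if k = 0 then R a else 0)" if "t \<in> ?S" for t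
      unfolding p by (rule Suc.IH) (use that S in auto)
    have "((\<lambda>t. ?H (?p t)) has_vector_derivative 0) (at 0 within ?S)"
    proof (rule has_vector_derivative_transform)
      show "0 \<in> ?S" using edge_point_in[OF Suc.prems] by simp
      show "?H (?p t) = (if k = 0 then R a else 0)" if "t \<in> ?S" for t
        by (rule const[OF that])
    qed (rule has_vector_derivative_const)
    then have "vector_derivative (\<lambda>t. ?H (?p t)) (at 0 within ?S) = 0"
      by (intro vector_derivative_within lim)
    then show ?case
      by (simp add: mixed_partial_within_def partial_within_def)
  qed
  from this[of "a $ i" k] show ?thesis
    using assms ab(1)[of i] by (simp add: edge_point_corner)
qed

end

text \<open>Adds the second part of the functional orthogonality assumption for this pair, the only
  link between pure and mixed partial derivatives of \<open>R\<close>.\<close>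

locale controlled_box_pair = orthogonal_box_pair f g h a b a' b'
  for f g :: "real^'d::finite \<Rightarrow> real^'n::finite" and h a b a' b' +
  assumes control: "pure_partials_control_mixed (cbox a b) (relative_frame f g h)"
begin

text \<open>Derivatives within the box at the corner are those of a smooth extension around it, to
  which the flatness estimate applies. The bound is entrywise because only entries that vanish at
  the corner are used.\<close>

lemma R_flat:
  "\<exists>C \<delta>. C \<ge> 0 \<and> \<delta> > 0 \<and> (\<forall>u\<in>cbox a b \<inter> ball a \<delta>. \<forall>k i. \<bar>R u $ k $ i - R a $ k $ i\<bar> \<le> C * norm (u - a) ^ N)"
proof -
  obtain U F where UF: "a \<in> U" "smooth_on_open U F" "\<And>y. y \<in> cbox a b \<inter> U \<Longrightarrow> F y = R y"
    using R_local_extension[OF corner_in] by metis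
  have "mixed_partial_within (cbox a b) is R a = 0" if "is \<noteq> []" for "is"
    using control pure_partials_R_corner corner_in that
    unfolding pure_partials_control_mixed_def by (simp add: Suc_le_eq)
  then have "iterated_partial is F a = 0" if "is \<noteq> []" for "is"
    using mixed_partial_within_cbox[OF ab(1) UF(2,3), of a "is"] UF(1) corner_in that by simp
  then obtain C \<delta> where C: "C \<ge> 0" "\<delta> > 0" "\<And>u. u \<in> ball a \<delta> \<Longrightarrow> norm (F u - F a) \<le> C * norm (u - a) ^ N"
    using smooth_flat_at_point[OF UF(2,1), of N] by blast
  obtain e where e: "e > 0" "ball a e \<subseteq> U"
    using openE[OF smooth_on_openD(1)[OF UF(2)] UF(1)] by blast
  have "\<bar>R u $ k $ i - R a $ k $ i\<bar> \<le> C * norm (u - a) ^ N" if u: "u \<in> cbox a b" "u \<in> ball a (min \<delta> e)" for u k i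
  proof -
    have "u \<in> U" using u(2) e(2) by (auto simp: subset_iff)
    then have "F u = R u" "F a = R a"
      using UF(1,3) u(1) corner_in by auto
    then have "norm (R u - R a) \<le> C * norm (u - a) ^ N"
      using C(3)[of u] u(2) by simp
    moreover have "\<bar>(R u - R a) $ k $ i\<bar> \<le> norm ((R u - R a) $ k)"
      by (rule component_le_norm_cart)
    moreover have "norm ((R u - R a) $ k) \<le> norm (R u - R a)"
      by (rule Finite_Cartesian_Product.norm_nth_le)
    ultimately show ?thesis by simp
  qed
  then show ?thesis
    using C(1,2) e(1) by (intro exI[of _ C] exI[of _ "min \<delta> e"]) auto
qed

end

section \<open>The coordinatewise form of the transition map\<close>

lemma (in orthogonal_box_pair) edge_derivative:
  assumes "s \<in> {a $ i..b $ i}"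
  shows "((\<lambda>s. h (edge_point i s) $ k) has_real_derivative
      gram k i (edge_point i s) / (norm (partial f k (h (edge_point i s))))\<^sup>2) (at s within {a $ i..b $ i})"
proof -
  let ?I = "{a $ i..b $ i}"
  let ?p = "edge_point i"
  have im: "?p ` ?I \<subseteq> cbox a b"
    using edge_point_in by blast
  have "(?p has_derivative (\<lambda>t. t *\<^sub>R axis i 1)) (at s within ?I)"
    unfolding edge_point_def by (auto intro!: derivative_eq_intros)
  moreover have "(h has_derivative h' (?p s)) (at (?p s) within ?p ` ?I)"
    using has_derivative_subset[OF h_derivative(1) im] edge_point_in[OF assms] by blast
  ultimately have "((\<lambda>s. h (?p s)) has_derivative (\<lambda>t. h' (?p s) (t *\<^sub>R axis i 1))) (at s within ?I)"
    by (rule has_derivative_in_compose)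
  then have "((\<lambda>s. h (?p s) $ k) has_derivative (\<lambda>t. h' (?p s) (t *\<^sub>R axis i 1) $ k)) (at s within ?I)"
    by (rule bounded_linear.has_derivative[OF bounded_linear_vec_nth])
  moreover have "h' (?p s) (t *\<^sub>R axis i 1) $ k = gram k i (?p s) / (norm (partial f k (h (?p s))))\<^sup>2 * t" for t
    using linear_cmul[OF linear_h'[OF edge_point_in[OF assms]]] by (simp add: h'_axis)
  ultimately show ?thesis
    unfolding has_field_derivative_def by (simp only:)
qed

lemma (in orthogonal_box_pair) ex_corner_pattern:
  "\<exists>\<sigma>. bij \<sigma> \<and> (\<forall>i. R a $ \<sigma> i $ i \<noteq> 0) \<and> (\<forall>i k. k \<noteq> \<sigma> i \<longrightarrow> R a $ k $ i = 0)"
proof -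
  have row: "R a $ k $ i = 0 \<or> R a $ k $ j = 0" if "i \<noteq> j" for k i j
    using gram_monomial_edge_point[of "a $ i" i i j k] that ab(1)[of i]
    by (auto simp: R_nth edge_point_corner)
  have "\<exists>k. R a $ k $ i \<noteq> 0" for i
  proof (rule ccontr)
    assume "\<not> ?thesis"
    then have "(\<Sum>k\<in>UNIV. R a $ k $ i * R a $ k $ i) = 0" by simp
    then show False using R_orthonormal_columns[OF corner_in, of i i] by simp
  qed
  then obtain \<sigma> where \<sigma>: "\<And>i. R a $ \<sigma> i $ i \<noteq> 0" by metis
  have "inj \<sigma>"
    using \<sigma> row by (metis injI)
  then have bij: "bij \<sigma>"
    by (simp add: bij_def finite_UNIV_inj_surj)
  have "R a $ k $ i = 0" if "k \<noteq> \<sigma> i" for i k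
  proof -
    obtain j where "k = \<sigma> j" using bij by (metis bij_pointE)
    then show ?thesis using row[of j i k] \<sigma>[of j] that by auto
  qed
  then show ?thesis using bij \<sigma> by blast
qed

context controlled_box_pair
begin

text \<open>\<open>corner_perm i\<close> is the coordinate of \<open>h\<close> that moves along the
  edge in direction \<open>i\<close>; the pattern determines it uniquely.\<close>

definition corner_perm :: "'d \<Rightarrow> 'd" where
  "corner_perm = (SOME \<sigma>. bij \<sigma> \<and> (\<forall>i. R a $ \<sigma> i $ i \<noteq> 0) \<and> (\<forall>i k. k \<noteq> \<sigma> i \<longrightarrow> R a $ k $ i = 0))"

abbreviation "\<sigma> \<equiv> corner_perm"

lemma corner_perm: "bij \<sigma>" "R a $ \<sigma> i $ i \<noteq> 0" "k \<noteq> \<sigma> i \<Longrightarrow> R a $ k $ i = 0"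
  using someI_ex[OF ex_corner_pattern] unfolding corner_perm_def[symmetric] by blast+

lemma corner_perm_inv [simp]: "\<sigma> (inv \<sigma> k) = k" "inv \<sigma> (\<sigma> i) = i"
  using corner_perm(1) by (simp_all add: bij_def surj_f_inv_f)

definition T :: "'d \<Rightarrow> real \<Rightarrow> real" where
  "T i s = h (edge_point i s) $ \<sigma> i"

definition T' :: "'d \<Rightarrow> real \<Rightarrow> real" where
  "T' i s = gram (\<sigma> i) i (edge_point i s) / (norm (partial f (\<sigma> i) (h (edge_point i s))))\<^sup>2"

lemma T_derivative: "s \<in> {a $ i..b $ i} \<Longrightarrow> (T i has_real_derivative T' i s) (at s within {a $ i..b $ i})"
  unfolding T_def T'_def by (rule edge_derivative)

text \<open>\<open>T'\<close> is a positive multiple of an entry of \<open>R\<close>, and that entry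
  is the same at all points of the edge.\<close>

lemma T'_sign:
  assumes "s \<in> {a $ i..b $ i}"
  shows "R a $ \<sigma> i $ i > 0 \<Longrightarrow> T' i s > 0" "R a $ \<sigma> i $ i < 0 \<Longrightarrow> T' i s < 0"
  using mixing_functions_partial_nonzero[OF f(1)] mixing_functions_partial_nonzero[OF g(1)]
  by (simp_all add: T'_def gram_eq R_edge_point[OF assms] zero_less_mult_iff mult_less_0_iff divide_less_0_iff)

lemma continuous_on_T: "continuous_on {a $ i..b $ i} (T i)"
  using T_derivative DERIV_continuous_on by blast

text \<open>Every other coordinate of \<open>h\<close> has zero derivative along the edge, by the
  zero pattern of \<open>R\<close>: the edge is mapped into a line parallel to an axis.\<close>

lemma h_edge_point:
  assumes s: "s \<in> {a $ i..b $ i}"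
  shows "h (edge_point i s) = h a + (T i s - h a $ \<sigma> i) *\<^sub>R axis (\<sigma> i) 1"
proof -
  have "h (edge_point i s) $ k = h a $ k" if k: "k \<noteq> \<sigma> i" for k
  proof -
    have "((\<lambda>s. h (edge_point i s) $ k) has_field_derivative 0) (at s within {a $ i..b $ i})"
      if "s \<in> {a $ i..b $ i}" for s
      using edge_derivative[OF that, of k] corner_perm(3)[OF k] by (simp add: gram_eq R_edge_point[OF that])
    then obtain c where "\<And>s. s \<in> {a $ i..b $ i} \<Longrightarrow> h (edge_point i s) $ k = c"
      using has_field_derivative_zero_constant[of "{a $ i..b $ i}" "\<lambda>s. h (edge_point i s) $ k"] by auto
    from this[OF s] this[of "a $ i"] show ?thesis
      using ab(1)[of i] by (simp add: edge_point_corner)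
  qed
  then show ?thesis
    by (auto simp: vec_eq_iff axis_def T_def)
qed

lemma smooth_T: "smooth_map_on {a $ i..b $ i} (T i)"
  unfolding smooth_map_on_def
proof
  fix s assume s: "s \<in> {a $ i..b $ i}"
  obtain U F where UF: "edge_point i s \<in> U" "smooth_on_open U F" "\<And>y. y \<in> cbox a b \<inter> U \<Longrightarrow> F y = h y"
    using h_local_extension[OF edge_point_in[OF s]] by metis
  have eq: "edge_point i = (\<lambda>s. (a + (- a $ i) *\<^sub>R axis i 1) + s *\<^sub>R axis i 1)"
    by (simp add: fun_eq_iff edge_point_def algebra_simps)
  have sm: "smooth_on_open UNIV (edge_point i)"
    unfolding eq by (intro smooth_on_open_add smooth_on_open_const smooth_on_open_linear bounded_linear_scaleR_left) auto
  have op: "open (edge_point i -` U)"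
    using open_vimage[OF smooth_on_openD(1)[OF UF(2)]] smooth_on_openD(3)[OF sm] by blast
  have "smooth_on_open (edge_point i -` U) (\<lambda>t. F (edge_point i t))"
    by (rule smooth_on_open_compose[OF UF(2) smooth_on_open_subset[OF sm op]]) auto
  then have "smooth_on_open (edge_point i -` U) (\<lambda>t. F (edge_point i t) $ \<sigma> i)"
    by (rule smooth_on_open_linear_comp[OF bounded_linear_vec_nth])
  moreover have "F (edge_point i t) $ \<sigma> i = T i t" if "t \<in> {a $ i..b $ i} \<inter> edge_point i -` U" for t
    using UF(3)[of "edge_point i t"] edge_point_in that by (simp add: T_def)
  ultimately show "\<exists>U F. s \<in> U \<and> smooth_on_open U F \<and> (\<forall>y\<in>{a $ i..b $ i} \<inter> U. F y = T i y)"
    using UF(1) by blast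
qed

text \<open>\<open>f\<close> on the image line, evaluated at \<open>T i s\<close>, equals
  \<open>g\<close> on the edge at \<open>s\<close>. Any component of \<open>f\<close> with nonzero
  derivative along the line can be inverted in one variable.\<close>

lemma analytic_T: "analytic_real_on {a $ i..b $ i} (T i)"
proof (rule analytic_real_on_inverse[OF continuous_on_T])
  fix s assume s: "s \<in> {a $ i..b $ i}"
  let ?k = "\<sigma> i"
  \<comment> \<open>The line through \<open>h a\<close> that contains the image of the edge,
    parametrized by its moving coordinate.\<close>
  let ?c = "\<lambda>y. h a + (y - h a $ ?k) *\<^sub>R axis ?k 1"
  obtain m where m: "partial f ?k (h (edge_point i s)) $ m \<noteq> 0"
    using mixing_functions_partial_nonzero[OF f(1)] by (metis vec_eq_iff zero_index)
  have rf: "real_analytic f" and rg: "real_analytic g"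
    using f(1) g(1) by (simp_all add: mixing_functions_def)
  have cj: "?c y $ j = (h a $ j - h a $ ?k * axis ?k 1 $ j) + axis ?k 1 $ j * y" for j y
    by (simp add: algebra_simps)
  have F: "analytic_real_on UNIV (\<lambda>y. f (?c y) $ m)"
    by (rule analytic_real_on_real_analytic_compose[OF rf]) (simp only: cj analytic_real_on_affine)
  have ej: "edge_point i y $ j = (a $ j - a $ i * axis i 1 $ j) + axis i 1 $ j * y" for j y
    by (simp add: edge_point_def algebra_simps)
  have G: "analytic_real_on {a $ i..b $ i} (\<lambda>y. g (edge_point i y) $ m)"
    by (rule analytic_real_on_real_analytic_compose[OF rg]) (simp only: ej analytic_real_on_affine)
  have D: "(f has_derivative frechet_derivative f (at (?c (T i s)))) (at (?c (T i s)))"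
    by (rule smooth_on_openD(4)[OF mixing_functions_smooth[OF f(1)] UNIV_I])
  have "(?c has_derivative (\<lambda>t. t *\<^sub>R axis ?k 1)) (at (T i s))"
    by (auto intro!: derivative_eq_intros)
  then have "((\<lambda>y. f (?c y)) has_derivative (\<lambda>t. frechet_derivative f (at (?c (T i s))) (t *\<^sub>R axis ?k 1))) (at (T i s))"
    by (rule has_derivative_compose) (rule D)
  then have "((\<lambda>y. f (?c y) $ m) has_derivative (\<lambda>t. frechet_derivative f (at (?c (T i s))) (t *\<^sub>R axis ?k 1) $ m)) (at (T i s))"
    by (rule bounded_linear.has_derivative[OF bounded_linear_vec_nth])
  moreover have "frechet_derivative f (at (?c (T i s))) (t *\<^sub>R axis ?k 1) $ m = partial f ?k (?c (T i s)) $ m * t" for t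
    using linear_cmul[OF has_derivative_linear[OF D]] by simp
  ultimately have "((\<lambda>y. f (?c y) $ m) has_real_derivative partial f ?k (?c (T i s)) $ m) (at (T i s))"
    by (simp add: has_field_derivative_def)
  moreover have "partial f ?k (?c (T i s)) $ m \<noteq> 0"
    using m unfolding h_edge_point[OF s] .
  moreover have "f (?c (T i y)) $ m = g (edge_point i y) $ m" if "y \<in> {a $ i..b $ i}" for y
    using gfh[OF edge_point_in[OF that]] h_edge_point[OF that] by simp
  ultimately show "\<exists>F F' G. analytic_real_on UNIV F \<and> (F has_real_derivative F') (at (T i s)) \<and>
      F' \<noteq> 0 \<and> analytic_real_on {a $ i..b $ i} G \<and> (\<forall>y\<in>{a $ i..b $ i}. F (T i y) = G y)"
    using F G by blast
qed

section \<open>Agreement of the transition map with its coordinatewise form\<close>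

definition H :: "real^'d \<Rightarrow> real^'d" where
  "H u = (\<chi> k. T (inv \<sigma> k) (u $ inv \<sigma> k))"

lemma H_nth: "H u $ \<sigma> i = T i (u $ i)"
  by (simp add: H_def)

text \<open>Each coordinate of \<open>H u\<close> is the same coordinate of \<open>h\<close> at some
  edge point, and the target is a product of intervals.\<close>

lemma H_in:
  assumes "u \<in> cbox a b"
  shows "H u \<in> cbox a' b'"
proof -
  have "a' $ k \<le> H u $ k \<and> H u $ k \<le> b' $ k" for k
  proof -
    have "u $ inv \<sigma> k \<in> {a $ inv \<sigma> k..b $ inv \<sigma> k}"
      using assms by (simp add: mem_box_cart)
    from h_in[OF edge_point_in[OF this]] show ?thesis
      by (simp add: H_def T_def mem_box_cart)
  qed
  then show ?thesis by (simp add: mem_box_cart)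
qed

text \<open>An entry of the derivative of \<open>h\<close> is the entry of \<open>R\<close> times
  such a ratio, so bounds on \<open>R\<close> become bounds on that derivative.\<close>

lemma partial_ratio_bounded:
  "\<exists>K\<ge>0. \<forall>u\<in>cbox a b. \<forall>j k. norm (partial g j u) / norm (partial f k (h u)) \<le> K"
proof -
  let ?q = "\<lambda>j k u. norm (partial g j u) / norm (partial f k (h u))"
  have "continuous_on (cbox a b) (\<lambda>u. partial f k (h u))" for k
    by (rule continuous_on_compose2[OF smooth_on_openD(3)[OF smooth_on_openD(5)[OF mixing_functions_smooth[OF f(1)]]] continuous_on_h]) simp
  moreover have "continuous_on (cbox a b) (\<lambda>u. partial g j u)" for j
    by (rule continuous_on_subset[OF smooth_on_openD(3)[OF smooth_on_openD(5)[OF mixing_functions_smooth[OF g(1)]]]]) simp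
  ultimately have "continuous_on (cbox a b) (\<lambda>u. \<Sum>j\<in>UNIV. \<Sum>k\<in>UNIV. ?q j k u)"
    using mixing_functions_partial_nonzero[OF f(1)] by (intro continuous_intros) auto
  then have "bounded ((\<lambda>u. \<Sum>j\<in>UNIV. \<Sum>k\<in>UNIV. ?q j k u) ` cbox a b)"
    by (intro compact_imp_bounded compact_continuous_image compact_cbox)
  then obtain K where K: "K > 0" "\<And>u. u \<in> cbox a b \<Longrightarrow> \<bar>\<Sum>j\<in>UNIV. \<Sum>k\<in>UNIV. ?q j k u\<bar> \<le> K"
    unfolding bounded_pos by auto
  have "?q j k u \<le> K" if u: "u \<in> cbox a b" for u j k
  proof -
    have "?q j k u \<le> (\<Sum>k\<in>UNIV. ?q j k u)"
      by (rule member_le_sum[of k UNIV "\<lambda>k. ?q j k u"]) auto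
    also have "\<dots> \<le> (\<Sum>j\<in>UNIV. \<Sum>k\<in>UNIV. ?q j k u)"
      by (rule member_le_sum[of j UNIV "\<lambda>j. \<Sum>k\<in>UNIV. ?q j k u"]) (auto intro: sum_nonneg)
    also have "\<dots> \<le> K" using K(2)[OF u] by simp
    finally show ?thesis .
  qed
  then show ?thesis using K(1) by (intro exI[of _ K]) auto
qed

lemma f_Lipschitz:
  "\<exists>L\<ge>0. \<forall>x\<in>cbox a' b'. \<forall>y\<in>cbox a' b'. norm (f x - f y) \<le> L * norm (x - y)"
proof -
  have "continuous_on (cbox a' b') (\<lambda>x. partial f k x)" for k
    by (rule continuous_on_subset[OF smooth_on_openD(3)[OF smooth_on_openD(5)[OF mixing_functions_smooth[OF f(1)]]]]) simp
  then have "continuous_on (cbox a' b') (\<lambda>x. \<Sum>k\<in>UNIV. norm (partial f k x))"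
    by (intro continuous_intros)
  then have "bounded ((\<lambda>x. \<Sum>k\<in>UNIV. norm (partial f k x)) ` cbox a' b')"
    by (intro compact_imp_bounded compact_continuous_image compact_cbox)
  then obtain L where L: "L > 0" "\<And>x. x \<in> cbox a' b' \<Longrightarrow> \<bar>\<Sum>k\<in>UNIV. norm (partial f k x)\<bar> \<le> L"
    unfolding bounded_pos by auto
  note D = smooth_on_openD(4)[OF mixing_functions_smooth[OF f(1)] UNIV_I]
  have "norm (f x - f y) \<le> L * norm (x - y)" if "x \<in> cbox a' b'" "y \<in> cbox a' b'" for x y
  proof (rule differentiable_bound[OF convex_box(1) _ _ that])
    show "(f has_derivative frechet_derivative f (at x)) (at x within cbox a' b')" for x
      using D has_derivative_at_withinI by blast
    show "onorm (frechet_derivative f (at x)) \<le> L" if x: "x \<in> cbox a' b'" for x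
    proof (rule onorm_bound)
      show "0 \<le> L" using L(1) by simp
      fix v
      have "norm (frechet_derivative f (at x) v) \<le> (\<Sum>k\<in>UNIV. norm (v $ k *\<^sub>R partial f k x))"
        by (subst linear_eq_sum_axis[OF has_derivative_linear[OF D]]) (rule norm_sum)
      also have "\<dots> \<le> (\<Sum>k\<in>UNIV. norm v * norm (partial f k x))"
        unfolding norm_scaleR real_norm_def by (intro sum_mono mult_right_mono component_le_norm_cart) auto
      also have "\<dots> = (\<Sum>k\<in>UNIV. norm (partial f k x)) * norm v"
        by (simp add: sum_distrib_left sum_distrib_right mult_ac)
      also have "\<dots> \<le> L * norm v"
        using L(2)[OF x] by (intro mult_right_mono) auto
      finally show "norm (frechet_derivative f (at x) v) \<le> L * norm v" .
    qed
  qed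
  then show ?thesis using L(1) by (intro exI[of _ L]) auto
qed

text \<open>Coordinate \<open>\<sigma> i\<close> of \<open>H\<close> and \<open>h\<close> agree at
  the edge point with the same \<open>i\<close>-th coordinate as \<open>u\<close>. On the segment
  from there to \<open>u\<close> coordinate \<open>i\<close> is fixed, so \<open>\<sigma> i\<close>
  of \<open>h\<close> changes only through entries of \<open>R\<close> that vanish at the corner,
  and these are flat.\<close>

lemma H_minus_h_flat:
  "\<exists>C \<delta>. C \<ge> 0 \<and> \<delta> > 0 \<and> (\<forall>u\<in>cbox a b \<inter> ball a \<delta>. norm (H u - h u) \<le> C * norm (u - a) ^ N)"
proof -
  obtain C \<delta> where C: "C \<ge> 0" "\<delta> > 0"
    "\<And>u k i. u \<in> cbox a b \<Longrightarrow> u \<in> ball a \<delta> \<Longrightarrow> \<bar>R u $ k $ i - R a $ k $ i\<bar> \<le> C * norm (u - a) ^ N"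
    using R_flat[of N] by (metis IntI)
  obtain K where K: "K \<ge> 0" "\<And>u j k. u \<in> cbox a b \<Longrightarrow> norm (partial g j u) / norm (partial f k (h u)) \<le> K"
    using partial_ratio_bounded by blast
  define B where "B u = real CARD('d) * (C * norm (u - a) ^ N * K)" for u
  have comp: "\<bar>(H u - h u) $ \<sigma> i\<bar> \<le> B u" if u: "u \<in> cbox a b" "u \<in> ball a (min \<delta> 1)" for u i
  proof -
    define y where "y = edge_point i (u $ i)"
    define w where "w = u - y"
    have ui: "u $ i \<in> {a $ i..b $ i}" using u(1) by (simp add: mem_box_cart)
    have y: "y \<in> cbox a b" using edge_point_in[OF ui] by (simp add: y_def)
    have yw: "y + w = u" by (simp add: w_def)
    have wj: "w $ j = (if j = i then 0 else u $ j - a $ j)" for j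
      by (simp add: w_def y_def edge_point_nth)
    have nu: "norm (u - a) < \<delta>" "norm (u - a) \<le> 1"
      using u(2) by (auto simp: dist_norm norm_minus_commute)
    let ?\<phi> = "\<lambda>t. h (y + t *\<^sub>R w) $ \<sigma> i"
    have "norm (?\<phi> 1 - ?\<phi> 0) \<le> B u * norm (1 - 0 :: real)"
    proof (rule field_differentiable_bound[of "{0..1}" ?\<phi> "\<lambda>t. h' (y + t *\<^sub>R w) w $ \<sigma> i"])
      fix t :: real assume t: "t \<in> {0..1}"
      let ?p = "y + t *\<^sub>R w"
      have yw_in: "y + w \<in> cbox a b" using u(1) yw by simp
      show "(?\<phi> has_real_derivative h' ?p w $ \<sigma> i) (at t within {0..1})"
        by (rule h_derivative_segment[OF y yw_in t])
      have p: "?p \<in> cbox a b" by (rule segment_in[OF y yw_in t])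
      \<comment> \<open>Relative to the corner, coordinate \<open>i\<close> equals that of
        \<open>u\<close> and the others are scaled by \<open>t\<close>; the flatness bound at
        \<open>u\<close> thus serves the whole segment.\<close>
      have pa: "norm (?p - a) \<le> norm (u - a)"
      proof (rule norm_le_componentwise_cart)
        fix j
        have "(?p - a) $ j = (if j = i then u $ i - a $ i else t * (u $ j - a $ j))"
          by (simp add: wj y_def edge_point_nth)
        then show "norm ((?p - a) $ j) \<le> norm ((u - a) $ j)"
          using t by (auto simp: abs_mult intro: mult_left_le_one_le)
      qed
      have pb: "?p \<in> ball a \<delta>" using pa nu(1) by (simp add: dist_norm norm_minus_commute)
      have summand: "norm (w $ j * (h' ?p (axis j 1) $ \<sigma> i)) \<le> C * norm (u - a) ^ N * K" for j
      proof (cases "j = i")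
        case True
        then show ?thesis using C(1) K(1) by (simp add: wj)
      next
        case False
        then have "\<sigma> i \<noteq> \<sigma> j" using corner_perm(1) by (metis corner_perm_inv(2))
        then have "\<bar>R ?p $ \<sigma> i $ j\<bar> \<le> C * norm (?p - a) ^ N"
          using C(3)[OF p pb, of "\<sigma> i" j] corner_perm(3)[of "\<sigma> i" j] by simp
        also have "\<dots> \<le> C * norm (u - a) ^ N"
          using pa C(1) by (intro mult_left_mono power_mono) auto
        finally have Rp: "\<bar>R ?p $ \<sigma> i $ j\<bar> \<le> C * norm (u - a) ^ N" .
        have "h' ?p (axis j 1) $ \<sigma> i = R ?p $ \<sigma> i $ j * (norm (partial g j ?p) / norm (partial f (\<sigma> i) (h ?p)))"
          using mixing_functions_partial_nonzero[OF f(1)]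
          by (simp add: h'_axis gram_eq power2_eq_square)
        then have "\<bar>h' ?p (axis j 1) $ \<sigma> i\<bar> \<le> C * norm (u - a) ^ N * K"
          using mult_mono[OF Rp K(2)[OF p, of j "\<sigma> i"]] C(1) by (simp add: abs_mult)
        moreover have "\<bar>w $ j\<bar> \<le> 1"
          using component_le_norm_cart[of "u - a" j] nu(2) by (simp add: wj)
        ultimately show ?thesis
          using mult_mono[of "\<bar>w $ j\<bar>" 1 "\<bar>h' ?p (axis j 1) $ \<sigma> i\<bar>" "C * norm (u - a) ^ N * K"]
          by (simp add: abs_mult)
      qed
      have "h' ?p w = (\<Sum>j\<in>UNIV. w $ j *\<^sub>R h' ?p (axis j 1))"
        by (rule linear_eq_sum_axis[OF linear_h'[OF p]])
      then have "h' ?p w $ \<sigma> i = (\<Sum>j\<in>UNIV. w $ j * (h' ?p (axis j 1) $ \<sigma> i))"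
        by (simp add: sum_component)
      also have "norm \<dots> \<le> (\<Sum>j\<in>(UNIV::'d set). C * norm (u - a) ^ N * K)"
        by (rule sum_norm_le) (rule summand)
      finally show "norm (h' ?p w $ \<sigma> i) \<le> B u"
        by (simp add: B_def)
    qed auto
    moreover have "?\<phi> 1 = h u $ \<sigma> i" "?\<phi> 0 = H u $ \<sigma> i"
      using yw by (simp_all add: H_nth T_def y_def)
    ultimately show ?thesis
      by (simp add: abs_minus_commute)
  qed
  have "norm (H u - h u) \<le> (real CARD('d) * (real CARD('d) * (C * K))) * norm (u - a) ^ N"
    if u: "u \<in> cbox a b" "u \<in> ball a (min \<delta> 1)" for u
  proof -
    have "\<bar>(H u - h u) $ k\<bar> \<le> B u" for k
      using comp[OF u, of "inv \<sigma> k"] by simp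
    then have "norm (H u - h u) \<le> real CARD('d) * B u"
      by (rule norm_le_of_component_le)
    then show ?thesis by (simp add: B_def mult_ac)
  qed
  then show ?thesis
    using C(1,2) K(1) by (intro exI[of _ "real CARD('d) * (real CARD('d) * (C * K))"] exI[of _ "min \<delta> 1"]) auto
qed

text \<open>The comparison takes place after applying \<open>f\<close>, since \<open>f\<close>
  composed with \<open>h\<close> is the analytic map \<open>g\<close>; injectivity of
  \<open>f\<close> brings the equality back.\<close>

lemma h_eq_H:
  assumes u: "u \<in> cbox a b"
  shows "h u = H u"
proof -
  let ?p = "\<lambda>s. a + s *\<^sub>R (u - a)"
  have p: "?p s \<in> cbox a b" if "s \<in> {0..1}" for s
    using segment_in[OF corner_in _ that, of "u - a"] u by simp
  have rf: "real_analytic f" and rg: "real_analytic g"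
    using f(1) g(1) by (simp_all add: mixing_functions_def)
  obtain L where L: "L \<ge> 0" "\<And>x y. x \<in> cbox a' b' \<Longrightarrow> y \<in> cbox a' b' \<Longrightarrow> norm (f x - f y) \<le> L * norm (x - y)"
    using f_Lipschitz by blast
  have "f (H u) $ m = g u $ m" for m
  proof -
    define \<phi> where "\<phi> s = f (H (?p s)) $ m - g (?p s) $ m" for s
    have pj: "?p s $ j = a $ j + (u $ j - a $ j) * s" for s j
      by simp
    have "analytic_real_on {0..1} (\<lambda>s. H (?p s) $ k)" for k
    proof -
      let ?j = "inv \<sigma> k"
      have "analytic_real_on {0..1} (\<lambda>s. T ?j (a $ ?j + (u $ ?j - a $ ?j) * s))"
      proof (rule analytic_real_on_compose[OF analytic_T analytic_real_on_affine])
        show "(\<lambda>s. a $ ?j + (u $ ?j - a $ ?j) * s) ` {0..1} \<subseteq> {a $ ?j..b $ ?j}"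
          using p unfolding pj[symmetric] mem_box_cart by auto
      qed
      then show ?thesis unfolding H_def vec_lambda_beta pj .
    qed
    then have "analytic_real_on {0..1} (\<lambda>s. f (H (?p s)) $ m)"
      by (rule analytic_real_on_real_analytic_compose[OF rf])
    moreover have "analytic_real_on {0..1} (\<lambda>s. g (?p s) $ m)"
      by (rule analytic_real_on_real_analytic_compose[OF rg]) (simp only: pj analytic_real_on_affine)
    ultimately have an: "analytic_real_on {0..1} \<phi>"
      unfolding \<phi>_def by (rule analytic_real_on_diff)
    have "\<phi> 1 = 0"
    proof (rule analytic_real_on_flat_eq_0[OF an])
      fix N :: nat
      obtain C \<delta> where C: "C \<ge> 0" "\<delta> > 0"
        "\<And>u. u \<in> cbox a b \<Longrightarrow> u \<in> ball a \<delta> \<Longrightarrow> norm (H u - h u) \<le> C * norm (u - a) ^ N"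
        using H_minus_h_flat[of N] by (metis IntI)
      \<comment> \<open>Parameters below this bound stay within distance \<open>\<delta>\<close> of
        the corner; the added 1 covers \<open>u = a\<close>.\<close>
      let ?d = "\<delta> / (norm (u - a) + 1)"
      have "\<bar>\<phi> s\<bar> \<le> L * (C * norm (u - a) ^ N) * s ^ N" if s: "s \<in> {0..1}" "s < ?d" for s
      proof -
        have n: "norm (?p s - a) = s * norm (u - a)"
          using s(1) by simp
        also have "\<dots> \<le> s * (norm (u - a) + 1)"
          using s(1) by (intro mult_left_mono) auto
        also have "\<dots> < \<delta>"
          using s(2) by (simp add: pos_less_divide_eq add_nonneg_pos)
        finally have "?p s \<in> ball a \<delta>"
          by (simp add: dist_norm norm_minus_commute)
        then have Hh: "norm (H (?p s) - h (?p s)) \<le> C * norm (?p s - a) ^ N"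
          using C(3) p[OF s(1)] by blast
        have "\<bar>\<phi> s\<bar> = \<bar>(f (H (?p s)) - f (h (?p s))) $ m\<bar>"
          by (simp add: \<phi>_def gfh[OF p[OF s(1)]])
        also have "\<dots> \<le> norm (f (H (?p s)) - f (h (?p s)))"
          by (rule component_le_norm_cart)
        also have "\<dots> \<le> L * norm (H (?p s) - h (?p s))"
          by (rule L(2)[OF H_in[OF p[OF s(1)]] h_in[OF p[OF s(1)]]])
        also have "\<dots> \<le> L * (C * norm (?p s - a) ^ N)"
          by (rule mult_left_mono[OF Hh L(1)])
        also have "\<dots> = L * (C * norm (u - a) ^ N) * s ^ N"
          unfolding n by (simp add: power_mult_distrib mult_ac)
        finally show ?thesis .
      qed
      moreover have "?d > 0" using C(2) by (simp add: add_nonneg_pos)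
      ultimately show "\<exists>K \<delta>. \<delta> > 0 \<and> (\<forall>s\<in>{0..1}. s < \<delta> \<longrightarrow> \<bar>\<phi> s\<bar> \<le> K * s ^ N)"
        by blast
    qed
    then show ?thesis by (simp add: \<phi>_def)
  qed
  then have "f (H u) = f (h u)"
    using gfh[OF u] by (simp add: vec_eq_iff)
  then show ?thesis
    using injD[OF mixing_functions_inj[OF f(1)]] by metis
qed

text \<open>The derivative of \<open>T i\<close> has one sign on the whole interval; the decreasing
  case is reduced to the increasing one by negation.\<close>

lemma ex_T_extension:
  "\<exists>\<tau>. smooth_on_open UNIV \<tau> \<and> strictly_monotone_on UNIV \<tau> \<and> (\<forall>s\<in>{a $ i..b $ i}. \<tau> s = T i s)"
proof -
  consider "R a $ \<sigma> i $ i > 0" | "R a $ \<sigma> i $ i < 0"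
    using corner_perm(2)[of i] by linarith
  then show ?thesis
  proof cases
    case 1
    obtain \<tau> where "smooth_on_open UNIV \<tau>" "strict_mono \<tau>" "\<And>s. s \<in> {a $ i..b $ i} \<Longrightarrow> \<tau> s = T i s"
      using smooth_strict_mono_extension[OF ab(1) smooth_T T_derivative T'_sign(1)[OF _ 1]] by metis
    then show ?thesis
      unfolding strictly_monotone_on_def by blast
  next
    case 2
    have neg: "bounded_linear (\<lambda>x::real. - x)"
      by (rule bounded_linear_minus[OF bounded_linear_ident])
    have sm: "smooth_map_on {a $ i..b $ i} (\<lambda>s. - T i s)"
      unfolding smooth_map_on_def
    proof
      fix s assume "s \<in> {a $ i..b $ i}"
      then obtain U F where "s \<in> U" "smooth_on_open U F" "\<forall>y\<in>{a $ i..b $ i} \<inter> U. F y = T i y"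
        using smooth_T unfolding smooth_map_on_def by blast
      then show "\<exists>U F. s \<in> U \<and> smooth_on_open U F \<and> (\<forall>y\<in>{a $ i..b $ i} \<inter> U. F y = - T i y)"
        using smooth_on_open_linear_comp[OF neg, of U F] by (intro exI[of _ U] exI[of _ "\<lambda>x. - F x"]) simp
    qed
    have pos: "- T' i s > 0" if "s \<in> {a $ i..b $ i}" for s
      using T'_sign(2)[OF that 2] by simp
    obtain \<tau> where \<tau>: "smooth_on_open UNIV \<tau>" "strict_mono \<tau>" "\<And>s. s \<in> {a $ i..b $ i} \<Longrightarrow> \<tau> s = - T i s"
      using smooth_strict_mono_extension[OF ab(1) sm DERIV_minus[OF T_derivative] pos] by metis
    have "strict_antimono_on UNIV (\<lambda>x. - \<tau> x)"
      using \<tau>(2) by (simp add: monotone_on_def strict_mono_def)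
    then show ?thesis
      using smooth_on_open_linear_comp[OF neg \<tau>(1)] \<tau>(3)
      by (intro exI[of _ "\<lambda>x. - \<tau> x"]) (simp add: strictly_monotone_on_def)
  qed
qed

lemma ex_elementwise_reparameterization:
  "\<exists>P t. coordinate_permutation P \<and> elementwise_reparameterization t \<and> (\<forall>u\<in>cbox a b. h u = (P \<circ> t) u)"
proof -
  have "\<forall>i. \<exists>\<tau>. smooth_on_open UNIV \<tau> \<and> strictly_monotone_on UNIV \<tau> \<and> (\<forall>s\<in>{a $ i..b $ i}. \<tau> s = T i s)"
    using ex_T_extension by blast
  then obtain \<tau> where \<tau>: "\<And>i. smooth_on_open UNIV (\<tau> i)" "\<And>i. strictly_monotone_on UNIV (\<tau> i)"
    "\<And>i s. s \<in> {a $ i..b $ i} \<Longrightarrow> \<tau> i s = T i s"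
    by metis
  \<comment> \<open>The inverse permutation appears because coordinate \<open>k\<close> of
    \<open>h\<close> depends on latent coordinate \<open>inv \<sigma> k\<close>.\<close>
  define P :: "real^'d \<Rightarrow> real^'d" where "P z = (\<chi> k. z $ inv \<sigma> k)" for z
  have "coordinate_permutation P"
    unfolding coordinate_permutation_def P_def using bij_imp_bij_inv[OF corner_perm(1)] by blast
  moreover have "elementwise_reparameterization (coordinatewise \<tau>)"
    unfolding elementwise_reparameterization_def using \<tau>(1,2) by (intro exI[of _ \<tau>]) simp
  moreover have "h u = (P \<circ> coordinatewise \<tau>) u" if "u \<in> cbox a b" for u
    unfolding h_eq_H[OF that] using that \<tau>(3)
    by (simp add: vec_eq_iff H_def P_def coordinatewise_def mem_box_cart)
  ultimately show ?thesis by blast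
qed

end

text \<open>Makes \<open>inv\<close> of the reparameterization a genuine left inverse, also when
  some component has a range smaller than the line.\<close>

lemma inj_elementwise_reparameterization:
  assumes "elementwise_reparameterization t"
  shows "inj t"
proof -
  obtain \<tau> where "(\<forall>i. strictly_monotone_on UNIV (\<tau> i) \<and> smooth_on_open UNIV (\<tau> i)) \<and> t = coordinatewise \<tau>"
    using assms unfolding elementwise_reparameterization_def by (rule exE)
  then have \<tau>: "\<And>i. strictly_monotone_on UNIV (\<tau> i)" "t = coordinatewise \<tau>"
    by simp_all
  have inj: "inj (\<tau> i)" for i
    using strictly_monotone_on_imp_inj_on[OF \<tau>(1)] .
  show ?thesis
  proof (rule injI)
    fix x y assume "t x = t y"
    then have "\<tau> i (x $ i) = \<tau> i (y $ i)" for i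
      by (simp add: \<tau>(2) coordinatewise_def vec_eq_iff)
    then have "x $ i = y $ i" for i
      by (rule injD[OF inj])
    then show "x = y"
      by (simp add: vec_eq_iff)
  qed
qed

lemma continuous_on_elementwise_reparameterization:
  assumes "elementwise_reparameterization t"
  shows "continuous_on UNIV t"
proof -
  obtain \<tau> where "(\<forall>i. strictly_monotone_on UNIV (\<tau> i) \<and> smooth_on_open UNIV (\<tau> i)) \<and> t = coordinatewise \<tau>"
    using assms unfolding elementwise_reparameterization_def by (rule exE)
  then have \<tau>: "\<And>i. smooth_on_open UNIV (\<tau> i)" "t = coordinatewise \<tau>"
    by simp_all
  have "continuous_on UNIV (\<lambda>z :: real^'a. \<tau> i (z $ i))" for i
    by (rule continuous_on_compose2[OF smooth_on_openD(3)[OF \<tau>(1)]]) (auto intro: continuous_intros)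
  then show ?thesis
    unfolding \<tau>(2) coordinatewise_def by (rule continuous_on_vec_lambda)
qed

lemma coordinate_permutation_inj_continuous:
  assumes "coordinate_permutation P"
  shows "inj P" "continuous_on UNIV P"
proof -
  obtain \<pi> where \<pi>: "bij \<pi>" "P = (\<lambda>z. \<chi> i. z $ \<pi> i)"
    using assms unfolding coordinate_permutation_def by blast
  show "inj P"
  proof (rule injI)
    fix x y assume "P x = P y"
    then have "x $ \<pi> i = y $ \<pi> i" for i
      by (simp add: \<pi>(2) vec_eq_iff)
    then show "x = y"
      using \<pi>(1) by (metis vec_eq_iff bij_pointE)
  qed
  show "continuous_on UNIV P"
    unfolding \<pi>(2) by (intro continuous_on_vec_lambda continuous_intros)
qed

lemma functional_orthogonality_control:
  assumes M: "functional_orthogonality M" "(f, p) \<in> M" "(g, q) \<in> M"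
    and h: "diffeomorphism_betw (latent_domain q) (latent_domain p) h" "\<forall>u\<in>latent_domain q. g u = f (h u)"
  shows "pure_partials_control_mixed (latent_domain q) (relative_frame f g h)"
proof -
  have "\<forall>(g, q)\<in>M. \<forall>h. diffeomorphism_betw (latent_domain q) (latent_domain p) h \<and>
      (\<forall>u\<in>latent_domain q. g u = f (h u))
      \<longrightarrow> pure_partials_control_mixed (latent_domain q) (relative_frame f g h)"
    using bspec[OF conjunct2[OF M(1)[unfolded functional_orthogonality_def]] M(2)] by simp
  from bspec[OF this M(3)] show ?thesis
    using h by simp
qed

section \<open>Passing from equal observation laws to a transition map between boxes\<close>

theorem proposition2:
  fixes M :: "((real^'d::finite \<Rightarrow> real^'n::finite) \<times> (real^'d \<Rightarrow> real)) set"
  assumes "CARD('d) < CARD('n)"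
    and "M \<subseteq> mixing_functions \<times> latent_densities"
    and "functional_orthogonality M"
    and "\<forall>(f, p)\<in>M. full_support p"
  shows "\<forall>(f, p)\<in>M. \<forall>(g, q)\<in>M.
    pushforward f (latent_law p) = pushforward g (latent_law q) \<longrightarrow>
    (\<exists>P t. coordinate_permutation P \<and> elementwise_reparameterization t \<and>
       (\<forall>z\<in>latent_domain p. f z = (g \<circ> inv (P \<circ> t)) z) \<and>
       latent_law p = pushforward (P \<circ> t) (latent_law q))"
proof -
  have "\<exists>P t. coordinate_permutation P \<and> elementwise_reparameterization t \<and>
       (\<forall>z\<in>latent_domain p. f z = (g \<circ> inv (P \<circ> t)) z) \<and>
       latent_law p = pushforward (P \<circ> t) (latent_law q)"
    if fp: "(f, p) \<in> M" and gq: "(g, q) \<in> M"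
      and eq: "pushforward f (latent_law p) = pushforward g (latent_law q)"
    for f g :: "real^'d \<Rightarrow> real^'n" and p q
  proof -
    have f: "f \<in> mixing_functions" "orthogonal_columns f" and g: "g \<in> mixing_functions" "orthogonal_columns g"
      using assms(2,3) fp gq unfolding functional_orthogonality_def by auto
    have p: "p \<in> latent_densities"
      using assms(2) fp by auto
    obtain a' b' where box_p: "\<And>i. a' $ i < b' $ i" "latent_domain p = cbox a' b'"
      using full_support_imp_box[of p] assms(4) fp by blast
    obtain a b where box_q: "\<And>i. a $ i < b $ i" "latent_domain q = cbox a b"
      using full_support_imp_box[of q] assms(4) gq by blast
    note cont_f = smooth_on_openD(3)[OF mixing_functions_smooth[OF f(1)]]
      and cont_g = smooth_on_openD(3)[OF mixing_functions_smooth[OF g(1)]]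
      and inj_f = mixing_functions_inj[OF f(1)] and inj_g = mixing_functions_inj[OF g(1)]
    have comp: "compact (latent_domain p)" "compact (latent_domain q)"
      by (simp_all add: box_p(2) box_q(2) compact_cbox)
    have im: "f ` cbox a' b' = g ` cbox a b"
      using image_latent_domain_subset[OF cont_f cont_g comp(2) eq]
        image_latent_domain_subset[OF cont_g cont_f comp(1) eq[symmetric]]
      by (simp add: box_p(2) box_q(2))
    \<comment> \<open>Total by choice, but meaningful where \<open>g u\<close> lies in the range of
      \<open>f\<close>, in particular on the box of \<open>q\<close>.\<close>
    define h where "h u = inv f (g u)" for u
    have fh: "f (h u) = g u \<and> h u \<in> cbox a' b'" if "u \<in> cbox a b" for u
    proof -
      have "g u \<in> f ` cbox a' b'"
        unfolding im using that by (rule imageI)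
      then obtain z where "z \<in> cbox a' b'" "g u = f z" by (elim imageE)
      then show ?thesis
        by (simp add: h_def inv_f_f[OF inj_f])
    qed
    have bij: "bij_betw h (cbox a b) (cbox a' b')"
    proof (rule bij_betw_imageI)
      show "inj_on h (cbox a b)"
      proof (rule inj_onI)
        fix u v assume uv: "u \<in> cbox a b" "v \<in> cbox a b" "h u = h v"
        then have "g u = g v"
          using fh[OF uv(1)] fh[OF uv(2)] by simp
        then show "u = v" by (rule injD[OF inj_g])
      qed
      have "z \<in> h ` cbox a b" if "z \<in> cbox a' b'" for z
      proof -
        have "f z \<in> g ` cbox a b"
          unfolding im[symmetric] using that by (rule imageI)
        then obtain u where u: "u \<in> cbox a b" "f z = g u"
          by (elim imageE)
        then have "h u = z"
          using inv_f_f[OF inj_f, of z] by (simp add: h_def)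
        then show ?thesis using u(1) by blast
      qed
      then show "h ` cbox a b = cbox a' b'"
        using fh by blast
    qed
    interpret pair: orthogonal_box_pair f g h a b a' b'
      by unfold_locales (simp_all add: f g box_p(1) box_q(1) bij fh)
    \<comment> \<open>The second orthogonality condition applies only to diffeomorphisms; smoothness
      of the inverse is smoothness of \<open>h\<close> for the exchanged pair.\<close>
    have "diffeomorphism_betw (cbox a b) (cbox a' b') h"
      unfolding diffeomorphism_betw_def
      using bij pair.smooth_h orthogonal_box_pair.smooth_h[OF pair.swap] by blast
    moreover have "\<forall>u\<in>cbox a b. g u = f (h u)"
      using fh by simp
    ultimately have "pure_partials_control_mixed (cbox a b) (relative_frame f g h)"
      unfolding box_p(2)[symmetric] box_q(2)[symmetric]
      by (intro functional_orthogonality_control[OF assms(3) fp gq])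
    then interpret ctrl: controlled_box_pair f g h a b a' b'
      by unfold_locales
    obtain P t where P: "coordinate_permutation P" and t: "elementwise_reparameterization t"
      and hPt: "\<And>u. u \<in> cbox a b \<Longrightarrow> h u = (P \<circ> t) u"
      using ctrl.ex_elementwise_reparameterization by blast
    have inj: "inj (P \<circ> t)"
      using coordinate_permutation_inj_continuous(1)[OF P] inj_elementwise_reparameterization[OF t] by (rule inj_compose)
    have cont: "continuous_on UNIV (P \<circ> t)"
      using coordinate_permutation_inj_continuous(2)[OF P] continuous_on_elementwise_reparameterization[OF t]
      by (intro continuous_on_compose) (auto intro: continuous_on_subset)
    have "f z = (g \<circ> inv (P \<circ> t)) z" if "z \<in> latent_domain p" for z
    proof -
      obtain u where u: "u \<in> cbox a b" "z = h u"
        using bij \<open>z \<in> latent_domain p\<close> unfolding box_p(2) bij_betw_def by blast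
      then have "inv (P \<circ> t) z = u"
        using hPt inv_f_f[OF inj] by metis
      then show ?thesis using fh u by simp
    qed
    moreover have "latent_law p = pushforward (P \<circ> t) (latent_law q)"
    proof (rule latent_law_eq_pushforward[OF cont_f cont_g cont inj_f comp(1) p eq])
      show "(P \<circ> t) u \<in> latent_domain p \<and> f ((P \<circ> t) u) = g u" if "u \<in> latent_domain q" for u
        using fh[of u] hPt[of u] that by (simp add: box_p(2) box_q(2))
    qed
    ultimately show ?thesis using P t by blast
  qed
  then show ?thesis by blast
qed

end
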